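(* Every lexicographic extension of a Euclidean oriented matroid is Euclidean.
   Context: An oriented matroid $\mathcal{O}$ on a finite ground set $E$ is given by its covectors in $\{+,-,0\}^E$; cocircuits are the minimal nonzero covectors. Notation: $X_e$ entry, $\mathrm{supp}(X)$, $z(X)=E\setminus\mathrm{supp}(X)$, composition $X\circ Y$, $\mathrm{sep}(X,Y)=\{e:X_e=-Y_e\neq0\}$, conformal means $\mathrm{sep}=\emptyset$. With $r$ the rank of $\mathcal{M}(\mathcal{O})$, cocircuits $X\neq\pm Y$ are comodular if $z(X\circ Y)$ is a flat of rank $r-2$; then elimination of $e\in\mathrm{sep}(X,Y)$ yields the unique cocircuit $Z$ with $Z_e=0$, $\mathrm{supp}(Z)\subseteq\mathrm{supp}(X\circ Y)\setminus\{e\}$. An oriented matroid program $(\mathcal{O},g,f)$: distinct $g,f\in E$, $g$ not a loop, $f$ not a coloop. For comodular cocircuits $X,Y$ with $X_g=Y_g\ne0$ let $Z$ be the elimination of $g$ between $-X$ and $Y$; $X\to Y$ if $Z_f=+$, $X\leftarrow Y$ if $Z_f=-$, undirected if $Z_f=0$. $G_f$ has vertices the cocircuits with $Y_g=+$ and edges between conformal comodular pairs, directed so. A directed cycle is a closed sequence of pairwise distinct vertices, consecutive ones adjacent, each edge forward or undirected and at least one forward. $(\mathcal{O},g,f)$ is Euclidean if $G_f$ has no directed cycle; $\mathcal{O}$ is Euclidean if all programs $(\mathcal{O},g,f)$ with $g\ne f$, $g$ not a loop, $f$ not a coloop, are Euclidean. For an ordered subset $[e_1,\dots,e_k]$ of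 $E$ and $\alpha\in\{+,-\}^k$, the lexicographic extension $\mathcal{O}[e_1^{\alpha_1},\dots,e_k^{\alpha_k}]=\mathcal{O}\cup p$ is the single-element extension by $p$ with localization $\sigma(Y)=\alpha_iY_{e_i}$ for cocircuits $Y$, $i$ the least index with $Y_{e_i}\neq0$, and $\sigma(Y)=0$ if no such index exists. *)

theory Defs
  imports Main
begin

section \<open>Sign vectors\<close>

text \<open>
  The signs \<open>+\<close>, \<open>-\<close>, \<open>0\<close> are the integers \<open>1\<close>, \<open>-1\<close>, \<open>0\<close>.  A sign vector on \<open>E\<close> is a
  total function that vanishes outside \<open>E\<close>, so that distinct functions are distinct sign
  vectors; the negative of \<open>X\<close> is the pointwise \<open>- X\<close>.
\<close>

type_synonym 'a signvec = "'a \<Rightarrow> int"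

definition sign_vectors :: "'a set \<Rightarrow> 'a signvec set" where
  "sign_vectors E = {X. (\<forall>e. X e \<in> {1, -1, 0}) \<and> (\<forall>e. e \<notin> E \<longrightarrow> X e = 0)}"

definition zero_vec :: "'a signvec" where
  "zero_vec = (\<lambda>_. 0)"

definition supp :: "'a signvec \<Rightarrow> 'a set" where
  "supp X = {e. X e \<noteq> 0}"

definition zeros :: "'a set \<Rightarrow> 'a signvec \<Rightarrow> 'a set" where
  "zeros E X = E - supp X"

definition comp_vec :: "'a signvec \<Rightarrow> 'a signvec \<Rightarrow> 'a signvec" (infixl "\<circ>\<^sub>s" 65) where
  "X \<circ>\<^sub>s Y = (\<lambda>e. if X e \<noteq> 0 then X e else Y e)"

definition sep :: "'a signvec \<Rightarrow> 'a signvec \<Rightarrow> 'a set" where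
  "sep X Y = {e. X e = - Y e \<and> X e \<noteq> 0}"

definition conformal :: "'a signvec \<Rightarrow> 'a signvec \<Rightarrow> bool" where
  "conformal X Y \<longleftrightarrow> sep X Y = {}"

text \<open>The componentwise order generated by \<open>0 < +\<close> and \<open>0 < -\<close>.\<close>

definition face_le :: "'a signvec \<Rightarrow> 'a signvec \<Rightarrow> bool" (infix "\<preceq>" 50) where
  "X \<preceq> Y \<longleftrightarrow> (\<forall>e. X e = 0 \<or> X e = Y e)"


section \<open>Oriented matroids\<close>

locale oriented_matroid =
  fixes E :: "'a set" and L :: "'a signvec set"
  assumes finite_ground: "finite E"
    and covectors_sign: "L \<subseteq> sign_vectors E"
    and covector_zero: "zero_vec \<in> L"
    and covector_neg: "X \<in> L \<Longrightarrow> - X \<in> L"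
    and covector_comp: "X \<in> L \<Longrightarrow> Y \<in> L \<Longrightarrow> X \<circ>\<^sub>s Y \<in> L"
    and covector_elim: "X \<in> L \<Longrightarrow> Y \<in> L \<Longrightarrow> e \<in> sep X Y \<Longrightarrow>
      \<exists>Z \<in> L. Z e = 0 \<and> (\<forall>h. h \<notin> sep X Y \<longrightarrow> Z h = (X \<circ>\<^sub>s Y) h)"

definition cocircuits :: "'a signvec set \<Rightarrow> 'a signvec set" where
  "cocircuits L = {X \<in> L. X \<noteq> zero_vec \<and> (\<forall>Y \<in> L. Y \<noteq> zero_vec \<longrightarrow> Y \<preceq> X \<longrightarrow> Y = X)}"

text \<open>
  The underlying matroid is the matroid on \<open>E\<close> whose cocircuits are the supports of the
  cocircuits.  In terms of cocircuits, a set \<open>S\<close> is independent iff every \<open>e \<in> S\<close> is cut out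
  of \<open>S\<close> by a cocircuit, that is, \<open>e\<close> is not in the closure of \<open>S - {e}\<close>.
\<close>

definition om_indep :: "'a set \<Rightarrow> 'a signvec set \<Rightarrow> 'a set \<Rightarrow> bool" where
  "om_indep E L S \<longleftrightarrow> S \<subseteq> E \<and> (\<forall>e \<in> S. \<exists>X \<in> cocircuits L. supp X \<inter> S = {e})"

definition om_rank :: "'a set \<Rightarrow> 'a signvec set \<Rightarrow> 'a set \<Rightarrow> nat" where
  "om_rank E L A = Max (card ` {S. S \<subseteq> A \<and> om_indep E L S})"

definition om_flat :: "'a set \<Rightarrow> 'a signvec set \<Rightarrow> 'a set \<Rightarrow> bool" where
  "om_flat E L F \<longleftrightarrow> F \<subseteq> E \<and> (\<forall>e \<in> E - F. om_rank E L F < om_rank E L (insert e F))"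

definition om_loop :: "'a set \<Rightarrow> 'a signvec set \<Rightarrow> 'a \<Rightarrow> bool" where
  "om_loop E L e \<longleftrightarrow> e \<in> E \<and> \<not> om_indep E L {e}"

definition om_coloop :: "'a set \<Rightarrow> 'a signvec set \<Rightarrow> 'a \<Rightarrow> bool" where
  "om_coloop E L e \<longleftrightarrow> e \<in> E \<and> (\<exists>X \<in> cocircuits L. supp X = {e})"

definition comodular :: "'a set \<Rightarrow> 'a signvec set \<Rightarrow> 'a signvec \<Rightarrow> 'a signvec \<Rightarrow> bool" where
  "comodular E L X Y \<longleftrightarrow> X \<in> cocircuits L \<and> Y \<in> cocircuits L \<and> X \<noteq> Y \<and> X \<noteq> - Y \<and>
     om_flat E L (zeros E (X \<circ>\<^sub>s Y)) \<and> om_rank E L (zeros E (X \<circ>\<^sub>s Y)) + 2 = om_rank E L E"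


section \<open>Oriented matroid programs\<close>

text \<open>
  For comodular \<open>X\<close>, \<open>Y\<close> and \<open>e \<in> sep X Y\<close>, vanishing at \<open>e\<close> and the support condition
  determine the cocircuit \<open>Z\<close> only up to sign.  The sign is the one given by the covector
  elimination axiom: \<open>Z\<close> agrees with \<open>X \<circ>\<^sub>s Y\<close> outside \<open>sep X Y\<close>.
\<close>

definition is_elimination ::
  "'a signvec set \<Rightarrow> 'a \<Rightarrow> 'a signvec \<Rightarrow> 'a signvec \<Rightarrow> 'a signvec \<Rightarrow> bool" where
  "is_elimination L e X Y Z \<longleftrightarrow> Z \<in> cocircuits L \<and> Z e = 0 \<and> supp Z \<subseteq> supp (X \<circ>\<^sub>s Y) - {e} \<and>
     (\<forall>h. h \<notin> sep X Y \<longrightarrow> Z h = (X \<circ>\<^sub>s Y) h)"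

definition om_program :: "'a set \<Rightarrow> 'a signvec set \<Rightarrow> 'a \<Rightarrow> 'a \<Rightarrow> bool" where
  "om_program E L g f \<longleftrightarrow> g \<in> E \<and> f \<in> E \<and> g \<noteq> f \<and> \<not> om_loop E L g \<and> \<not> om_coloop E L f"

definition program_verts :: "'a signvec set \<Rightarrow> 'a \<Rightarrow> 'a signvec set" where
  "program_verts L g = {Y \<in> cocircuits L. Y g = 1}"

definition program_edge ::
  "'a set \<Rightarrow> 'a signvec set \<Rightarrow> 'a \<Rightarrow> 'a signvec \<Rightarrow> 'a signvec \<Rightarrow> bool" where
  "program_edge E L g X Y \<longleftrightarrow> X \<in> program_verts L g \<and> Y \<in> program_verts L g \<and>
     comodular E L X Y \<and> conformal X Y"

definition forward_edge ::
  "'a set \<Rightarrow> 'a signvec set \<Rightarrow> 'a \<Rightarrow> 'a \<Rightarrow> 'a signvec \<Rightarrow> 'a signvec \<Rightarrow> bool" where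
  "forward_edge E L g f X Y \<longleftrightarrow> program_edge E L g X Y \<and>
     (\<exists>Z. is_elimination L g (- X) Y Z \<and> Z f = 1)"

definition undirected_edge ::
  "'a set \<Rightarrow> 'a signvec set \<Rightarrow> 'a \<Rightarrow> 'a \<Rightarrow> 'a signvec \<Rightarrow> 'a signvec \<Rightarrow> bool" where
  "undirected_edge E L g f X Y \<longleftrightarrow> program_edge E L g X Y \<and>
     (\<exists>Z. is_elimination L g (- X) Y Z \<and> Z f = 0)"

definition directed_cycle ::
  "'a set \<Rightarrow> 'a signvec set \<Rightarrow> 'a \<Rightarrow> 'a \<Rightarrow> 'a signvec list \<Rightarrow> bool" where
  "directed_cycle E L g f vs \<longleftrightarrow> distinct vs \<and> set vs \<subseteq> program_verts L g \<and>
     (\<forall>i < length vs.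
        forward_edge E L g f (vs ! i) (vs ! (Suc i mod length vs)) \<or>
        undirected_edge E L g f (vs ! i) (vs ! (Suc i mod length vs))) \<and>
     (\<exists>i < length vs. forward_edge E L g f (vs ! i) (vs ! (Suc i mod length vs)))"

definition euclidean_program :: "'a set \<Rightarrow> 'a signvec set \<Rightarrow> 'a \<Rightarrow> 'a \<Rightarrow> bool" where
  "euclidean_program E L g f \<longleftrightarrow> \<not> (\<exists>vs. directed_cycle E L g f vs)"

definition euclidean_om :: "'a set \<Rightarrow> 'a signvec set \<Rightarrow> bool" where
  "euclidean_om E L \<longleftrightarrow> oriented_matroid E L \<and>
     (\<forall>g f. om_program E L g f \<longrightarrow> euclidean_program E L g f)"


section \<open>Lexicographic extensions\<close>

definition om_deletion :: "'a signvec set \<Rightarrow> 'a \<Rightarrow> 'a signvec set" where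
  "om_deletion L p = (\<lambda>X. X(p := 0)) ` L"

text \<open>
  \<open>L'\<close> is the single-element extension of \<open>L\<close> by \<open>p\<close> with localization \<open>\<sigma>\<close>.  As usual for
  localizations, the extension has the same rank as \<open>L\<close>, i.e. \<open>p\<close> is not a coloop; without
  this condition \<open>\<sigma> = 0\<close> would be attached both to a loop and to a coloop.
\<close>

definition extension_with_localization ::
  "'a set \<Rightarrow> 'a signvec set \<Rightarrow> 'a \<Rightarrow> ('a signvec \<Rightarrow> int) \<Rightarrow> 'a signvec set \<Rightarrow> bool" where
  "extension_with_localization E L p \<sigma> L' \<longleftrightarrow>
     p \<notin> E \<and> oriented_matroid (insert p E) L' \<and> om_deletion L' p = L \<and>
     \<not> om_coloop (insert p E) L' p \<and>
     (\<forall>Y \<in> cocircuits L. Y(p := \<sigma> Y) \<in> cocircuits L')"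

text \<open>The list \<open>[(e\<^sub>1, \<alpha>\<^sub>1), \<dots>, (e\<^sub>k, \<alpha>\<^sub>k)]\<close> stands for the signed ordered subset.\<close>

fun lex_localization :: "('a \<times> int) list \<Rightarrow> 'a signvec \<Rightarrow> int" where
  "lex_localization [] Y = 0"
| "lex_localization ((e, \<alpha>) # es) Y = (if Y e \<noteq> 0 then \<alpha> * Y e else lex_localization es Y)"

definition lexicographic_extension ::
  "'a set \<Rightarrow> 'a signvec set \<Rightarrow> ('a \<times> int) list \<Rightarrow> 'a \<Rightarrow> 'a signvec set \<Rightarrow> bool" where
  "lexicographic_extension E L es p L' \<longleftrightarrow>
     distinct (map fst es) \<and> fst ` set es \<subseteq> E \<and> snd ` set es \<subseteq> {1, -1} \<and>
     extension_with_localization E L p (lex_localization es) L'"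

end

theory Submission
  imports Defs
begin

text \<open>
  A directed cycle is a closed walk along lines in which the objective \<open>f\<close>, measured on the affine chart
  \<open>g = 1\<close>, never decreases and increases at least once.  An extension \<open>p = [e, q]\<close> lies infinitesimally close
  to \<open>e\<close> and meets \<open>e\<close> as \<open>q\<close> does, so by induction on the list it suffices to compare the extension \<open>K\<close> by
  \<open>p\<close> with the extension \<open>N\<close> by \<open>q\<close> (carried by the same element).  A vertex \<open>W\<close> of \<open>K\<close> on \<open>p\<close> but not on \<open>e\<close>
  is infinitesimally close to a point \<open>A\<close> on \<open>e\<close>, and moving \<open>W\<close> to \<open>A\<close> turns a cycle of \<open>K\<close> into a closed walk
  of \<open>N\<close> that never decreases, hence is undirected.  What remains are ties.  They are broken
  lexicographically, by the sign of \<open>f\<close> on the direction \<open>D\<close> from \<open>A\<close> to \<open>W\<close>, by \<open>p(A)/g(A)\<close>, by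
  \<open>f(D)/e(D)\<close> and by \<open>p(D)/e(D)\<close>; each of these is again monotone along the cycle in a program that is
  already known to be Euclidean.  If \<open>A\<close> lies at infinity, the roles of \<open>f\<close> and \<open>g\<close> are exchanged first.
  In the programs in which \<open>p\<close> is the objective or lies at infinity, no vertex of a cycle is of
  this kind, apart from trivial cycles on \<open>p\<close>, and the comparison is simpler.
\<close>

section \<open>Hypersums of sign vectors\<close>

text \<open>In a realization, \<open>p\<close> is the functional \<open>\<alpha> * e + t * q\<close>
  with infinitesimal t > 0; the sign constants below are read off from this formula. Oriented
  matroids have no sums of vectors. The substitute is uniqueness on lines: in rank two, a covector
  vanishing at a given element is determined up to sign. Identities such as y = x + Z, carried over
  to other points, are obtained by placing all vectors on one line and reading the remaining sign at
  an element that vanishes at exactly one end of the edge. Images of cycles under the maps between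
  \<open>K\<close> and \<open>N\<close> need be neither simple nor conformal. Hence Euclideanness is
  restated for closed walks with arbitrary comodular steps (\<open>acyc\<close>). Moreover a cycle
  is enlarged to a strongly connected set of edges: a monotone sign is constant there, so ties can
  be broken one after another with the same edges. Two of the tie-breaks run in \<open>K\<close>
  itself with objective \<open>p\<close>. This is not circular, because that program is settled from
  \<open>N\<close> alone.\<close>

definition signs :: "'a signvec \<Rightarrow> bool" where
  "signs X \<longleftrightarrow> (\<forall>h. X h = 0 \<or> X h = 1 \<or> X h = -1)"

text \<open>\<open>vsum X Z Y\<close>: the vector \<open>Y\<close> can be the sign vector of a sum of real vectors with signs \<open>X\<close> and \<open>Z\<close>.
  Elimination of \<open>g\<close> between \<open>- X\<close> and \<open>Y\<close> yields the \<open>Z\<close> with \<open>Z g = 0\<close> and \<open>vsum X Z Y\<close>; in this form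
  the relation is symmetric up to signs.\<close>

definition vsum :: "'a signvec \<Rightarrow> 'a signvec \<Rightarrow> 'a signvec \<Rightarrow> bool" where
  "vsum X Z Y \<longleftrightarrow> (\<forall>h. (X h = 0 \<longrightarrow> Y h = Z h) \<and> (Z h = 0 \<longrightarrow> Y h = X h) \<and> (X h = Z h \<longrightarrow> Y h = X h))"

lemma signsD: "signs X \<Longrightarrow> X h = 0 \<or> X h = 1 \<or> X h = -1"
  by (simp add: signs_def)

lemma neg_neg [simp]: "- (- X) = (X :: 'a signvec)"
  by (simp add: fun_eq_iff)

lemma neg_eq_iff: "- X = Y \<longleftrightarrow> X = - (Y :: 'a signvec)"
  by (metis neg_neg)

lemma neg_eq_zero_vec [simp]: "- X = zero_vec \<longleftrightarrow> X = zero_vec"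
  by (auto simp: zero_vec_def fun_eq_iff)

lemma zero_vec_apply [simp]: "zero_vec h = 0"
  by (simp add: zero_vec_def)

lemma nonzeroE: assumes "X \<noteq> zero_vec" obtains h where "X h \<noteq> 0"
  using assms by (auto simp: zero_vec_def fun_eq_iff)

lemma supp_neg [simp]: "supp (- X) = supp X"
  by (simp add: supp_def)

lemma in_supp: "h \<in> supp X \<longleftrightarrow> X h \<noteq> 0"
  by (simp add: supp_def)

lemma supp_zero_iff: "supp X = {} \<longleftrightarrow> X = zero_vec"
  by (auto simp: supp_def zero_vec_def fun_eq_iff)

lemma vsum_rev:
  assumes "signs X" "signs Y" "signs Z" "vsum X Z Y" shows "vsum Y (- Z) X"
  unfolding vsum_def
proof
  fix h
  show "(Y h = 0 \<longrightarrow> X h = (- Z) h) \<and> ((- Z) h = 0 \<longrightarrow> X h = Y h) \<and> (Y h = (- Z) h \<longrightarrow> X h = Y h)"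
    using signsD[OF assms(1), of h] signsD[OF assms(2), of h] signsD[OF assms(3), of h] assms(4)
    unfolding vsum_def by (auto dest!: spec[of _ h])
qed

lemma vsum_neg: "vsum X Z Y \<Longrightarrow> vsum (- X) (- Z) (- Y)"
  by (auto simp: vsum_def)

lemma vsum_commute: "vsum X Z Y \<Longrightarrow> vsum Z X Y"
  by (auto simp: vsum_def)

lemma vsum_zero: "signs X \<Longrightarrow> signs Z \<Longrightarrow> vsum X Z Y \<Longrightarrow> Y h = 0 \<Longrightarrow> X h = - Z h"
  unfolding vsum_def using signsD[of X h] signsD[of Z h] by (auto dest!: spec[of _ h])

lemma vsum_l0: "vsum X Z Y \<Longrightarrow> X h = 0 \<Longrightarrow> Y h = Z h"
  and vsum_r0: "vsum X Z Y \<Longrightarrow> Z h = 0 \<Longrightarrow> Y h = X h"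
  and vsum_same: "vsum X Z Y \<Longrightarrow> X h = Z h \<Longrightarrow> Y h = X h"
  by (auto simp: vsum_def)

lemma vsum_mono:
  assumes "signs X" "signs Z" "signs Y" "vsum X Z Y"
  shows "0 \<le> Z h \<Longrightarrow> X h \<le> Y h" and "Z h \<le> 0 \<Longrightarrow> Y h \<le> X h"
  using signsD[OF assms(1), of h] signsD[OF assms(2), of h] signsD[OF assms(3), of h] assms(4)
  unfolding vsum_def by (auto dest!: spec[of _ h])

text \<open>Face order with \<open>p\<close> ignored: a point infinitesimally close to
  \<open>X\<close> is a face of \<open>X\<close> except possibly at \<open>p\<close>.\<close>

definition off_le :: "'a \<Rightarrow> 'a signvec \<Rightarrow> 'a signvec \<Rightarrow> bool" where
  "off_le p A X \<longleftrightarrow> (\<forall>h. h \<noteq> p \<longrightarrow> A h = 0 \<or> A h = X h)"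

lemma face_leI:
  assumes "signs V" "signs X" "sep V X = {}" "\<And>h. X h = 0 \<Longrightarrow> V h = 0"
  shows "V \<preceq> X"
  unfolding face_le_def
proof
  fix h
  have "\<not> (V h = - X h \<and> V h \<noteq> 0)" using assms(3) by (auto simp: sep_def)
  then show "V h = 0 \<or> V h = X h"
    using assms(4)[of h] signsD[OF assms(1), of h] signsD[OF assms(2), of h] by auto
qed

section \<open>Rank of sets of covectors\<close>

definition covs :: "'a signvec set \<Rightarrow> 'a set \<Rightarrow> 'a signvec set" where
  "covs L S = {U \<in> L. supp U \<subseteq> S}"

text \<open>\<open>rank_le L n S\<close> says that the contraction of \<open>L\<close> to \<open>S\<close> has rank at most \<open>n\<close>.\<close>

primrec rank_le :: "'a signvec set \<Rightarrow> nat \<Rightarrow> 'a set \<Rightarrow> bool" where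
  "rank_le L 0 S \<longleftrightarrow> (\<forall>U \<in> covs L S. U = zero_vec)"
| "rank_le L (Suc n) S \<longleftrightarrow> (\<forall>c. (\<exists>U \<in> covs L S. U c \<noteq> 0) \<longrightarrow> rank_le L n (S - {c}))"

lemma covs_mono: "S \<subseteq> S' \<Longrightarrow> U \<in> covs L S \<Longrightarrow> U \<in> covs L S'"
  by (auto simp: covs_def)

lemma covs_out: "U \<in> covs L S \<Longrightarrow> h \<notin> S \<Longrightarrow> U h = 0"
  by (auto simp: covs_def supp_def)

lemma covs_diff: "U \<in> covs L (S - {c}) \<longleftrightarrow> U \<in> covs L S \<and> U c = 0"
  by (auto simp: covs_def supp_def)

lemma covs_in: "U \<in> covs L S \<Longrightarrow> U \<in> L"
  by (simp add: covs_def)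

lemma rank_le_covs_mono: "covs L2 S2 \<subseteq> covs L1 S1 \<Longrightarrow> rank_le L1 n S1 \<Longrightarrow> rank_le L2 n S2"
proof (induction n arbitrary: S1 S2)
  case (Suc n)
  show ?case unfolding rank_le.simps
  proof (intro allI impI)
    fix c assume "\<exists>U \<in> covs L2 S2. U c \<noteq> 0"
    then have "rank_le L1 n (S1 - {c})" using Suc.prems by auto
    moreover have "covs L2 (S2 - {c}) \<subseteq> covs L1 (S1 - {c})"
      using Suc.prems(1) by (auto simp: covs_diff)
    ultimately show "rank_le L2 n (S2 - {c})" using Suc.IH by blast
  qed
qed auto

lemma rank_le_mono: "rank_le L n S \<Longrightarrow> S' \<subseteq> S \<Longrightarrow> rank_le L n S'"
  by (rule rank_le_covs_mono) (auto intro: covs_mono)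

lemma cocircuit_in: "X \<in> cocircuits L \<Longrightarrow> X \<in> L"
  and cocircuit_nonzero: "X \<in> cocircuits L \<Longrightarrow> X \<noteq> zero_vec"
  by (auto simp: cocircuits_def)

section \<open>Conformal elimination, cocircuits and their supports\<close>

context oriented_matroid
begin

lemma covector_signs: "X \<in> L \<Longrightarrow> signs X"
  using covectors_sign by (auto simp: signs_def sign_vectors_def)

lemma covector_supp: "X \<in> L \<Longrightarrow> supp X \<subseteq> E"
  using covectors_sign by (auto simp: sign_vectors_def supp_def)

lemma finite_supp: "X \<in> L \<Longrightarrow> finite (supp X)"
  using covector_supp finite_ground finite_subset by blast

lemma covs_signs: "U \<in> covs L S \<Longrightarrow> signs U"
  by (simp add: covector_signs covs_def)

lemma covs_neg: "U \<in> covs L S \<Longrightarrow> - U \<in> covs L S"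
  by (simp add: covector_neg covs_def)

lemma covs_elim:
  assumes "U \<in> covs L S" "V \<in> covs L S" "U c = - V c" "U c \<noteq> 0"
  shows "\<exists>Z \<in> covs L S. Z c = 0 \<and> vsum U V Z"
proof -
  have "c \<in> sep U V" using assms by (simp add: sep_def)
  then obtain Z where Z: "Z \<in> L" "Z c = 0" "\<And>h. h \<notin> sep U V \<Longrightarrow> Z h = (U \<circ>\<^sub>s V) h"
    using covector_elim[of U V c] assms by (auto simp: covs_def)
  have "vsum U V Z"
    unfolding vsum_def using Z(3) by (auto simp: sep_def comp_vec_def)
  moreover have "supp Z \<subseteq> S"
  proof
    fix h assume "h \<in> supp Z"
    then show "h \<in> S" using vsum_l0[OF \<open>vsum U V Z\<close>, of h] covs_out[OF assms(1), of h] covs_out[OF assms(2), of h]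
      by (metis in_supp)
  qed
  ultimately show ?thesis using Z by (auto simp: covs_def)
qed

text \<open>Picture \<open>V + t * X\<close> for growing t, stopped as soon as no sign is opposed to
  \<open>X\<close>: the last opposed element has just become zero. Formally this is repeated
  elimination of opposed elements, each of which strictly shrinks \<open>sep\<close>.\<close>

lemma conformal_elim:
  assumes "X \<in> L" "V \<in> L"
  shows "\<exists>V' \<in> L. sep V' X = {} \<and> (\<forall>h. h \<notin> sep V X \<longrightarrow> V' h = (V \<circ>\<^sub>s X) h) \<and>
    (sep V X \<noteq> {} \<longrightarrow> (\<exists>h \<in> sep V X. V' h = 0))"
  using assms(2)
proof (induction "card (sep V X)" arbitrary: V rule: less_induct)
  case less
  show ?case
  proof (cases "sep V X = {}")
    case True
    have "sep (V \<circ>\<^sub>s X) X = {}" using True by (auto simp: sep_def comp_vec_def split: if_splits)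
    then show ?thesis using True covector_comp[OF less.prems assms(1)]
      by (intro bexI[of _ "V \<circ>\<^sub>s X"]) auto
  next
    case False
    then obtain h where h: "h \<in> sep V X" by auto
    obtain Z where Z: "Z \<in> L" "Z h = 0" "\<And>k. k \<notin> sep V X \<Longrightarrow> Z k = (V \<circ>\<^sub>s X) k"
      using covector_elim[OF less.prems assms(1) h] by auto
    have sub: "sep Z X \<subseteq> sep V X - {h}"
      using Z(2) Z(3) by (fastforce simp: sep_def comp_vec_def split: if_splits)
    have "finite (sep V X)"
      using finite_supp[OF less.prems] by (rule rev_finite_subset) (auto simp: sep_def supp_def)
    then have "card (sep Z X) < card (sep V X)"
      using sub h by (intro psubset_card_mono) auto
    note IH = less.hyps[OF this Z(1)]
    show ?thesis
    proof (cases "sep Z X = {}")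
      case True then show ?thesis using Z h by blast
    next
      case False
      then obtain V' where V': "V' \<in> L" "sep V' X = {}" "\<And>k. k \<notin> sep Z X \<Longrightarrow> V' k = (Z \<circ>\<^sub>s X) k"
          "\<exists>k \<in> sep Z X. V' k = 0" using IH by auto
      have "V' k = (V \<circ>\<^sub>s X) k" if "k \<notin> sep V X" for k
      proof -
        have "k \<notin> sep Z X" using sub that by auto
        then show ?thesis using V'(3)[of k] Z(3)[OF that] by (simp add: comp_vec_def)
      qed
      then show ?thesis using V' sub by blast
    qed
  qed
qed

text \<open>One of \<open>Y\<close>, \<open>- Y\<close> is opposed to \<open>X\<close> somewhere.
  \<open>conformal_elim\<close> moves it to a covector properly below \<open>X\<close>, which must
  be zero, and this happens only if it was \<open>- X\<close>.\<close>

lemma cocircuit_minimal: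
  assumes "X \<in> cocircuits L" "Y \<in> L" "Y \<noteq> zero_vec" "supp Y \<subseteq> supp X"
  shows "Y = X \<or> Y = - X"
proof -
  have X: "X \<in> L" using assms by (simp add: cocircuits_def)
  have *: "U = - X" if U: "U \<in> L" "supp U \<subseteq> supp X" "sep U X \<noteq> {}" for U
  proof -
    obtain V where V: "V \<in> L" "sep V X = {}" "\<And>h. h \<notin> sep U X \<Longrightarrow> V h = (U \<circ>\<^sub>s X) h"
      "\<exists>h \<in> sep U X. V h = 0" using conformal_elim[OF X U(1)] U(3) by blast
    have sV: "signs V" "signs X" "signs U" using V X U covector_signs by auto
    have "V \<preceq> X"
    proof (rule face_leI[OF sV(1,2) V(2)])
      fix h assume "X h = 0"
      moreover from this have "U h = 0" using U(2) by (auto simp: supp_def)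
      ultimately show "V h = 0" using V(3)[of h] by (simp add: sep_def comp_vec_def)
    qed
    moreover have "V \<noteq> X" using V(4) by (auto simp: sep_def)
    ultimately have "V = zero_vec" using assms(1) V(1) by (auto simp: cocircuits_def)
    then have "\<And>h. h \<notin> sep U X \<Longrightarrow> (U \<circ>\<^sub>s X) h = 0" using V(3) by simp
    then show ?thesis by (force simp: fun_eq_iff sep_def comp_vec_def split: if_splits)
  qed
  obtain c where c: "Y c \<noteq> 0" using assms(3) by (rule nonzeroE)
  have cX: "X c \<noteq> 0" using assms(4) c by (auto simp: supp_def)
  have s: "signs X" "signs Y" using X assms(2) covector_signs by auto
  show ?thesis
  proof (cases "Y c = - X c")
    case True
    then have "sep Y X \<noteq> {}" using c by (auto simp: sep_def)
    then show ?thesis using *[OF assms(2,4)] by simp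
  next
    case False
    then have "Y c = X c" using c cX signsD[OF s(1), of c] signsD[OF s(2), of c] by auto
    then have "sep (- Y) X \<noteq> {}" using c by (auto simp: sep_def)
    then have "- Y = - X" using *[of "- Y"] assms(2,4) covector_neg by simp
    then show ?thesis by (simp add: neg_eq_iff)
  qed
qed

lemma cocircuit_neg: "X \<in> cocircuits L \<Longrightarrow> - X \<in> cocircuits L"
proof -
  assume X: "X \<in> cocircuits L"
  have "Y = - X" if "Y \<in> L" "Y \<noteq> zero_vec" "Y \<preceq> - X" for Y
  proof -
    have "- Y \<in> L" "- Y \<noteq> zero_vec" "- Y \<preceq> X"
      using that covector_neg by (auto simp: face_le_def)
    then have "- Y = X" using X by (auto simp: cocircuits_def)
    then show ?thesis by (simp add: neg_eq_iff)
  qed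
  then show ?thesis using X covector_neg by (auto simp: cocircuits_def)
qed

lemma cocircuitI:
  assumes "X \<in> L" "X \<noteq> zero_vec" "\<And>Y. Y \<in> L \<Longrightarrow> Y \<noteq> zero_vec \<Longrightarrow> supp Y \<subseteq> supp X \<Longrightarrow> Y = X \<or> Y = - X"
  shows "X \<in> cocircuits L"
proof -
  have "Y = X" if Y: "Y \<in> L" "Y \<noteq> zero_vec" "Y \<preceq> X" for Y
  proof -
    have "supp Y \<subseteq> supp X" using Y(3) by (auto simp: face_le_def supp_def)
    then consider "Y = X" | "Y = - X" using assms(3) Y by blast
    then show ?thesis
    proof cases
      case 2
      obtain c where "Y c \<noteq> 0" using Y(2) by (rule nonzeroE)
      then show ?thesis using 2 Y(3) by (auto simp: face_le_def dest!: spec[of _ c])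
    qed
  qed
  then show ?thesis using assms by (auto simp: cocircuits_def)
qed

text \<open>If a proper face \<open>Y\<close> misses \<open>c\<close>, then
  \<open>conformal_elim\<close> applied to \<open>- Y\<close> and \<open>X\<close> yields another
  proper face that contains \<open>c\<close>. So the descent to a cocircuit never has to lose
  \<open>c\<close>.\<close>

lemma cocircuit_below:
  assumes "X \<in> L" "X c \<noteq> 0"
  shows "\<exists>C \<in> cocircuits L. C \<preceq> X \<and> C c \<noteq> 0"
  using assms
proof (induction "card (supp X)" arbitrary: X rule: less_induct)
  case less
  have smaller: "\<exists>C \<in> cocircuits L. C \<preceq> X \<and> C c \<noteq> 0" if V: "V \<in> L" "V \<preceq> X" "V \<noteq> X" "V c \<noteq> 0" for V
  proof -
    have "supp V \<subset> supp X" using V(2,3) by (force simp: face_le_def supp_def fun_eq_iff)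
    then have "card (supp V) < card (supp X)" using finite_supp[OF less.prems(1)] psubset_card_mono by blast
    from less.hyps[OF this V(1,4)] obtain C where "C \<in> cocircuits L" "C \<preceq> V" "C c \<noteq> 0" by auto
    then show ?thesis using V(2) unfolding face_le_def by metis
  qed
  show ?case
  proof (cases "X \<in> cocircuits L")
    case True
    then show ?thesis using less.prems by (auto simp: face_le_def)
  next
    case False
    then obtain Y where Y: "Y \<in> L" "Y \<noteq> zero_vec" "Y \<preceq> X" "Y \<noteq> X"
      using less.prems by (auto simp: cocircuits_def)
    show ?thesis
    proof (cases "Y c = 0")
      case False then show ?thesis using smaller[of Y] Y by blast
    next
      case True
      obtain d where d: "Y d \<noteq> 0" using Y(2) by (rule nonzeroE)
      have "sep (- Y) X \<noteq> {}" using d Y(3) by (auto simp: sep_def face_le_def intro!: exI[of _ d])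
      moreover have "sep (- Y) X = supp Y" using Y(3) by (auto simp: sep_def face_le_def supp_def)
      ultimately obtain V where V: "V \<in> L" "sep V X = {}" "\<And>h. h \<notin> supp Y \<Longrightarrow> V h = ((- Y) \<circ>\<^sub>s X) h"
        "\<exists>h \<in> supp Y. V h = 0"
        using conformal_elim[OF less.prems(1) covector_neg[OF Y(1)]] by metis
      have sV: "signs V" "signs X" using V less.prems covector_signs by auto
      have "V \<preceq> X"
      proof (rule face_leI[OF sV V(2)])
        fix h assume "X h = 0"
        moreover from this have "Y h = 0" using Y(3) by (auto simp: face_le_def dest!: spec[of _ h])
        ultimately show "V h = 0" using V(3)[of h] by (simp add: supp_def comp_vec_def)
      qed
      moreover have "V \<noteq> X" using V(4) Y(3) by (auto simp: supp_def face_le_def)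
      moreover have "V c = X c" using V(3)[of c] True by (simp add: supp_def comp_vec_def)
      ultimately show ?thesis using smaller[OF V(1)] less.prems(2) by simp
    qed
  qed
qed

subsection \<open>Exchange\<close>

text \<open>Steinitz exchange for covectors: \<open>V\<close> is corrected by \<open>U\<close> or
  \<open>- U\<close> until it vanishes at \<open>b\<close>; the value at \<open>d\<close> survives
  because \<open>U\<close> vanishes there.\<close>

lemma nonloop_exchange:
  assumes "U \<in> covs L (S - {d})" "U b \<noteq> 0" "V \<in> covs L S" "V d \<noteq> 0"
  shows "\<exists>Z \<in> covs L (S - {b}). Z d \<noteq> 0"
proof (cases "V b = 0")
  case True
  then show ?thesis using assms by (auto simp: covs_diff)
next
  case False
  have U: "U \<in> covs L S" "U d = 0" using assms by (auto simp: covs_diff)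
  have s: "signs U" "signs V" using U assms covs_signs by auto
  obtain U' where U': "U' \<in> covs L S" "U' d = 0" "V b = - U' b"
    using U covs_neg[OF U(1)] False assms(2) signsD[OF s(1), of b] signsD[OF s(2), of b]
    by (metis add.inverse_inverse neg_0_equal_iff_equal uminus_apply)
  obtain Z where "Z \<in> covs L S" "Z b = 0" "vsum V U' Z"
    using covs_elim[OF assms(3) U'(1,3) False] by auto
  then show ?thesis using U'(2) assms(4) vsum_r0[of V U' Z d] by (intro bexI[of _ Z]) (auto simp: covs_diff)
qed

text \<open>Although \<open>rank_le\<close> quantifies over all sections, a single one suffices to
  bound the rank. Sections by \<open>c\<close> and \<open>d\<close> are compared inside a further
  section by \<open>b\<close>.\<close>

lemma rank_le_section:
  assumes "rank_le L n (S - {c})" "U \<in> covs L S" "U c \<noteq> 0" "V \<in> covs L S" "V d \<noteq> 0"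
  shows "rank_le L n (S - {d})"
  using assms
proof (induction n arbitrary: S U V)
  case 0
  show ?case unfolding rank_le.simps
  proof
    fix Z assume Z: "Z \<in> covs L (S - {d})"
    show "Z = zero_vec"
    proof (rule ccontr)
      assume nz: "Z \<noteq> zero_vec"
      have "Z c \<noteq> 0" using 0(1) Z nz by (auto simp: covs_diff)
      from nonloop_exchange[OF Z this 0(4,5)] show False using 0(1) by auto
    qed
  qed
next
  case (Suc n)
  show ?case unfolding rank_le.simps
  proof (intro allI impI)
    fix b assume "\<exists>Z \<in> covs L (S - {d}). Z b \<noteq> 0"
    then obtain Z where Z: "Z \<in> covs L (S - {d})" "Z b \<noteq> 0" by auto
    obtain Y where Y: "Y \<in> covs L (S - {b})" "Y d \<noteq> 0"
      using nonloop_exchange[OF Z Suc.prems(4,5)] by auto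
    show "rank_le L n (S - {d} - {b})"
    proof (cases "\<exists>T \<in> covs L (S - {b}). T c \<noteq> 0")
      case True
      then obtain T where T: "T \<in> covs L (S - {b})" "T c \<noteq> 0" by auto
      have "Z \<in> covs L S" using Z by (auto simp: covs_diff)
      obtain T' where "T' \<in> covs L (S - {c})" "T' b \<noteq> 0"
        using nonloop_exchange[OF T \<open>Z \<in> covs L S\<close> Z(2)] by auto
      then have "rank_le L n (S - {c} - {b})" using Suc.prems(1) by auto
      then have "rank_le L n (S - {b} - {c})" by (simp add: Diff_insert2[symmetric] insert_commute)
      from Suc.IH[OF this T Y] show ?thesis by (simp add: Diff_insert2[symmetric] insert_commute)
    next
      \<comment> \<open>Here \<open>c\<close> vanishes wherever \<open>b\<close> does, so cutting by
        \<open>b\<close> includes cutting by \<open>c\<close>.\<close>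
      case False
      then have "Y \<in> covs L (S - {c})" using Y by (auto simp: covs_diff)
      then have r: "rank_le L n (S - {c} - {d})" using Suc.prems(1) Y(2) by auto
      have "covs L (S - {d} - {b}) \<subseteq> covs L (S - {c} - {d})" using False by (auto simp: covs_diff)
      then show ?thesis using r by (rule rank_le_covs_mono)
    qed
  qed
qed

lemma rank_le_SucI:
  "rank_le L n (S - {c}) \<Longrightarrow> U \<in> covs L S \<Longrightarrow> U c \<noteq> 0 \<Longrightarrow> rank_le L (Suc n) S"
  using rank_le_section by auto

subsection \<open>Lines\<close>

lemma rank1_unique:
  assumes "rank_le L 1 S" "U \<in> covs L S" "V \<in> covs L S" "U \<noteq> zero_vec" "V \<noteq> zero_vec"
  shows "U = V \<or> U = - V"
proof -
  obtain c where c: "U c \<noteq> 0" using assms(4) by (rule nonzeroE)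
  have r0: "\<And>T. T \<in> covs L S \<Longrightarrow> T c = 0 \<Longrightarrow> T = zero_vec" using assms(1,2) c by (auto simp: covs_diff)
  have cV: "V c \<noteq> 0" using r0 assms by blast
  have s: "signs U" "signs V" using assms covs_signs by auto
  have *: "U = - T" if T: "T \<in> covs L S" "U c = - T c" for T
  proof -
    obtain Z where Z: "Z \<in> covs L S" "Z c = 0" "vsum U T Z" using covs_elim[OF assms(2) T c] by auto
    then have "Z = zero_vec" using r0 by blast
    then show ?thesis using vsum_zero[OF s(1) covs_signs[OF T(1)] Z(3)] by (auto simp: fun_eq_iff)
  qed
  have "U c = - V c \<or> U c = V c" using c cV signsD[OF s(1), of c] signsD[OF s(2), of c] by auto
  then show ?thesis using *[of V] *[of "- V"] assms(3) covs_neg by auto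
qed

lemma line_unique:
  assumes "rank_le L 2 S" "X \<in> covs L S" "X c \<noteq> 0" "U \<in> covs L S" "V \<in> covs L S" "U c = 0" "V c = 0"
    "U \<noteq> zero_vec" "V \<noteq> zero_vec"
  shows "U = V \<or> U = - V"
proof -
  have "rank_le L 1 (S - {c})" using assms(1,2,3) by (auto simp: numeral_2_eq_2)
  then show ?thesis using rank1_unique[of "S - {c}" U V] assms by (auto simp: covs_diff)
qed

lemma line_eq:
  assumes "rank_le L 2 S" "X \<in> covs L S" "X c \<noteq> 0" "U \<in> covs L S" "V \<in> covs L S" "U c = 0" "V c = 0"
    "U d = V d" "U d \<noteq> 0"
  shows "U = V"
proof -
  have "U \<noteq> zero_vec" "V \<noteq> zero_vec" using assms(8,9) by auto
  from line_unique[OF assms(1-7) this] show ?thesis using assms(8,9) by auto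
qed

lemma line_cocircuit:
  assumes "rank_le L 2 S" "X \<in> covs L S" "X c \<noteq> 0" "U \<in> covs L S" "U c = 0" "U \<noteq> zero_vec"
  shows "U \<in> cocircuits L"
proof (rule cocircuitI)
  fix Y assume Y: "Y \<in> L" "Y \<noteq> zero_vec" "supp Y \<subseteq> supp U"
  then have "Y \<in> covs L S" "Y c = 0" using assms(4,5) by (auto simp: covs_def supp_def)
  then show "Y = U \<or> Y = - U" using line_unique[OF assms(1-3) _ assms(4) _ assms(5) Y(2) assms(6)] by blast
qed (use assms covs_in in auto)

lemma line_point:
  assumes "X \<in> covs L S" "Y \<in> covs L S" "X \<noteq> zero_vec" "Y \<noteq> zero_vec" "X \<noteq> Y" "X \<noteq> - Y"
  shows "\<exists>U \<in> covs L S. U c = 0 \<and> U \<noteq> zero_vec"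
proof -
  have s: "signs X" "signs Y" using assms covs_signs by auto
  have *: "\<exists>U \<in> covs L S. U c = 0 \<and> U \<noteq> zero_vec" if T: "T \<in> covs L S" "X c = - T c" "X c \<noteq> 0" "X \<noteq> - T" for T
  proof -
    obtain Z where Z: "Z \<in> covs L S" "Z c = 0" "vsum X T Z" using covs_elim[OF assms(1) T(1,2,3)] by auto
    have "Z \<noteq> zero_vec"
    proof
      assume "Z = zero_vec"
      then have "X = - T" using vsum_zero[OF s(1) covs_signs[OF T(1)] Z(3)] by (auto simp: fun_eq_iff)
      then show False using T by simp
    qed
    then show ?thesis using Z by blast
  qed
  show ?thesis
  proof (cases "X c = 0 \<or> Y c = 0")
    case True then show ?thesis using assms by blast
  next
    case False
    then have "X c = - Y c \<or> X c = (- (- Y)) c" using signsD[OF s(1), of c] signsD[OF s(2), of c] by auto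
    then show ?thesis using *[of Y] *[of "- Y"] assms False covs_neg by auto
  qed
qed

text \<open>\<open>Z\<close> plays the role of \<open>Y - X\<close>, obtained by eliminating
  \<open>g\<close> between \<open>- X\<close> and \<open>Y\<close>. With uniqueness on lines it
  replaces vector arithmetic.\<close>

lemma line_diff:
  assumes "X \<in> covs L S" "Y \<in> covs L S" "X g = Y g" "X g \<noteq> 0" "X \<noteq> Y"
  shows "\<exists>Z \<in> covs L S. Z g = 0 \<and> Z \<noteq> zero_vec \<and> vsum X Z Y"
proof -
  have nX: "- X \<in> covs L S" using assms covs_neg by blast
  obtain Z where Z: "Z \<in> covs L S" "Z g = 0" "vsum (- X) Y Z"
    using covs_elim[OF nX assms(2), of g] assms(3,4) by auto
  have s: "signs (- X)" "signs Y" "signs Z" using nX assms Z covs_signs by auto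
  have "vsum Y (- X) Z" using Z(3) by (rule vsum_commute)
  then have "vsum Z X Y" using vsum_rev[OF s(2) s(3) s(1)] by simp
  then have v: "vsum X Z Y" by (rule vsum_commute)
  moreover have "Z \<noteq> zero_vec" 
  proof
    assume "Z = zero_vec"
    then have "Y = X" using vsum_r0[OF v] by (simp add: fun_eq_iff)
    then show False using assms(5) by simp
  qed
  ultimately show ?thesis using Z by blast
qed

text \<open>Two elements that vanish at a common point \<open>A\<close> of a line are proportional
  on it: passing from \<open>U\<close> to \<open>V\<close> with \<open>c\<close> fixed is a move in
  direction \<open>A\<close> or \<open>- A\<close>, which does not change \<open>f\<close>.\<close>

lemma line_prop:
  assumes "rank_le L 2 S" "A \<in> covs L S" "A \<noteq> zero_vec" "A c = 0" "A f = 0"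
    "U \<in> covs L S" "V \<in> covs L S" "U c = V c" "U c \<noteq> 0"
  shows "U f = V f"
proof (cases "U = V")
  case False
  obtain Z where Z: "Z \<in> covs L S" "Z c = 0" "Z \<noteq> zero_vec" "vsum U Z V"
    using line_diff[OF assms(6,7,8,9) False] by auto
  have "Z = A \<or> Z = - A" using line_unique[OF assms(1,6,9) Z(1) assms(2) Z(2) assms(4) Z(3) assms(3)] .
  then have "Z f = 0" using assms(5) by auto
  then show ?thesis using vsum_r0[OF Z(4)] by simp
qed simp

end

section \<open>Matroid rank and comodular pairs\<close>

context oriented_matroid
begin

text \<open>Closure in the underlying matroid, in terms of all covectors;
  \<open>cocircuit_below\<close> makes this equivalent to the description by cocircuits.\<close>

definition spanned :: "'a set \<Rightarrow> 'a \<Rightarrow> bool" where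
  "spanned A e \<longleftrightarrow> (\<forall>X \<in> L. (\<forall>a \<in> A. X a = 0) \<longrightarrow> X e = 0)"

lemma om_indep_iff:
  "om_indep E L S \<longleftrightarrow> S \<subseteq> E \<and> (\<forall>e \<in> S. \<not> spanned (S - {e}) e)"
proof -
  have "(\<exists>X \<in> cocircuits L. supp X \<inter> S = {e}) \<longleftrightarrow> \<not> spanned (S - {e}) e" if "e \<in> S" for e
  proof
    assume "\<exists>X \<in> cocircuits L. supp X \<inter> S = {e}"
    then obtain X where "X \<in> L" "supp X \<inter> S = {e}" by (auto simp: cocircuits_def)
    then show "\<not> spanned (S - {e}) e"
      unfolding spanned_def by (intro notI) (drule bspec[of _ _ X], auto simp: supp_def)
  next
    assume "\<not> spanned (S - {e}) e"
    then obtain X where X: "X \<in> L" "\<And>a. a \<in> S - {e} \<Longrightarrow> X a = 0" "X e \<noteq> 0"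
      by (auto simp: spanned_def)
    obtain C where C: "C \<in> cocircuits L" "C \<preceq> X" "C e \<noteq> 0" using cocircuit_below[OF X(1,3)] by auto
    have "C a = 0" if "a \<in> S - {e}" for a using C(2) X(2)[OF that] by (metis face_le_def)
    then have "supp C \<inter> S = {e}" using C(3) \<open>e \<in> S\<close> by (auto simp: supp_def)
    then show "\<exists>X \<in> cocircuits L. supp X \<inter> S = {e}" using C(1) by blast
  qed
  then show ?thesis by (auto simp: om_indep_def)
qed

lemma spanned_mono: "spanned A e \<Longrightarrow> A \<subseteq> B \<Longrightarrow> spanned B e"
  by (auto simp: spanned_def)

lemma spanned_trans: "spanned A e \<Longrightarrow> (\<And>a. a \<in> A \<Longrightarrow> spanned B a) \<Longrightarrow> spanned B e"
  by (auto simp: spanned_def)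

lemma om_indep_subset: "om_indep E L S \<Longrightarrow> T \<subseteq> S \<Longrightarrow> om_indep E L T"
  unfolding om_indep_iff by (meson Diff_mono order_refl spanned_mono subsetD subset_trans)

text \<open>A covector that isolates an old \<open>x\<close> within \<open>S\<close> may be nonzero
  at \<open>e\<close>; \<open>nonloop_exchange\<close> with the covector isolating \<open>e\<close>
  corrects this.\<close>

lemma om_indep_insert:
  assumes S: "om_indep E L S" and e: "e \<in> E" "\<not> spanned S e"
  shows "om_indep E L (insert e S)"
proof -
  have eS: "e \<notin> S" using e(2) by (auto simp: spanned_def)
  obtain Y where Y: "Y \<in> L" "\<And>a. a \<in> S \<Longrightarrow> Y a = 0" "Y e \<noteq> 0" using e(2) by (auto simp: spanned_def)
  have "\<not> spanned (insert e S - {x}) x" if x: "x \<in> S" for x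
  proof -
    have "\<not> spanned (S - {x}) x" using S x by (auto simp: om_indep_iff)
    then obtain X where X: "X \<in> L" "\<And>a. a \<in> S - {x} \<Longrightarrow> X a = 0" "X x \<noteq> 0" by (auto simp: spanned_def)
    let ?T = "UNIV - (S - {x})"
    have c: "X \<in> covs L ?T" "Y \<in> covs L ?T" "Y \<in> covs L (?T - {x})"
      using X Y x by (auto simp: covs_def supp_def)
    obtain Z where Z: "Z \<in> covs L (?T - {e})" "Z x \<noteq> 0"
      using nonloop_exchange[OF c(3) Y(3) c(1) X(3)] by auto
    have "Z a = 0" if "a \<in> insert e S - {x}" for a using covs_out[OF Z(1), of a] that by auto
    then show ?thesis unfolding spanned_def using Z(2) covs_in[OF Z(1)] by blast
  qed
  moreover have "\<not> spanned (insert e S - {e}) e" using eS e(2) by simp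
  ultimately show ?thesis using S e(1) by (auto simp: om_indep_iff)
qed

lemma finite_indeps: "finite {S. S \<subseteq> A \<and> om_indep E L S}"
  by (rule finite_subset[of _ "Pow E"]) (auto simp: om_indep_iff finite_ground)

lemma om_indep_empty: "om_indep E L {}"
  by (simp add: om_indep_iff)

lemma card_le_om_rank: "S \<subseteq> A \<Longrightarrow> om_indep E L S \<Longrightarrow> card S \<le> om_rank E L A"
  unfolding om_rank_def using finite_indeps by (intro Max_ge) auto

lemma om_rank_basis: obtains S where "S \<subseteq> A" "om_indep E L S" "card S = om_rank E L A"
proof -
  have "om_rank E L A \<in> card ` {S. S \<subseteq> A \<and> om_indep E L S}"
    unfolding om_rank_def using finite_indeps om_indep_empty by (intro Max_in) auto
  then show ?thesis using that by auto
qed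

lemma om_rank_le: "(\<And>S. S \<subseteq> A \<Longrightarrow> om_indep E L S \<Longrightarrow> card S \<le> k) \<Longrightarrow> om_rank E L A \<le> k"
  by (metis om_rank_basis)

lemma om_rank_mono: "A \<subseteq> B \<Longrightarrow> om_rank E L A \<le> om_rank E L B"
  by (rule om_rank_le) (auto intro: card_le_om_rank)

lemma indep_finite: "om_indep E L S \<Longrightarrow> finite S"
  using finite_ground finite_subset by (auto simp: om_indep_iff)

lemma om_rank_insert:
  assumes "e \<in> E" "\<not> spanned A e"
  shows "om_rank E L (insert e A) = Suc (om_rank E L A)"
proof (rule antisym)
  show "om_rank E L (insert e A) \<le> Suc (om_rank E L A)"
  proof (rule om_rank_le)
    fix S assume S: "S \<subseteq> insert e A" "om_indep E L S"
    have "card (S - {e}) \<le> om_rank E L A"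
      using S by (intro card_le_om_rank om_indep_subset[OF S(2)]) auto
    then show "card S \<le> Suc (om_rank E L A)" using indep_finite[OF S(2)]
      by (cases "e \<in> S") (auto simp: card_Diff_singleton)
  qed
next
  obtain S where S: "S \<subseteq> A" "om_indep E L S" "card S = om_rank E L A" by (rule om_rank_basis)
  have nS: "\<not> spanned S e" using assms(2) spanned_mono S(1) by blast
  then have "e \<notin> S" by (auto simp: spanned_def)
  then have "card (insert e S) = Suc (om_rank E L A)" using S indep_finite by simp
  moreover have "card (insert e S) \<le> om_rank E L (insert e A)"
    using S by (intro card_le_om_rank om_indep_insert assms(1) nS) auto
  ultimately show "Suc (om_rank E L A) \<le> om_rank E L (insert e A)" by simp
qed

lemma om_rank_insert_spanned:
  assumes "A \<subseteq> E" "spanned A e"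
  shows "om_rank E L (insert e A) \<le> om_rank E L A"
proof (rule om_rank_le)
  fix S assume S: "S \<subseteq> insert e A" "om_indep E L S"
  show "card S \<le> om_rank E L A"
  proof (cases "e \<in> S")
    case False
    then show ?thesis using S card_le_om_rank by blast
  next
    case True
    have ind: "om_indep E L (S - {e})" using S om_indep_subset by blast
    \<comment> \<open>Otherwise \<open>S - {e}\<close> would span \<open>e\<close>; so some element
      of \<open>A\<close> can replace \<open>e\<close> in \<open>S\<close>.\<close>
    have "\<not> (\<forall>a \<in> A. spanned (S - {e}) a)"
      using S(2) True spanned_trans[OF assms(2)] by (metis om_indep_iff)
    then obtain a where a: "a \<in> A" "\<not> spanned (S - {e}) a" by blast
    have "om_indep E L (insert a (S - {e}))" using om_indep_insert[OF ind _ a(2)] a(1) assms(1) by blast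
    then have "card (insert a (S - {e})) \<le> om_rank E L A" using S(1) a(1) by (intro card_le_om_rank) auto
    moreover have "a \<notin> S - {e}" using a(2) by (auto simp: spanned_def)
    ultimately show ?thesis using True indep_finite[OF S(2)]
      by (metis card.remove card_insert_disjoint finite_Diff)
  qed
qed

lemma om_rank_spanning:
  assumes "A \<subseteq> E" "\<And>e. e \<in> E \<Longrightarrow> spanned A e"
  shows "om_rank E L E \<le> om_rank E L A"
proof -
  have "om_rank E L (A \<union> D) \<le> om_rank E L A" if "finite D" "D \<subseteq> E" for D
    using that
  proof induction
    case (insert x D)
    have "spanned (A \<union> D) x" using assms(2)[of x] insert.prems spanned_mono by (meson Un_upper1 insert_subset)
    then have "om_rank E L (insert x (A \<union> D)) \<le> om_rank E L (A \<union> D)"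
      using om_rank_insert_spanned assms(1) insert.prems by simp
    then show ?case using insert by simp
  qed simp
  from this[OF finite_ground] assms(1) show ?thesis by (simp add: Un_absorb1)
qed

lemma nonloop_iff: "(\<exists>U \<in> covs L (E - F). U c \<noteq> 0) \<longleftrightarrow> c \<in> E \<and> \<not> spanned F c"
  using covector_supp by (fastforce simp: covs_def supp_def spanned_def)

text \<open>The covectors supported off \<open>F\<close> form the contraction by \<open>F\<close>,
  of rank r(E) - r(F); a section by a non-loop \<open>c\<close> adds to \<open>F\<close> an element
  outside its closure, so both sides drop by one.\<close>

lemma rank_le_iff_om_rank:
  "F \<subseteq> E \<Longrightarrow> rank_le L n (E - F) \<longleftrightarrow> om_rank E L E \<le> om_rank E L F + n"
proof (induction n arbitrary: F)
  case 0
  have "rank_le L 0 (E - F) \<longleftrightarrow> (\<forall>c. \<not> (\<exists>U \<in> covs L (E - F). U c \<noteq> 0))"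
    by (auto simp: zero_vec_def fun_eq_iff)
  also have "\<dots> \<longleftrightarrow> (\<forall>c \<in> E. spanned F c)" by (auto simp: nonloop_iff)
  also have "\<dots> \<longleftrightarrow> om_rank E L E \<le> om_rank E L F"
  proof
    assume r: "om_rank E L E \<le> om_rank E L F"
    show "\<forall>c \<in> E. spanned F c"
    proof (rule ballI, rule ccontr)
      fix c assume c: "c \<in> E" "\<not> spanned F c"
      have "om_rank E L (insert c F) \<le> om_rank E L E" using c 0 by (intro om_rank_mono) auto
      then show False using om_rank_insert[OF c] r by simp
    qed
  qed (use om_rank_spanning 0 in auto)
  finally show ?case by simp
next
  case (Suc n)
  have "rank_le L (Suc n) (E - F) \<longleftrightarrow> (\<forall>c. c \<in> E \<and> \<not> spanned F c \<longrightarrow> rank_le L n (E - insert c F))"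
    unfolding rank_le.simps nonloop_iff by (metis Diff_insert)
  also have "\<dots> \<longleftrightarrow> (\<forall>c. c \<in> E \<and> \<not> spanned F c \<longrightarrow> om_rank E L E \<le> om_rank E L F + Suc n)"
  proof -
    have "rank_le L n (E - insert c F) \<longleftrightarrow> om_rank E L E \<le> om_rank E L F + Suc n"
      if "c \<in> E" "\<not> spanned F c" for c
      using Suc.IH[of "insert c F"] Suc.prems om_rank_insert[OF that] that by simp
    then show ?thesis by blast
  qed
  \<comment> \<open>If no such \<open>c\<close> exists, \<open>F\<close> spans \<open>E\<close> and
    the inequality holds anyway.\<close>
  also have "\<dots> \<longleftrightarrow> om_rank E L E \<le> om_rank E L F + Suc n"
    using om_rank_spanning[OF Suc.prems] by (metis add_leD1 le_Suc_ex trans_le_add1)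
  finally show ?case .
qed

text \<open>Flatness is automatic, since \<open>X \<circ>\<^sub>s Y\<close> is a covector nonzero at
  every element off the set, and corank at least two follows from \<open>X \<noteq> Y\<close> and
  \<open>X \<noteq> - Y\<close>. Only the upper bound on the corank is a condition.\<close>

lemma comodular_iff:
  "comodular E L X Y \<longleftrightarrow> X \<in> cocircuits L \<and> Y \<in> cocircuits L \<and> X \<noteq> Y \<and> X \<noteq> - Y \<and>
    rank_le L 2 (supp X \<union> supp Y)"
proof -
  have "om_flat E L (zeros E (X \<circ>\<^sub>s Y)) \<and> om_rank E L (zeros E (X \<circ>\<^sub>s Y)) + 2 = om_rank E L E \<longleftrightarrow>
    rank_le L 2 (supp X \<union> supp Y)" if cc: "X \<in> cocircuits L" "Y \<in> cocircuits L" "X \<noteq> Y" "X \<noteq> - Y"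
  proof -
    let ?F = "zeros E (X \<circ>\<^sub>s Y)"
    have XY: "X \<in> L" "Y \<in> L" "X \<noteq> zero_vec" "Y \<noteq> zero_vec" using cc by (auto simp: cocircuits_def)
    have F: "?F \<subseteq> E" "E - ?F = supp X \<union> supp Y"
      using covector_supp[OF XY(1)] covector_supp[OF XY(2)] by (auto simp: zeros_def supp_def comp_vec_def)
    have nsp: "\<not> spanned ?F e" if "e \<in> E - ?F" for e
      unfolding spanned_def
    proof
      assume "\<forall>X\<in>L. (\<forall>a\<in>?F. X a = 0) \<longrightarrow> X e = 0"
      then have "(X \<circ>\<^sub>s Y) e = 0" using covector_comp[OF XY(1,2)] by (auto simp: zeros_def supp_def)
      then show False using that by (auto simp: zeros_def supp_def)
    qed
    have flat: "om_flat E L ?F" using F(1) nsp om_rank_insert by (auto simp: om_flat_def)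
    have "\<not> rank_le L 1 (supp X \<union> supp Y)"
      using rank1_unique[of "supp X \<union> supp Y" X Y] XY cc(3,4) by (auto simp: covs_def)
    then have "\<not> om_rank E L E \<le> om_rank E L ?F + 1" using rank_le_iff_om_rank[OF F(1), of 1] F(2) by metis
    then show ?thesis using flat rank_le_iff_om_rank[OF F(1), of 2] F(2) by auto
  qed
  then show ?thesis unfolding comodular_def by blast
qed

end

section \<open>Steps along lines\<close>

definition step :: "'a signvec set \<Rightarrow> 'a \<Rightarrow> 'a signvec \<Rightarrow> 'a signvec \<Rightarrow> 'a signvec \<Rightarrow> bool" where
  "step L g X Z Y \<longleftrightarrow> X \<in> cocircuits L \<and> Y \<in> cocircuits L \<and> Z \<in> cocircuits L \<and> X \<noteq> Y \<and>
    X g = 1 \<and> Y g = 1 \<and> Z g = 0 \<and> vsum X Z Y \<and> rank_le L 2 (supp X \<union> supp Y)"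

text \<open>The factor \<open>\<tau>\<close> reverses the objective; it is needed for quantities
  that are monotone only up to a common sign.\<close>

definition wk :: "'a signvec set \<Rightarrow> 'a \<Rightarrow> 'a \<Rightarrow> int \<Rightarrow> ('a signvec \<times> 'a signvec) set" where
  "wk L g f \<tau> = {(X, Y). \<exists>Z. step L g X Z Y \<and> 0 \<le> \<tau> * Z f}"

definition cwk :: "'a signvec set \<Rightarrow> 'a \<Rightarrow> 'a \<Rightarrow> ('a signvec \<times> 'a signvec) set" where
  "cwk L g f = {(X, Y). \<exists>Z. step L g X Z Y \<and> conformal X Y \<and> 0 \<le> Z f}"

definition acyc :: "'a signvec set \<Rightarrow> 'a \<Rightarrow> 'a \<Rightarrow> bool" where
  "acyc L g f \<longleftrightarrow> (\<forall>X Z Y. step L g X Z Y \<longrightarrow> 0 < Z f \<longrightarrow> (Y, X) \<notin> (wk L g f 1)\<^sup>*)"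

definition cacyc :: "'a signvec set \<Rightarrow> 'a \<Rightarrow> 'a \<Rightarrow> bool" where
  "cacyc L g f \<longleftrightarrow>
    (\<forall>X Z Y. step L g X Z Y \<longrightarrow> conformal X Y \<longrightarrow> 0 < Z f \<longrightarrow> (Y, X) \<notin> (cwk L g f)\<^sup>*)"

definition strongly_connected :: "('b \<times> 'b) set \<Rightarrow> bool" where
  "strongly_connected R \<longleftrightarrow> (\<forall>(a, b) \<in> R. \<forall>(c, d) \<in> R. (b, c) \<in> R\<^sup>*)"

text \<open>\<open>R\<close> collects the edges of \<open>W\<close> that lie on a closed walk
  through the edge from \<open>X\<close> to \<open>Y\<close>; the return walks stay inside
  \<open>R\<close>.\<close>

lemma strongly_connected_component:
  assumes "(X, Y) \<in> W" "(Y, X) \<in> W\<^sup>*"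
  obtains R where "strongly_connected R" "(X, Y) \<in> R" "R \<subseteq> W"
proof -
  let ?R = "{(a, b) \<in> W. (Y, a) \<in> W\<^sup>* \<and> (b, X) \<in> W\<^sup>*}"
  have fw: "(a, X) \<in> ?R\<^sup>*" if "(a, X) \<in> W\<^sup>*" "(Y, a) \<in> W\<^sup>*" for a
    using that
  proof (induction rule: converse_rtrancl_induct)
    case (step y z)
    then have "(y, z) \<in> ?R" by auto
    moreover have "(Y, z) \<in> W\<^sup>*" using step by auto
    ultimately show ?case using step.IH by (meson converse_rtrancl_into_rtrancl)
  qed simp
  have bw: "(Y, c) \<in> ?R\<^sup>*" if "(Y, c) \<in> W\<^sup>*" "(c, X) \<in> W\<^sup>*" for c
    using that
  proof (induction rule: rtrancl_induct)
    case (step y z)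
    then have "(y, z) \<in> ?R" by auto
    moreover have "(y, X) \<in> W\<^sup>*" using step by (meson converse_rtrancl_into_rtrancl)
    ultimately show ?case using step.IH by (meson rtrancl.rtrancl_into_rtrancl)
  qed simp
  have XY: "(X, Y) \<in> ?R" using assms by auto
  have "(b, c) \<in> ?R\<^sup>*" if "(a, b) \<in> ?R" "(c, d) \<in> ?R" for a b c d
  proof -
    have "(b, X) \<in> ?R\<^sup>*" using that by (intro fw) auto
    moreover have "(Y, c) \<in> ?R\<^sup>*"
      using that by (intro bw) (auto intro: converse_rtrancl_into_rtrancl)
    ultimately show ?thesis using XY by (meson converse_rtrancl_into_rtrancl rtrancl_trans)
  qed
  then have "strongly_connected ?R" by (auto simp: strongly_connected_def)
  then show ?thesis using that XY by blast
qed

lemma strongly_connected_mono: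
  assumes "strongly_connected R" "\<And>x y. (x, y) \<in> R \<Longrightarrow> q x \<le> (q y :: int)" "(x, y) \<in> R"
  shows "q x = q y"
proof -
  have "q a \<le> q b" if "(a, b) \<in> R\<^sup>*" for a b
    using that by (induction) (use assms(2) in fastforce)+
  moreover have "(y, x) \<in> R\<^sup>*" using assms(1,3) by (fastforce simp: strongly_connected_def)
  ultimately show ?thesis using assms(2,3) by (meson antisym)
qed

lemma strongly_connected_const:
  assumes "strongly_connected R" "\<And>x y. (x, y) \<in> R \<Longrightarrow> q x = q y" "(x0, y0) \<in> R" "(x, y) \<in> R"
  shows "q x = q x0" "q y = q x0"
proof -
  have "q a = q b" if "(a, b) \<in> R\<^sup>*" for a b
    using that by (induction) (use assms(2) in fastforce)+
  moreover have "(y0, x) \<in> R\<^sup>*" using assms(1,3,4) by (fastforce simp: strongly_connected_def)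
  ultimately show "q x = q x0" "q y = q x0" using assms by metis+
qed

lemma strongly_connected_image:
  assumes "strongly_connected R" "\<And>x y. (x, y) \<in> R \<Longrightarrow> (\<phi> x, \<phi> y) \<in> W\<^sup>*" "(x, y) \<in> R"
  shows "(\<phi> y, \<phi> x) \<in> W\<^sup>*"
proof -
  have "(\<phi> a, \<phi> b) \<in> W\<^sup>*" if "(a, b) \<in> R\<^sup>*" for a b
    using that by (induction) (use assms(2) rtrancl_trans in fastforce)+
  moreover have "(y, x) \<in> R\<^sup>*" using assms(1,3) by (fastforce simp: strongly_connected_def)
  ultimately show ?thesis by blast
qed

context oriented_matroid
begin

lemma cocircuit_signs: "X \<in> cocircuits L \<Longrightarrow> signs X"
  by (simp add: cocircuit_in covector_signs)

lemma cocircuit_zero: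
  assumes "X \<in> cocircuits L" "Y \<in> cocircuits L" "X \<noteq> Y" "X \<noteq> - Y"
  shows "\<exists>c. X c = 0 \<and> Y c \<noteq> 0"
proof (rule ccontr)
  assume "\<not> ?thesis"
  then have "supp Y \<subseteq> supp X" by (auto simp: supp_def)
  then have "Y = X \<or> Y = - X"
    using cocircuit_minimal[OF assms(1)] assms(2) by (auto simp: cocircuits_def)
  then show False using assms(3,4) by (auto simp: neg_eq_iff)
qed

lemma step_covs:
  assumes "step L g X Z Y"
  shows "X \<in> covs L (supp X \<union> supp Y)" "Y \<in> covs L (supp X \<union> supp Y)" "Z \<in> covs L (supp X \<union> supp Y)"
    "rank_le L 2 (supp X \<union> supp Y)" "vsum X Z Y" "X g = 1" "Y g = 1" "Z g = 0" "X \<noteq> Y" "X \<noteq> - Y"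
    "Z \<noteq> zero_vec" "X \<in> cocircuits L" "Y \<in> cocircuits L" "Z \<in> cocircuits L"
    "signs X" "signs Y" "signs Z" "X \<in> L" "Y \<in> L" "Z \<in> L"
proof -
  have *: "X \<in> L" "Y \<in> L" "Z \<in> L" "vsum X Z Y" "X g = 1" "Y g = 1"
    using assms by (auto simp: step_def cocircuits_def)
  then show "X \<in> covs L (supp X \<union> supp Y)" "Y \<in> covs L (supp X \<union> supp Y)" "X \<in> L" "Y \<in> L" "Z \<in> L"
    by (auto simp: covs_def)
  show "Z \<in> covs L (supp X \<union> supp Y)" using * by (auto simp: covs_def supp_def dest: vsum_l0)
  show "X \<noteq> - Y" using * by auto
  show "signs X" "signs Y" "signs Z" using * covector_signs by auto
qed (use assms in \<open>auto simp: step_def cocircuits_def\<close>)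

lemma stepI:
  assumes "rank_le L 2 S" "X \<in> covs L S" "Y \<in> covs L S" "Z \<in> covs L S" "X \<in> cocircuits L" "Y \<in> cocircuits L"
    "X g = 1" "Y g = 1" "Z g = 0" "vsum X Z Y" "X \<noteq> Y"
  shows "step L g X Z Y"
proof -
  have "supp X \<union> supp Y \<subseteq> S" using assms by (auto simp: covs_def)
  then have r: "rank_le L 2 (supp X \<union> supp Y)" using assms(1) rank_le_mono by blast
  have "Z \<noteq> zero_vec"
  proof
    assume "Z = zero_vec"
    then have "Y = X" using vsum_r0[OF assms(10)] by (simp add: fun_eq_iff)
    then show False using assms(11) by simp
  qed
  then have "Z \<in> cocircuits L" using line_cocircuit[OF assms(1,2) _ assms(4,9)] assms(7) by simp
  then show ?thesis using assms r by (simp add: step_def)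
qed

lemma step_rev: "step L g X Z Y \<Longrightarrow> step L g Y (- Z) X"
  using vsum_rev[of X Y Z] cocircuit_neg cocircuit_signs unfolding step_def by (auto simp: Un_commute)

lemma wk_converse: "wk L g f (- \<tau>) = (wk L g f \<tau>)\<inverse>"
proof -
  have *: "(Y, X) \<in> wk L g f (- \<tau>)" if w: "(X, Y) \<in> wk L g f \<tau>" for X Y \<tau>
  proof -
    obtain Z where "step L g X Z Y" "0 \<le> \<tau> * Z f" using w by (auto simp: wk_def)
    then show ?thesis unfolding wk_def using step_rev by (auto intro!: exI[of _ "- Z"])
  qed
  show ?thesis using *[of _ _ \<tau>] *[of _ _ "- \<tau>"] by auto
qed

text \<open>The image of a return path from \<open>y\<close> to \<open>x\<close> closes up every
  step met on the image walk of the edge \<open>(x, y)\<close>. A strict one would violate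
  \<open>acyc\<close>; for \<open>\<tau> = -1\<close> the closed walk is read backwards.\<close>

lemma acyc_tie:
  assumes "acyc L g f" "strongly_connected R" "\<tau> = 1 \<or> \<tau> = -1"
    and "\<And>x y. (x, y) \<in> R \<Longrightarrow> (\<phi> x, \<phi> y) \<in> (wk L g f \<tau>)\<^sup>*"
    and "(x, y) \<in> R" "(\<phi> x, u) \<in> (wk L g f \<tau>)\<^sup>*" "step L g u Z v" "(v, \<phi> y) \<in> (wk L g f \<tau>)\<^sup>*" "0 \<le> \<tau> * Z f"
  shows "Z f = 0"
proof (rule ccontr)
  assume "Z f \<noteq> 0"
  then have pos: "0 < \<tau> * Z f" using assms(3,9) by auto
  have "(\<phi> y, \<phi> x) \<in> (wk L g f \<tau>)\<^sup>*" by (rule strongly_connected_image[OF assms(2,4,5)])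
  then have vu: "(v, u) \<in> (wk L g f \<tau>)\<^sup>*" using assms(6,8) by (meson rtrancl_trans)
  from assms(3) show False
  proof
    assume "\<tau> = 1" then show False using assms(1,7) vu pos by (auto simp: acyc_def)
  next
    assume t: "\<tau> = -1"
    then have "(u, v) \<in> (wk L g f 1)\<^sup>*" using vu wk_converse[of g f 1] by (simp add: rtrancl_converse)
    then show False using assms(1) step_rev[OF assms(7)] pos t by (fastforce simp: acyc_def)
  qed
qed

lemma acyc_tie1:
  assumes "acyc L g f" "strongly_connected R" "\<tau> = 1 \<or> \<tau> = -1"
    and "\<And>x y. (x, y) \<in> R \<Longrightarrow> \<phi> x = \<phi> y \<or> (\<exists>Z. step L g (\<phi> x) Z (\<phi> y) \<and> 0 \<le> \<tau> * Z f)"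
    and "(x, y) \<in> R" "step L g (\<phi> x) Z (\<phi> y)" "0 \<le> \<tau> * Z f"
  shows "Z f = 0"
proof (rule acyc_tie[OF assms(1-3) _ assms(5) _ assms(6) _ assms(7)])
  show "(\<phi> x, \<phi> y) \<in> (wk L g f \<tau>)\<^sup>*" if "(x, y) \<in> R" for x y
    using assms(4)[OF that] by (auto simp: wk_def)
qed auto

subsection \<open>Conformal steps suffice\<close>

text \<open>The segment is cut at a point \<open>U\<close> where an opposed element vanishes. Both
  pieces keep the direction \<open>Z\<close> and have fewer opposed elements.\<close>

lemma step_conformal_chain:
  assumes "step L g X Z Y"
  shows "(X, Y) \<in> {(a, b). step L g a Z b \<and> conformal a b}\<^sup>+"
  using assms
proof (induction "card (sep X Y)" arbitrary: X Y rule: less_induct)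
  case less
  show ?case
  proof (cases "conformal X Y")
    case True
    then show ?thesis using less.prems by auto
  next
    case False
    let ?S = "supp X \<union> supp Y"
    note st = step_covs[OF less.prems]
    from False obtain h where h: "X h = - Y h" "X h \<noteq> 0" by (auto simp: conformal_def sep_def)
    obtain U where U: "U \<in> covs L ?S" "U h = 0" "vsum X Y U" using covs_elim[OF st(1,2) h] by auto
    have Xg: "X g \<noteq> 0" using st(6) by simp
    have Ug: "U g = 1" using vsum_same[OF U(3), of g] st by simp
    then have Unz: "U \<noteq> zero_vec" by auto
    have Uc: "U \<in> cocircuits L" using line_cocircuit[OF st(4) st(1) h(2) U(1,2) Unz] .
    have ne: "U \<noteq> X" "U \<noteq> Y" using U(2) h by auto
    have sep0: "(X k = - U k \<and> X k \<noteq> 0 \<or> U k = - Y k \<and> U k \<noteq> 0) \<Longrightarrow> X k = - Y k \<and> X k \<noteq> 0 \<and> k \<noteq> h" for k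
      using U(2) vsum_l0[OF U(3), of k] vsum_r0[OF U(3), of k] vsum_same[OF U(3), of k]
        signsD[OF st(15), of k] signsD[OF st(16), of k] by smt
    then have sep1: "sep X U \<subseteq> sep X Y - {h}" "sep U Y \<subseteq> sep X Y - {h}"
      unfolding sep_def by blast+
    have fin: "finite (sep X Y)" by (rule finite_subset[OF _ finite_supp[OF st(18)]]) (auto simp: sep_def supp_def)
    have hs: "h \<in> sep X Y" using h by (simp add: sep_def)
    have lt: "card (sep X U) < card (sep X Y)" "card (sep U Y) < card (sep X Y)"
      using sep1 fin hs by (intro psubset_card_mono; blast)+
    have zeroX: "\<exists>c. X c = 0 \<and> Y c \<noteq> 0" using cocircuit_zero[OF st(12,13,9,10)] .
    have zeroY: "\<exists>c. Y c = 0 \<and> X c \<noteq> 0" using cocircuit_zero[OF st(13,12)] st(9,10) by (metis neg_neg)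
    have "step L g X Z U"
    proof -
      obtain Z' where Z': "Z' \<in> covs L ?S" "Z' g = 0" "Z' \<noteq> zero_vec" "vsum X Z' U"
        using line_diff[OF st(1) U(1), of g] Ug st(6) ne by auto
      obtain c where c: "X c = 0" "Y c \<noteq> 0" using zeroX by blast
      have "Z' c = Z c" using vsum_l0[OF Z'(4) c(1)] vsum_l0[OF st(5) c(1)] vsum_l0[OF U(3) c(1)] by simp
      moreover have "Z' c \<noteq> 0" using vsum_l0[OF Z'(4) c(1)] vsum_l0[OF U(3) c(1)] c(2) by simp
      ultimately have "Z' = Z" by (rule line_eq[OF st(4) st(1) Xg Z'(1) st(3) Z'(2) st(8)])
      then show ?thesis using stepI[OF st(4) st(1) U(1) Z'(1) st(12) Uc st(6) Ug Z'(2,4)] ne by simp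
    qed
    moreover have "step L g U Z Y"
    proof -
      obtain Z' where Z': "Z' \<in> covs L ?S" "Z' g = 0" "Z' \<noteq> zero_vec" "vsum U Z' Y"
        using line_diff[OF U(1) st(2), of g] Ug st(7) ne by auto
      obtain c where c: "Y c = 0" "X c \<noteq> 0" using zeroY by blast
      have Uc0: "U c = X c" using vsum_r0[OF U(3) c(1)] .
      have "U c = - Z' c" using vsum_zero[OF covs_signs[OF U(1)] covs_signs[OF Z'(1)] Z'(4) c(1)] .
      moreover have "X c = - Z c" using vsum_zero[OF st(15,17,5) c(1)] .
      ultimately have "Z' c = Z c" "Z' c \<noteq> 0" using Uc0 c(2) by auto
      then have "Z' = Z" by (rule line_eq[OF st(4) st(1) Xg Z'(1) st(3) Z'(2) st(8)])
      then show ?thesis using stepI[OF st(4) U(1) st(2) Z'(1) Uc st(13) Ug st(7) Z'(2,4)] ne by simp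
    qed
    ultimately show ?thesis using less.hyps[OF lt(1)] less.hyps[OF lt(2)] by (meson trancl_trans)
  qed
qed

lemma acyc_if_cacyc:
  assumes "cacyc L g f" shows "acyc L g f"
  unfolding acyc_def
proof (intro allI impI notI)
  fix X Z Y assume st: "step L g X Z Y" "0 < Z f" "(Y, X) \<in> (wk L g f 1)\<^sup>*"
  have "wk L g f 1 \<subseteq> (cwk L g f)\<^sup>*"
  proof
    fix q assume q: "q \<in> wk L g f 1"
    then obtain a Z b where "q = (a, b)" "step L g a Z b" "0 \<le> Z f" by (auto simp: wk_def)
    moreover from this have "{(a, b). step L g a Z b \<and> conformal a b} \<subseteq> cwk L g f" by (auto simp: cwk_def)
    ultimately show "q \<in> (cwk L g f)\<^sup>*"
      using step_conformal_chain[of g a Z b] by (meson subsetD trancl_into_rtrancl trancl_mono)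
  qed
  then have YX: "(Y, X) \<in> (cwk L g f)\<^sup>*" using st(3) by (meson rtrancl_subset_rtrancl subsetD)
  \<comment> \<open>All pieces have direction \<open>Z\<close>, so already the first conformal piece
    is strict.\<close>
  from tranclD[OF step_conformal_chain[OF st(1)]] obtain u where u: "step L g X Z u" "conformal X u"
    "(u, Y) \<in> {(a, b). step L g a Z b \<and> conformal a b}\<^sup>*" by blast
  have "{(a, b). step L g a Z b \<and> conformal a b} \<subseteq> cwk L g f" using st(2) by (auto simp: cwk_def)
  then have "(u, Y) \<in> (cwk L g f)\<^sup>*" using u(3) rtrancl_mono by blast
  then have "(u, X) \<in> (cwk L g f)\<^sup>*" using YX by (meson rtrancl_trans)
  then show False using assms u st(2) by (auto simp: cacyc_def)
qed

end

section \<open>Euclidean programs and acyclicity\<close>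

context oriented_matroid
begin

lemma is_elimination_iff:
  assumes "X \<in> L" "Y \<in> L"
  shows "is_elimination L g (- X) Y Z \<longleftrightarrow> Z \<in> cocircuits L \<and> Z g = 0 \<and> vsum X Z Y"
proof -
  have "supp Z \<subseteq> supp (- X \<circ>\<^sub>s Y) - {g} \<and> (\<forall>h. h \<notin> sep (- X) Y \<longrightarrow> Z h = (- X \<circ>\<^sub>s Y) h) \<longleftrightarrow> vsum X Z Y"
    if Z: "Z \<in> L" "Z g = 0"
  proof -
    note s = signsD[OF covector_signs[OF assms(1)]] signsD[OF covector_signs[OF assms(2)]]
      signsD[OF covector_signs[OF Z(1)]]
    have "(Z h \<noteq> 0 \<longrightarrow> (- X \<circ>\<^sub>s Y) h \<noteq> 0 \<and> h \<noteq> g) \<and> (h \<notin> sep (- X) Y \<longrightarrow> Z h = (- X \<circ>\<^sub>s Y) h) \<longleftrightarrow>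
      (X h = 0 \<longrightarrow> Y h = Z h) \<and> (Z h = 0 \<longrightarrow> Y h = X h) \<and> (X h = Z h \<longrightarrow> Y h = X h)" for h
      using s(1)[of h] s(2)[of h] s(3)[of h] Z(2) by (elim disjE) (auto simp: sep_def comp_vec_def)
    note pw = this
    have "supp Z \<subseteq> supp (- X \<circ>\<^sub>s Y) - {g} \<longleftrightarrow> (\<forall>h. Z h \<noteq> 0 \<longrightarrow> (- X \<circ>\<^sub>s Y) h \<noteq> 0 \<and> h \<noteq> g)"
      unfolding supp_def by blast
    then show ?thesis unfolding vsum_def pw[symmetric] by blast
  qed
  then show ?thesis unfolding is_elimination_def using cocircuit_in by blast
qed

lemma edge_iff:
  "program_edge E L g X Y \<and> (\<exists>Z. is_elimination L g (- X) Y Z \<and> Z f = k) \<longleftrightarrow>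
    (\<exists>Z. step L g X Z Y \<and> conformal X Y \<and> Z f = k)"
proof -
  have "X \<noteq> - Y" if "X g = 1" "Y g = 1" using that by auto
  then have "program_edge E L g X Y \<longleftrightarrow> X \<in> cocircuits L \<and> Y \<in> cocircuits L \<and> X g = 1 \<and> Y g = 1 \<and>
      X \<noteq> Y \<and> rank_le L 2 (supp X \<union> supp Y) \<and> conformal X Y"
    by (auto simp: program_edge_def program_verts_def comodular_iff)
  then show ?thesis
    using is_elimination_iff[of X Y g] cocircuit_in unfolding step_def by blast
qed

lemma forward_edge_iff:
  "forward_edge E L g f X Y \<longleftrightarrow> (\<exists>Z. step L g X Z Y \<and> conformal X Y \<and> Z f = 1)"
  by (simp add: forward_edge_def edge_iff)

lemma undirected_edge_iff:
  "undirected_edge E L g f X Y \<longleftrightarrow> (\<exists>Z. step L g X Z Y \<and> conformal X Y \<and> Z f = 0)"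
  by (simp add: undirected_edge_def edge_iff)

lemma cwk_iff: "(X, Y) \<in> cwk L g f \<longleftrightarrow> forward_edge E L g f X Y \<or> undirected_edge E L g f X Y"
proof -
  have "0 \<le> Z f \<longleftrightarrow> Z f = 1 \<or> Z f = 0" if "step L g X Z Y" for Z
    using signsD[OF step_covs(17)[OF that], of f] by auto
  then show ?thesis unfolding forward_edge_iff undirected_edge_iff cwk_def by blast
qed

text \<open>A shortest return walk from \<open>Y\<close> to \<open>X\<close> repeats no vertex, and
  the strict edge closes it to a directed cycle.\<close>

lemma cacyc_if_euclidean_program:
  assumes "euclidean_program E L g f"
  shows "cacyc L g f"
  unfolding cacyc_def
proof (intro allI impI notI)
  fix X Z Y assume st: "step L g X Z Y" "conformal X Y" "0 < Z f" and path: "(Y, X) \<in> (cwk L g f)\<^sup>*"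
  let ?R = "cwk L g f"
  define n where "n = (LEAST n. (Y, X) \<in> ?R ^^ n)"
  have "\<exists>n. (Y, X) \<in> ?R ^^ n" using path by (simp add: rtrancl_power)
  then have n: "(Y, X) \<in> ?R ^^ n" unfolding n_def by (rule LeastI_ex)
  then obtain v where v: "v 0 = Y" "v n = X" "\<And>i. i < n \<Longrightarrow> (v i, v (Suc i)) \<in> ?R"
    by (auto simp: relpow_fun_conv)
  have seg: "(v i, v j) \<in> ?R ^^ (j - i)" if "i \<le> j" "j \<le> n" for i j
    unfolding relpow_fun_conv using v(3) that by (intro exI[of _ "\<lambda>k. v (i + k)"]) auto
  have dist: "v i \<noteq> v j" if "i < j" "j \<le> n" for i j
  proof
    assume eq: "v i = v j"
    have "(Y, v i) \<in> ?R ^^ i" using seg[of 0 i] that v(1) by simp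
    moreover have "(v i, X) \<in> ?R ^^ (n - j)" using seg[of j n] that v(2) eq by simp
    ultimately have "(Y, X) \<in> ?R ^^ (i + (n - j))" by (auto simp: relpow_add)
    then have "n \<le> i + (n - j)" unfolding n_def by (rule Least_le)
    then show False using that by simp
  qed
  let ?vs = "map v [0..<Suc n]"
  have len: "length ?vs = Suc n" by simp
  have nth: "?vs ! i = v i" if "i \<le> n" for i using that by (simp del: upt_Suc)
  have fe: "forward_edge E L g f X Y"
    using st signsD[OF step_covs(17)[OF st(1)], of f] by (auto simp: forward_edge_iff)
  have edge: "(?vs ! i, ?vs ! (Suc i mod length ?vs)) \<in> ?R" if "i < length ?vs" for i
  proof (cases "i = n")
    case True
    then have "?vs ! i = X" "?vs ! (Suc i mod length ?vs) = Y" using nth v len by auto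
    then show ?thesis using fe by (metis cwk_iff)
  next
    case False
    then have i: "i < n" using that len by simp
    then show ?thesis using v(3)[OF i] nth[of i] nth[of "Suc i"] len by simp
  qed
  have "distinct ?vs"
    using dist by (auto simp: distinct_map inj_on_def simp del: upt_Suc) (metis le_less_Suc_eq less_Suc_eq_le linorder_neqE_nat)
  moreover have "set ?vs \<subseteq> program_verts L g"
  proof
    fix x assume "x \<in> set ?vs"
    then obtain i where "i < length ?vs" "x = ?vs ! i" by (metis in_set_conv_nth)
    with edge show "x \<in> program_verts L g" by (auto simp: cwk_def step_def program_verts_def simp del: upt_Suc)
  qed
  moreover have "forward_edge E L g f (?vs ! n) (?vs ! (Suc n mod length ?vs))"
    using fe nth v len by simp
  ultimately have "directed_cycle E L g f ?vs"
    unfolding directed_cycle_def using edge len unfolding cwk_iff by (metis lessI)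
  then show False using assms by (auto simp: euclidean_program_def)
qed

lemma euclidean_program_if_cacyc:
  assumes "cacyc L g f"
  shows "euclidean_program E L g f"
  unfolding euclidean_program_def
proof
  assume "\<exists>vs. directed_cycle E L g f vs"
  then obtain vs i where vs: "\<And>i. i < length vs \<Longrightarrow> (vs ! i, vs ! (Suc i mod length vs)) \<in> cwk L g f"
    and i: "i < length vs" "forward_edge E L g f (vs ! i) (vs ! (Suc i mod length vs))"
    unfolding directed_cycle_def cwk_iff by blast
  let ?n = "length vs"
  have "(vs ! (Suc i mod ?n), vs ! ((Suc i + k) mod ?n)) \<in> (cwk L g f)\<^sup>*" for k
  proof (induction k)
    case (Suc k)
    have "(Suc i + k) mod ?n < ?n" using i(1) by (intro mod_less_divisor) linarith
    from vs[OF this] have "(vs ! ((Suc i + k) mod ?n), vs ! ((Suc i + Suc k) mod ?n)) \<in> cwk L g f"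
      by (simp add: mod_Suc_eq)
    then show ?case using Suc by (meson rtrancl.rtrancl_into_rtrancl)
  qed simp
  moreover have "(Suc i + (?n - 1)) mod ?n = i" 
  proof -
    have "Suc i + (?n - 1) = i + ?n" using i(1) by linarith
    then show ?thesis using i(1) by (metis mod_add_self2 mod_less)
  qed
  ultimately have "(vs ! (Suc i mod ?n), vs ! i) \<in> (cwk L g f)\<^sup>*" by metis
  then show False using assms i(2) by (auto simp: forward_edge_iff cacyc_def)
qed

text \<open>Where Euclideanness says nothing, there is no strict step at all: the main case is a
  coloop \<open>f\<close>, whose one-element cocircuit forces every vertex to vanish at
  \<open>f\<close>.\<close>

lemma acyc_if_euclidean_om:
  assumes "euclidean_om E L"
  shows "acyc L g f"
proof (cases "om_program E L g f")
  case True
  then show ?thesis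
    using assms cacyc_if_euclidean_program acyc_if_cacyc by (auto simp: euclidean_om_def)
next
  case False
  have "\<not> 0 < Z f" if st: "step L g X Z Y" for X Z Y
  proof
    assume Zf: "0 < Z f"
    note s = step_covs[OF st]
    have gE: "g \<in> E" using s(6) covector_supp[OF s(18)] by (auto simp: supp_def)
    have fE: "f \<in> E" using Zf covector_supp[OF s(20)] by (auto simp: supp_def)
    have gf: "g \<noteq> f" using s(8) Zf by auto
    have "\<not> om_loop E L g"
    proof -
      have "supp X \<inter> {g} = {g}" using s(6) by (auto simp: supp_def)
      then show ?thesis using s(12) gE by (auto simp: om_loop_def om_indep_def)
    qed
    with False gE fE gf have "om_coloop E L f" by (simp add: om_program_def)
    then obtain U where U: "U \<in> cocircuits L" "supp U = {f}" by (auto simp: om_coloop_def)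
    have unique: "V f = 0" if V: "V \<in> cocircuits L" "V g = 1" for V
    proof (rule ccontr)
      assume "V f \<noteq> 0"
      then have "supp U \<subseteq> supp V" using U(2) by (auto simp: supp_def)
      then have "U = V \<or> U = - V" using cocircuit_minimal[OF V(1)] U(1) by (auto simp: cocircuits_def)
      then have "supp V = {f}" using U(2) by (metis supp_neg)
      then have "g \<notin> supp V" using gf by simp
      then show False using V(2) by (simp add: in_supp)
    qed
    have "X f = 0" "Y f = 0" using unique[OF s(12,6)] unique[OF s(13,7)] .
    then show False using vsum_l0[OF s(5), of f] Zf by simp
  qed
  then show ?thesis by (auto simp: acyc_def)
qed

end

lemma euclidean_omI:
  assumes "oriented_matroid E L" "\<And>g f. g \<noteq> f \<Longrightarrow> cacyc L g f"
  shows "euclidean_om E L"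
  using assms oriented_matroid.euclidean_program_if_cacyc
  unfolding euclidean_om_def om_program_def by metis

section \<open>Covectors of lexicographic extensions\<close>

text \<open>The induction on the list passes through the extension by its tail, which is not given and has
  to be constructed; hence this explicit description of the covectors.\<close>

definition lex_ext :: "('a \<times> int) list \<Rightarrow> 'a \<Rightarrow> 'a signvec set \<Rightarrow> 'a signvec set" where
  "lex_ext es p L = {X. X(p := 0) \<in> L \<and>
     (X p \<noteq> 0 \<longrightarrow> (\<exists>A \<in> L. A \<preceq> X(p := 0) \<and> lex_localization es A = X p)) \<and>
     (X p = 0 \<longrightarrow> lex_localization es X = 0 \<or>
       (\<exists>A \<in> L. A \<preceq> X \<and> lex_localization es A = 1) \<and> (\<exists>A \<in> L. A \<preceq> X \<and> lex_localization es A = -1))}"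

lemma face_le_refl [simp]: "X \<preceq> X"
  by (simp add: face_le_def)

lemma face_le_trans: "X \<preceq> Y \<Longrightarrow> Y \<preceq> Z \<Longrightarrow> X \<preceq> Z"
  by (force simp: face_le_def)

lemma face_le_comp: "X \<preceq> X \<circ>\<^sub>s Y"
  by (simp add: face_le_def comp_vec_def)

lemma face_le_zero: "X \<preceq> Y \<Longrightarrow> Y h = 0 \<Longrightarrow> X h = 0"
  by (auto simp: face_le_def dest!: spec[of _ h])

lemma lex_localization_zero_iff:
  "snd ` set es \<subseteq> {1, -1} \<Longrightarrow> lex_localization es X = 0 \<longleftrightarrow> (\<forall>e \<in> fst ` set es. X e = 0)"
  by (induction es X rule: lex_localization.induct) auto

lemma lex_localization_sign:
  "snd ` set es \<subseteq> {1, -1} \<Longrightarrow> signs X \<Longrightarrow> lex_localization es X \<in> {1, -1, 0}"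
  by (induction es X rule: lex_localization.induct) (auto dest: signsD)

lemma lex_localization_cong: "(\<And>e. e \<in> fst ` set es \<Longrightarrow> X e = Y e) \<Longrightarrow> lex_localization es X = lex_localization es Y"
  by (induction es X rule: lex_localization.induct) auto

lemma lex_localization_neg: "lex_localization es (- X) = - lex_localization es X"
  by (induction es X rule: lex_localization.induct) auto

text \<open>At the first list element where \<open>A\<close> or \<open>B\<close> is nonzero, each
  nonzero value has the sign that yields \<open>s\<close>; nothing cancels there.\<close>

lemma lex_localization_vsum:
  assumes "snd ` set es \<subseteq> {1, -1}" "signs A" "signs B" "vsum A B C"
    "lex_localization es A = s" "lex_localization es B = s \<or> lex_localization es B = 0" "s \<noteq> 0"
  shows "lex_localization es C = s"
  using assms(1,5,6)
proof (induction es)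
  case (Cons ea es)
  obtain e \<alpha> where ea: "ea = (e, \<alpha>)" by (cases ea)
  have \<alpha>: "\<alpha> = 1 \<or> \<alpha> = -1" using Cons.prems(1) ea by auto
  show ?case
  proof (cases "A e = 0 \<and> B e = 0")
    case True
    then have "C e = 0" using vsum_l0[OF assms(4)] by simp
    then show ?thesis using True Cons ea by simp
  next
    case False
    then have "C e = (if A e \<noteq> 0 then A e else B e)"
      using vsum_l0[OF assms(4), of e] vsum_r0[OF assms(4), of e] vsum_same[OF assms(4), of e]
        Cons.prems(2,3) \<alpha> ea assms(7) signsD[OF assms(2), of e] signsD[OF assms(3), of e]
      by (auto split: if_splits)
    then show ?thesis using False Cons.prems(2,3) ea \<alpha> assms(7) by (auto split: if_splits)
  qed
qed simp

section \<open>Covector axioms for the explicit extension\<close>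

locale lex_data = oriented_matroid +
  fixes es :: "('a \<times> int) list" and p :: 'a
  assumes es_ground: "fst ` set es \<subseteq> E" and es_signs: "snd ` set es \<subseteq> {1, -1}" and p_new: "p \<notin> E"
begin

abbreviation lex :: "'a signvec \<Rightarrow> int" where "lex \<equiv> lex_localization es"

lemma at_p: "X \<in> L \<Longrightarrow> X p = 0"
  using covector_supp p_new by (auto simp: supp_def)

lemma lex_upd [simp]: "lex (X(p := s)) = lex X"
  by (rule lex_localization_cong) (use es_ground p_new in auto)

lemma lex_sign: "X \<in> L \<Longrightarrow> lex X \<in> {1, -1, 0}"
  using lex_localization_sign es_signs covector_signs by blast

lemma lex_face:
  assumes "A \<preceq> X" "lex X = 0" shows "lex A = 0"
  using assms lex_localization_zero_iff[OF es_signs] face_le_zero by metis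

text \<open>Think of \<open>X\<close> as a cell: it meets an open side of \<open>p\<close> if some
  face lies on that side, and it meets \<open>p\<close> itself if it is contained in
  \<open>p\<close> or has faces on both sides.\<close>

definition ext_ok :: "'a signvec \<Rightarrow> int \<Rightarrow> bool" where
  "ext_ok X s \<longleftrightarrow> X \<in> L \<and> s \<in> {1, -1, 0} \<and> (s \<noteq> 0 \<longrightarrow> (\<exists>A \<in> L. A \<preceq> X \<and> lex A = s)) \<and>
     (s = 0 \<longrightarrow> lex X = 0 \<or> (\<exists>A \<in> L. A \<preceq> X \<and> lex A = 1) \<and> (\<exists>A \<in> L. A \<preceq> X \<and> lex A = -1))"

lemma mem_lex_ext: "X \<in> lex_ext es p L \<longleftrightarrow> ext_ok (X(p := 0)) (X p)"
proof -
  have "X p = 0 \<Longrightarrow> X(p := 0) = X" by (auto simp: fun_eq_iff)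
  then show ?thesis using lex_sign unfolding lex_ext_def ext_ok_def
    by (cases "X p = 0") (auto, (metis insertE singletonD)+)
qed

lemma upd_mem_lex_ext: "X \<in> L \<Longrightarrow> X(p := s) \<in> lex_ext es p L \<longleftrightarrow> ext_ok X s"
  using at_p by (simp add: mem_lex_ext fun_upd_idem)

lemma ext_ok_lex: "X \<in> L \<Longrightarrow> ext_ok X (lex X)"
  unfolding ext_ok_def using lex_sign face_le_refl by metis

lemma ext_ok_pos: "X \<in> L \<Longrightarrow> A \<in> L \<Longrightarrow> A \<preceq> X \<Longrightarrow> lex A = s \<Longrightarrow> s \<noteq> 0 \<Longrightarrow> ext_ok X s"
  using lex_sign by (auto simp: ext_ok_def)

lemma ext_ok_zeroI:
  "X \<in> L \<Longrightarrow> A \<in> L \<Longrightarrow> A \<preceq> X \<Longrightarrow> lex A = s \<Longrightarrow> s \<noteq> 0 \<Longrightarrow> B \<in> L \<Longrightarrow> B \<preceq> X \<Longrightarrow> lex B = - s \<Longrightarrow> ext_ok X 0"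
  using lex_sign[of A] by (auto simp: ext_ok_def)

lemma ext_ok_face:
  assumes "ext_ok X s" "t = s \<or> s = 0" "t \<in> {1, -1}"
  shows "lex X = 0 \<and> s = 0 \<or> (\<exists>A \<in> L. A \<preceq> X \<and> lex A = t)"
  using assms by (auto simp: ext_ok_def)

lemma ext_ok_comp:
  assumes "ext_ok X s" "ext_ok Y t"
  shows "ext_ok (X \<circ>\<^sub>s Y) (if s \<noteq> 0 then s else t)"
proof -
  have XY: "X \<in> L" "Y \<in> L" "X \<circ>\<^sub>s Y \<in> L" using assms covector_comp by (auto simp: ext_ok_def)
  have le: "\<exists>A' \<in> L. A' \<preceq> X \<circ>\<^sub>s Y \<and> lex A' = k" if "\<exists>A \<in> L. A \<preceq> X \<and> lex A = k" for k
    using that face_le_comp face_le_trans by blast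
  show ?thesis
  proof (cases "s = 0 \<and> lex X = 0")
    case False
    then show ?thesis
    proof (cases "s = 0")
      case True
      then have "\<exists>A \<in> L. A \<preceq> X \<circ>\<^sub>s Y \<and> lex A = 1" "\<exists>A \<in> L. A \<preceq> X \<circ>\<^sub>s Y \<and> lex A = -1"
        using False assms(1) le by (auto simp: ext_ok_def)
      then show ?thesis using True XY assms(2) by (auto simp: ext_ok_def)
    next
      case False
      then show ?thesis using assms(1) le[of s] XY by (auto simp: ext_ok_def)
    qed
  next
    case True
    \<comment> \<open>\<open>X\<close> vanishes on the whole list, so a face \<open>A\<close> of
      \<open>Y\<close> can be replaced by \<open>X \<circ>\<^sub>s A\<close> without changing its
      sign.\<close>
    have zero: "X e = 0" if "e \<in> fst ` set es" for e
      using True that lex_localization_zero_iff[OF es_signs] by blast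
    have eq: "lex (X \<circ>\<^sub>s B) = lex B" for B
      by (rule lex_localization_cong) (simp add: zero comp_vec_def)
    have "\<exists>A' \<in> L. A' \<preceq> X \<circ>\<^sub>s Y \<and> lex A' = k" if "\<exists>A \<in> L. A \<preceq> Y \<and> lex A = k" for k
    proof -
      from that obtain A where "A \<in> L" "A \<preceq> Y" "lex A = k" by auto
      moreover from this have "X \<circ>\<^sub>s A \<preceq> X \<circ>\<^sub>s Y" by (auto simp: face_le_def comp_vec_def)
      ultimately show ?thesis using covector_comp[OF XY(1)] eq by blast
    qed
    then show ?thesis using True assms(2) XY eq by (auto simp: ext_ok_def)
  qed
qed

text \<open>If one of the two compositions gets the sign opposed to that of its first factor, it has
  faces on both sides and may be put on \<open>p\<close>. Otherwise the list itself supplies an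
  element to eliminate, and the result \<open>Z\<close>, alone or composed with \<open>X\<close> or
  \<open>Y\<close>, may be put on \<open>p\<close>.\<close>

lemma ext_ok_elim_p:
  assumes "ext_ok X s" "ext_ok Y (- s)" "s \<noteq> 0"
  shows "\<exists>Z. ext_ok Z 0 \<and> (\<forall>h. h \<notin> sep X Y \<longrightarrow> Z h = (X \<circ>\<^sub>s Y) h)"
proof -
  have XY: "X \<in> L" "Y \<in> L" "s \<in> {1, -1}" using assms by (auto simp: ext_ok_def)
  note c = covector_comp[OF XY(1,2)] covector_comp[OF XY(2,1)]
  obtain A where A: "A \<in> L" "A \<preceq> X" "lex A = s" using assms by (auto simp: ext_ok_def)
  obtain B where B: "B \<in> L" "B \<preceq> Y" "lex B = - s" using assms by (auto simp: ext_ok_def)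
  have yx: "(Y \<circ>\<^sub>s X) h = (X \<circ>\<^sub>s Y) h" if "h \<notin> sep X Y" for h
    using that signsD[OF covector_signs[OF XY(1)], of h] signsD[OF covector_signs[OF XY(2)], of h]
    by (auto simp: sep_def comp_vec_def)
  have ne: "lex (X \<circ>\<^sub>s Y) \<noteq> 0" "lex (Y \<circ>\<^sub>s X) \<noteq> 0"
    using lex_face[OF face_le_trans[OF A(2) face_le_comp]] lex_face[OF face_le_trans[OF B(2) face_le_comp]]
      A(3) B(3) assms(3) by auto
  then have sg: "lex (X \<circ>\<^sub>s Y) = s \<or> lex (X \<circ>\<^sub>s Y) = - s" "lex (Y \<circ>\<^sub>s X) = s \<or> lex (Y \<circ>\<^sub>s X) = - s"
    using XY(3) lex_sign[OF c(1)] lex_sign[OF c(2)] by auto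
  consider "lex (X \<circ>\<^sub>s Y) = - s" | "lex (Y \<circ>\<^sub>s X) = s" | "lex (X \<circ>\<^sub>s Y) = s" "lex (Y \<circ>\<^sub>s X) = - s"
    using sg by blast
  then show ?thesis
  proof cases
    case 1
    have "ext_ok (X \<circ>\<^sub>s Y) 0"
      by (rule ext_ok_zeroI[OF c(1) A(1) face_le_trans[OF A(2) face_le_comp] A(3) assms(3) c(1) _ 1]) simp
    then show ?thesis by blast
  next
    case 2
    have "ext_ok (Y \<circ>\<^sub>s X) 0"
      by (rule ext_ok_zeroI[OF c(2) c(2) _ 2 assms(3) B(1) face_le_trans[OF B(2) face_le_comp] B(3)]) simp
    then show ?thesis using yx by blast
  next
    case 3
    \<comment> \<open>\<open>X\<close> and \<open>Y\<close> have opposite signs at the first relevant element, which is then eliminated.\<close>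
    have first: "\<exists>e \<in> fst ` set fs. X e = - Y e \<and> X e \<noteq> 0 \<and>
        (\<forall>Z T. Z e = 0 \<longrightarrow> (\<forall>h. X h = 0 \<and> Y h = 0 \<longrightarrow> Z h = 0) \<longrightarrow> (T = X \<or> T = Y) \<longrightarrow>
          lex_localization fs (Z \<circ>\<^sub>s T) = lex_localization fs T) \<and>
        lex_localization fs X = s \<and> lex_localization fs Y = - s"
      if "lex_localization fs (X \<circ>\<^sub>s Y) = s" "lex_localization fs (Y \<circ>\<^sub>s X) = - s" "snd ` set fs \<subseteq> {1,-1}" for fs
      using that
    proof (induction fs)
      case (Cons ea fs)
      obtain e \<alpha> where ea: "ea = (e, \<alpha>)" by (cases ea)
      show ?case
      proof (cases "X e = 0 \<and> Y e = 0")
        case True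
        then show ?thesis using Cons ea by (simp add: comp_vec_def)
      next
        case False
        have "X e = - Y e \<and> X e \<noteq> 0"
          using False Cons.prems ea assms(3) by (auto simp: comp_vec_def split: if_splits)
        then show ?thesis using ea Cons.prems by (auto simp: comp_vec_def)
      qed
    qed (use assms(3) in simp)
    obtain e where e: "X e = - Y e" "X e \<noteq> 0" "lex X = s" "lex Y = - s"
        "\<And>Z T. Z e = 0 \<Longrightarrow> (\<And>h. X h = 0 \<Longrightarrow> Y h = 0 \<Longrightarrow> Z h = 0) \<Longrightarrow> T = X \<or> T = Y \<Longrightarrow> lex (Z \<circ>\<^sub>s T) = lex T"
      using first[OF 3 es_signs] by blast
    have "e \<in> sep X Y" using e by (simp add: sep_def)
    then obtain Z where Z: "Z \<in> L" "Z e = 0" "\<And>h. h \<notin> sep X Y \<Longrightarrow> Z h = (X \<circ>\<^sub>s Y) h"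
      using covector_elim[OF XY(1,2)] by auto
    have Z0: "Z h = 0" if "X h = 0" "Y h = 0" for h using Z(3)[of h] that by (simp add: sep_def comp_vec_def)
    have lexT: "lex (Z \<circ>\<^sub>s T) = lex T" if "T = X \<or> T = Y" for T
      by (rule e(5)) (use Z(2) Z0 that in auto)
    have ZT: "(Z \<circ>\<^sub>s T) h = (X \<circ>\<^sub>s Y) h" if "h \<notin> sep X Y" "T = X \<or> T = Y" for T h
      using Z(3)[OF that(1)] that by (auto simp: comp_vec_def split: if_splits)
    consider "lex Z = 0" | "lex Z = s" | "lex Z = - s" using lex_sign[OF Z(1)] XY(3) by auto
    then show ?thesis
    proof cases
      case 1 then show ?thesis using Z ext_ok_lex[OF Z(1)] by auto
    next
      case 2
      have "ext_ok (Z \<circ>\<^sub>s Y) 0"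
        using ext_ok_zeroI[OF covector_comp[OF Z(1) XY(2)] Z(1) face_le_comp 2 assms(3) covector_comp[OF Z(1) XY(2)]]
          e(4) lexT[of Y] by simp
      then show ?thesis using ZT by blast
    next
      case 3
      have "ext_ok (Z \<circ>\<^sub>s X) 0"
        using ext_ok_zeroI[OF covector_comp[OF Z(1) XY(1)] covector_comp[OF Z(1) XY(1)] _ _ assms(3) Z(1) face_le_comp 3]
          e(3) lexT[of X] by simp
      then show ?thesis using ZT by blast
    qed
  qed
qed

text \<open>It suffices to find \<open>C\<close> of sign \<open>s\<close> that vanishes at
  \<open>h\<close> and agrees with the composition where it is nonzero outside
  \<open>sep X Y\<close>; an ordinary elimination is then composed behind it. \<open>A\<close> or
  \<open>B\<close> serves, or the elimination of \<open>h\<close> between them, which keeps the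
  sign.\<close>

lemma ext_ok_elim_sign:
  assumes "X \<in> L" "Y \<in> L" "h \<in> sep X Y" and A: "A \<in> L" "A \<preceq> X" "lex A = s" "s \<noteq> 0"
    and B: "B \<in> L" "B \<preceq> Y" "lex B = s \<or> B = Y \<and> lex B = 0"
  shows "\<exists>Z. Z h = 0 \<and> (\<forall>k. k \<notin> sep X Y \<longrightarrow> Z k = (X \<circ>\<^sub>s Y) k) \<and> ext_ok Z s"
proof -
  obtain Z0 where Z0: "Z0 \<in> L" "Z0 h = 0" "\<And>k. k \<notin> sep X Y \<Longrightarrow> Z0 k = (X \<circ>\<^sub>s Y) k"
    using covector_elim[OF assms(1-3)] by auto
  have *: ?thesis if C: "C \<in> L" "C h = 0" "lex C = s" "\<And>k. k \<notin> sep X Y \<Longrightarrow> C k = 0 \<or> C k = (X \<circ>\<^sub>s Y) k" for C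
  proof -
    have "(C \<circ>\<^sub>s Z0) h = 0" using C Z0 by (simp add: comp_vec_def)
    moreover have "(C \<circ>\<^sub>s Z0) k = (X \<circ>\<^sub>s Y) k" if "k \<notin> sep X Y" for k
      using C(4)[OF that] Z0(3)[OF that] by (auto simp: comp_vec_def)
    moreover have "ext_ok (C \<circ>\<^sub>s Z0) s"
      using ext_ok_pos[OF covector_comp[OF C(1) Z0(1)] C(1) face_le_comp C(3) A(4)] .
    ultimately show ?thesis by blast
  qed
  note sX = signsD[OF covector_signs[OF assms(1)]] and sY = signsD[OF covector_signs[OF assms(2)]]
  have offA: "A k = 0 \<or> A k = (X \<circ>\<^sub>s Y) k" for k
    using A(2) by (auto simp: face_le_def comp_vec_def dest!: spec[of _ k])
  have offB: "B k = 0 \<or> B k = (X \<circ>\<^sub>s Y) k" if "k \<notin> sep X Y" for k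
    using B(2) that sX[of k] sY[of k] by (auto simp: face_le_def comp_vec_def sep_def dest!: spec[of _ k])
  have Yh: "X h = - Y h" "Y h \<noteq> 0" using assms(3) by (auto simp: sep_def)
  consider "A h = 0" | "B h = 0" "lex B = s" | "A h \<noteq> 0" "B h \<noteq> 0" using B(3) Yh by blast
  then show ?thesis
  proof cases
    case 1 then show ?thesis using *[OF A(1) _ A(3)] offA by blast
  next
    case 2 then show ?thesis using *[OF B(1)] offB by blast
  next
    case 3
    have ABh: "A h = - B h" using 3 A(2) B(2) Yh by (auto simp: face_le_def dest!: spec[of _ h])
    obtain C where C: "C \<in> covs L UNIV" "C h = 0" "vsum A B C"
      using covs_elim[of A UNIV B h] A(1) B(1) ABh 3 by (auto simp: covs_def)
    have "lex C = s"
      using lex_localization_vsum[OF es_signs covector_signs[OF A(1)] covector_signs[OF B(1)] C(3) A(3) _ A(4)] B(3)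
      by auto
    moreover have "C k = 0 \<or> C k = (X \<circ>\<^sub>s Y) k" if "k \<notin> sep X Y" for k
      using offA[of k] offB[OF that] vsum_l0[OF C(3), of k] vsum_r0[OF C(3), of k] vsum_same[OF C(3), of k] by metis
    ultimately show ?thesis using *[of C] C covs_in by blast
  qed
qed

lemma ext_ok_elim:
  assumes X: "ext_ok X s" and Y: "ext_ok Y t" and h: "h \<in> sep X Y"
  shows "\<exists>Z r. Z h = 0 \<and> (\<forall>k. k \<notin> sep X Y \<longrightarrow> Z k = (X \<circ>\<^sub>s Y) k) \<and> ext_ok Z r \<and>
    (\<not> (s = - t \<and> s \<noteq> 0) \<longrightarrow> r = (if s \<noteq> 0 then s else t))"
proof -
  have XY: "X \<in> L" "Y \<in> L" "s \<in> {1,-1,0}" "t \<in> {1,-1,0}" using X Y by (auto simp: ext_ok_def)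
  obtain Z0 where Z0: "Z0 \<in> L" "Z0 h = 0" "\<And>k. k \<notin> sep X Y \<Longrightarrow> Z0 k = (X \<circ>\<^sub>s Y) k"
    using covector_elim[OF XY(1,2) h] by auto
  have comm: "(Y \<circ>\<^sub>s X) k = (X \<circ>\<^sub>s Y) k" "sep Y X = sep X Y" if "k \<notin> sep X Y" for k
    using that signsD[OF covector_signs[OF XY(1)], of k] signsD[OF covector_signs[OF XY(2)], of k]
    by (auto simp: sep_def comp_vec_def)
  have sepc: "sep Y X = sep X Y" by (auto simp: sep_def)
  have sgn: "\<exists>Z. Z h = 0 \<and> (\<forall>k. k \<notin> sep X Y \<longrightarrow> Z k = (X \<circ>\<^sub>s Y) k) \<and> ext_ok Z r"
    if r: "r \<in> {1,-1}" "s = r \<or> s = 0" "t = r \<or> t = 0" "\<not> (s = 0 \<and> lex X = 0 \<and> t = 0 \<and> lex Y = 0)" for r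
  proof -
    have fX: "s = 0 \<and> lex X = 0 \<or> (\<exists>A \<in> L. A \<preceq> X \<and> lex A = r)"
      using ext_ok_face[OF X, of r] r by auto
    have fY: "t = 0 \<and> lex Y = 0 \<or> (\<exists>A \<in> L. A \<preceq> Y \<and> lex A = r)"
      using ext_ok_face[OF Y, of r] r by auto
    have r0: "r \<noteq> 0" using r by auto
    show ?thesis
    proof (cases "s = 0 \<and> lex X = 0")
      case False
      then obtain A where A: "A \<in> L" "A \<preceq> X" "lex A = r" using fX by auto
      obtain B where B: "B \<in> L" "B \<preceq> Y" "lex B = r \<or> B = Y \<and> lex B = 0"
        using fY XY(2) face_le_refl by metis
      show ?thesis using ext_ok_elim_sign[OF XY(1,2) h A r0 B] .
    next
      case True
      then obtain B where B: "B \<in> L" "B \<preceq> Y" "lex B = r" using fY r(4) by auto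
      have h': "h \<in> sep Y X" using h sepc by simp
      from ext_ok_elim_sign[OF XY(2,1) h' B r0 XY(1) face_le_refl] True sepc comm(1) show ?thesis by auto
    qed
  qed
  show ?thesis
  proof (cases "s = - t \<and> s \<noteq> 0")
    case True
    then show ?thesis using Z0 ext_ok_lex[OF Z0(1)] by blast
  next
    case False
    show ?thesis
    proof (cases "s = 0 \<and> t = 0")
      case False
      then have "\<exists>Z. Z h = 0 \<and> (\<forall>k. k \<notin> sep X Y \<longrightarrow> Z k = (X \<circ>\<^sub>s Y) k) \<and> ext_ok Z (if s \<noteq> 0 then s else t)"
        using \<open>\<not> (s = - t \<and> s \<noteq> 0)\<close> XY by (intro sgn) auto
      then show ?thesis by blast
    next
      case st: True
      show ?thesis
      proof (cases "lex X = 0 \<and> lex Y = 0")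
        case True
        have "lex Z0 = 0"
          unfolding lex_localization_zero_iff[OF es_signs]
        proof
          fix e assume "e \<in> fst ` set es"
          then have "X e = 0" "Y e = 0" using True lex_localization_zero_iff[OF es_signs] by blast+
          then show "Z0 e = 0" using Z0(3)[of e] by (simp add: sep_def comp_vec_def)
        qed
        then show ?thesis using Z0 ext_ok_lex[OF Z0(1)] st by metis
      next
        case False
        \<comment> \<open>The sign zero is reached in two stages: \<open>h\<close> is eliminated
          once for each sign at \<open>p\<close>, then \<open>p\<close> is eliminated between the
          results.\<close>
        obtain U where U: "U h = 0" "\<And>k. k \<notin> sep X Y \<Longrightarrow> U k = (X \<circ>\<^sub>s Y) k" "ext_ok U 1"
          using sgn[of 1] st False by auto
        obtain V where V: "V h = 0" "\<And>k. k \<notin> sep X Y \<Longrightarrow> V k = (X \<circ>\<^sub>s Y) k" "ext_ok V (- 1)"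
          using sgn[of "-1"] st False by auto
        obtain Z where Z: "ext_ok Z 0" "\<And>k. k \<notin> sep U V \<Longrightarrow> Z k = (U \<circ>\<^sub>s V) k"
          using ext_ok_elim_p[OF U(3) V(3)] by auto
        have "Z h = 0" using Z(2)[of h] U V by (simp add: sep_def comp_vec_def)
        moreover have "Z k = (X \<circ>\<^sub>s Y) k" if "k \<notin> sep X Y" for k
          using U(2)[OF that] V(2)[OF that] Z(2)[of k] by (auto simp: sep_def comp_vec_def split: if_splits)
        ultimately show ?thesis using Z(1) st by auto
      qed
    qed
  qed
qed

lemma oriented_matroid_lex_ext: "oriented_matroid (insert p E) (lex_ext es p L)"
proof
  show "finite (insert p E)" using finite_ground by simp
  show "lex_ext es p L \<subseteq> sign_vectors (insert p E)"
  proof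
    fix X assume "X \<in> lex_ext es p L"
    then have X: "X(p := 0) \<in> L" "X p \<in> {1, -1, 0}" by (auto simp: mem_lex_ext ext_ok_def)
    have "(X(p := 0)) e \<in> {1, -1, 0} \<and> (e \<notin> E \<longrightarrow> (X(p := 0)) e = 0)" for e
      using X(1) covectors_sign unfolding sign_vectors_def by blast
    then show "X \<in> sign_vectors (insert p E)" using X(2) unfolding sign_vectors_def
      by (auto simp: fun_upd_def split: if_splits) metis+
  qed
  have "ext_ok zero_vec 0"
    using covector_zero lex_localization_zero_iff[OF es_signs] by (simp add: ext_ok_def)
  then show "zero_vec \<in> lex_ext es p L" by (simp add: mem_lex_ext zero_vec_def fun_upd_def)
next
  fix X assume X: "X \<in> lex_ext es p L"
  have neg: "\<exists>A \<in> L. A \<preceq> - Y \<and> lex A = - k" if "\<exists>A \<in> L. A \<preceq> Y \<and> lex A = k" for Y k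
  proof -
    from that obtain A where "A \<in> L" "A \<preceq> Y" "lex A = k" by auto
    then show ?thesis using covector_neg lex_localization_neg[of es A]
      by (intro bexI[of _ "- A"]) (auto simp: face_le_def)
  qed
  have "(- X)(p := 0) = - (X(p := 0))" by (auto simp: fun_eq_iff)
  then show "- X \<in> lex_ext es p L"
    using X neg[of "X(p := 0)" "X p"] neg[of "X(p := 0)" 1] neg[of "X(p := 0)" "-1"] covector_neg
      lex_localization_neg[of es "X(p := 0)"]
    by (auto simp: mem_lex_ext ext_ok_def)
next
  fix X Y assume XY: "X \<in> lex_ext es p L" "Y \<in> lex_ext es p L"
  have "(X \<circ>\<^sub>s Y)(p := 0) = X(p := 0) \<circ>\<^sub>s Y(p := 0)" by (auto simp: fun_eq_iff comp_vec_def)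
  then show "X \<circ>\<^sub>s Y \<in> lex_ext es p L"
    using XY ext_ok_comp[of "X(p := 0)" "X p" "Y(p := 0)" "Y p"] by (simp add: mem_lex_ext comp_vec_def)
next
  fix X Y e assume XY: "X \<in> lex_ext es p L" "Y \<in> lex_ext es p L" and e: "e \<in> sep X Y"
  let ?X = "X(p := 0)" and ?Y = "Y(p := 0)"
  have ok: "ext_ok ?X (X p)" "ext_ok ?Y (Y p)" using XY by (auto simp: mem_lex_ext)
  have "\<exists>Z r. ext_ok Z r \<and> (if e = p then r = 0 else Z e = 0) \<and>
    (\<forall>k. k \<notin> sep ?X ?Y \<longrightarrow> Z k = (?X \<circ>\<^sub>s ?Y) k) \<and>
    (\<not> (X p = - Y p \<and> X p \<noteq> 0) \<longrightarrow> r = (if X p \<noteq> 0 then X p else Y p))"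
  proof (cases "e = p")
    case True
    then have p: "X p = - Y p" "X p \<noteq> 0" using e by (auto simp: sep_def)
    then have "ext_ok ?Y (- X p)" using ok(2) by simp
    from ext_ok_elim_p[OF ok(1) this p(2)] show ?thesis using p True by auto
  next
    case False
    then have "e \<in> sep ?X ?Y" using e by (auto simp: sep_def)
    from ext_ok_elim[OF ok this] show ?thesis using False by (simp only: if_False) blast
  qed
  then obtain Z r where Z: "ext_ok Z r" "if e = p then r = 0 else Z e = 0"
    "\<And>k. k \<notin> sep ?X ?Y \<Longrightarrow> Z k = (?X \<circ>\<^sub>s ?Y) k"
    "\<not> (X p = - Y p \<and> X p \<noteq> 0) \<Longrightarrow> r = (if X p \<noteq> 0 then X p else Y p)" by blast
  have ZL: "Z \<in> L" using Z(1) by (simp add: ext_ok_def)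
  have "(Z(p := r)) h = (X \<circ>\<^sub>s Y) h" if "h \<notin> sep X Y" for h
  proof (cases "h = p")
    case True
    then show ?thesis using Z(4) that by (auto simp: sep_def comp_vec_def)
  next
    case False
    then have "h \<notin> sep ?X ?Y" using that by (auto simp: sep_def)
    then show ?thesis using Z(3)[of h] False by (simp add: comp_vec_def)
  qed
  moreover have "Z(p := r) \<in> lex_ext es p L" using Z(1) ZL upd_mem_lex_ext by blast
  moreover have "(Z(p := r)) e = 0" using Z(2) by (auto split: if_splits)
  ultimately show "\<exists>Z \<in> lex_ext es p L. Z e = 0 \<and> (\<forall>h. h \<notin> sep X Y \<longrightarrow> Z h = (X \<circ>\<^sub>s Y) h)" by blast
qed

end

section \<open>Uniqueness of the extension with the given localization\<close>

lemma lex_localization_first: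
  assumes "lex_localization es A \<noteq> 0"
  shows "\<exists>e. A e \<noteq> 0 \<and> (\<forall>C. C \<preceq> A \<longrightarrow> C e \<noteq> 0 \<longrightarrow> lex_localization es C = lex_localization es A)"
  using assms
proof (induction es)
  case (Cons ea es)
  obtain e \<alpha> where ea: "ea = (e, \<alpha>)" by (cases ea)
  show ?case
  proof (cases "A e = 0")
    case True
    then have "C e = 0" if "C \<preceq> A" for C using face_le_zero that by metis
    then show ?thesis using Cons True ea by auto
  next
    case False
    then show ?thesis using ea by (intro exI[of _ e]) (auto simp: face_le_def)
  qed
qed simp

text \<open>\<open>A\<close> minus a growing multiple of \<open>C\<close>, stopped when the first
  element of \<open>C\<close> vanishes.\<close>

lemma (in oriented_matroid) face_complement:
  assumes "A \<in> L" "C \<in> L" "C \<preceq> A" "C \<noteq> zero_vec"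
  shows "\<exists>A' \<in> L. A' \<preceq> A \<and> A' \<noteq> A \<and> (\<forall>h. C h = 0 \<longrightarrow> A' h = A h)"
proof -
  have sp: "sep (- C) A = supp C" using assms(3) by (auto simp: sep_def face_le_def supp_def)
  have "supp C \<noteq> {}" using assms(4) by (simp add: supp_zero_iff)
  then obtain V where V: "V \<in> L" "sep V A = {}" "\<And>h. h \<notin> supp C \<Longrightarrow> V h = (- C \<circ>\<^sub>s A) h" "\<exists>h \<in> supp C. V h = 0"
    using conformal_elim[OF assms(1) covector_neg[OF assms(2)]] sp by metis
  have off: "V h = A h" if "C h = 0" for h using V(3)[of h] that by (simp add: in_supp comp_vec_def)
  have "V \<preceq> A"
    by (rule face_leI[OF covector_signs[OF V(1)] covector_signs[OF assms(1)] V(2)])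
      (use off face_le_zero[OF assms(3)] in auto)
  moreover have "V \<noteq> A" using V(4) assms(3) by (auto simp: face_le_def supp_def)
  ultimately show ?thesis using V(1) off by blast
qed

context lex_data
begin

text \<open>The localization prescribes \<open>p\<close> on cocircuits only. Compositions yield all
  canonical extensions \<open>A(p := lex A)\<close>, and the other covectors of \<open>L'\<close>
  are traced back to these through the cocircuits of \<open>L'\<close> below them.\<close>

lemma extension_is_lex_ext:
  assumes "oriented_matroid (insert p E) L'" and del: "om_deletion L' p = L"
    and ncl: "\<not> om_coloop (insert p E) L' p"
    and loc: "\<And>Y. Y \<in> cocircuits L \<Longrightarrow> Y(p := lex Y) \<in> cocircuits L'"
  shows "L' = lex_ext es p L"
proof -
  interpret M: oriented_matroid "insert p E" L' by fact
  have down: "X(p := 0) \<in> L" if "X \<in> L'" for X using del that by (auto simp: om_deletion_def)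
  have up: "\<exists>t. X(p := t) \<in> L'" if X: "X \<in> L" for X
  proof -
    obtain X' where X': "X' \<in> L'" "X = X'(p := 0)" using del X by (auto simp: om_deletion_def)
    then have "X(p := X' p) = X'" by simp
    then show ?thesis using X' by metis
  qed
  \<comment> \<open>A covector supported on \<open>p\<close> alone would make \<open>p\<close> a
    coloop.\<close>
  have nonzero: "X(p := 0) \<noteq> zero_vec" if X: "X \<in> L'" "X p \<noteq> 0" for X
  proof
    assume z: "X(p := 0) = zero_vec"
    have Xh: "X h = 0" if "h \<noteq> p" for h using fun_cong[OF z, of h] that by simp
    then have s: "supp X = {p}" using X(2) by (auto simp: supp_def)
    have "X \<in> cocircuits L'"
    proof (rule M.cocircuitI[OF X(1)])
      show "X \<noteq> zero_vec" using X(2) by auto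
      fix Y assume Y: "Y \<in> L'" "Y \<noteq> zero_vec" "supp Y \<subseteq> supp X"
      have Yh: "Y h = 0" if "h \<noteq> p" for h using Y(3) s that by (auto simp: supp_def)
      have "Y p \<noteq> 0" using Y(2) Yh by (metis nonzeroE)
      then have "Y p = X p \<or> Y p = - X p"
        using X(2) signsD[OF M.covector_signs[OF X(1)], of p] signsD[OF M.covector_signs[OF Y(1)], of p] by auto
      then show "Y = X \<or> Y = - X" using Xh Yh unfolding fun_eq_iff by (metis neg_0_equal_iff_equal uminus_apply)
    qed
    then show False using ncl s by (auto simp: om_coloop_def)
  qed
  have canon: "A(p := lex A) \<in> L'" if "A \<in> L" for A
    using that
  proof (induction "card (supp A)" arbitrary: A rule: less_induct)
    case less
    obtain t where t: "A(p := t) \<in> L'" using up less.prems by blast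
    show ?case
    proof (cases "lex A = 0")
      case False
      from lex_localization_first[OF this] obtain e where e: "A e \<noteq> 0"
        "\<And>C. C \<preceq> A \<Longrightarrow> C e \<noteq> 0 \<Longrightarrow> lex C = lex A" by blast
      obtain C where C: "C \<in> cocircuits L" "C \<preceq> A" "C e \<noteq> 0" using cocircuit_below[OF less.prems e(1)] by auto
      have "C(p := lex A) \<in> L'" using loc[OF C(1)] e(2)[OF C(2,3)] by (auto simp: cocircuits_def)
      from M.covector_comp[OF this t] have "C(p := lex A) \<circ>\<^sub>s A(p := t) \<in> L'" .
      moreover have "C(p := lex A) \<circ>\<^sub>s A(p := t) = A(p := lex A)"
        using C(2) False by (auto simp: fun_eq_iff comp_vec_def face_le_def)
      ultimately show ?thesis by simp
    next
      case True
      show ?thesis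
      proof (cases "A = zero_vec")
        case True
        then have "A(p := lex A) = zero_vec" using \<open>lex A = 0\<close> by (auto simp: fun_eq_iff)
        then show ?thesis using M.covector_zero by simp
      next
        case False
        then obtain c where c: "A c \<noteq> 0" by (rule nonzeroE)
        obtain C where C: "C \<in> cocircuits L" "C \<preceq> A" "C c \<noteq> 0" using cocircuit_below[OF less.prems c] by auto
        have CL: "C \<in> L" "C \<noteq> zero_vec" using C by (auto simp: cocircuits_def)
        have lC: "lex C = 0" using lex_face[OF C(2) True] .
        then have C0: "C(p := 0) \<in> L'" using loc[OF C(1)] by (auto simp: cocircuits_def)
        obtain A' where A': "A' \<in> L" "A' \<preceq> A" "A' \<noteq> A" "\<And>h. C h = 0 \<Longrightarrow> A' h = A h"
          using face_complement[OF less.prems CL(1) C(2) CL(2)] by blast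
        have "supp A' \<subset> supp A" using A'(2,3) by (force simp: face_le_def supp_def fun_eq_iff)
        then have "card (supp A') < card (supp A)" using finite_supp[OF less.prems] psubset_card_mono by blast
        from less.hyps[OF this A'(1)] have "A'(p := 0) \<in> L'" using lex_face[OF A'(2) True] by simp
        from M.covector_comp[OF C0 this] have "C(p := 0) \<circ>\<^sub>s A'(p := 0) \<in> L'" .
        moreover have "C(p := 0) \<circ>\<^sub>s A'(p := 0) = A(p := lex A)"
          using C(2) A'(4) True by (auto simp: fun_eq_iff comp_vec_def face_le_def)
        ultimately show ?thesis by simp
      qed
    qed
  qed
  have sub1: "\<exists>A \<in> L. A \<preceq> X(p := 0) \<and> lex A = X p" if X: "X \<in> L'" "X p \<noteq> 0" for X
  proof -
    obtain C' where C': "C' \<in> cocircuits L'" "C' \<preceq> X" "C' p \<noteq> 0" using M.cocircuit_below[OF X] by auto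
    have Cp: "C' p = X p" using C'(2,3) by (auto simp: face_le_def dest!: spec[of _ p])
    let ?C = "C'(p := 0)"
    have C'L: "C' \<in> L'" using C'(1) by (simp add: cocircuits_def)
    have CL: "?C \<in> L" using down C'L by blast
    have Cnz: "?C \<noteq> zero_vec" using nonzero[OF C'L C'(3)] .
    then obtain h where h: "?C h \<noteq> 0" by (rule nonzeroE)
    then have hp: "h \<noteq> p" "C' h \<noteq> 0" by (auto split: if_splits)
    \<comment> \<open>The canonical extension has support inside that of \<open>C'\<close>, so
      minimality identifies it with \<open>C'\<close> and reveals the sign at
      \<open>p\<close>.\<close>
    have m: "?C(p := lex ?C) \<in> L'" using canon[OF CL] .
    have "supp (?C(p := lex ?C)) \<subseteq> supp C'" using C'(3) by (auto simp: supp_def)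
    moreover have "?C(p := lex ?C) \<noteq> zero_vec" using hp by (auto simp: fun_eq_iff)
    ultimately have "?C(p := lex ?C) = C' \<or> ?C(p := lex ?C) = - C'"
      using M.cocircuit_minimal[OF C'(1) m] by blast
    moreover have "?C(p := lex ?C) \<noteq> - C'" using hp by (metis fun_upd_other neg_equal_zero uminus_apply)
    ultimately have "lex ?C = X p" using Cp by (metis fun_upd_same)
    moreover have "?C \<preceq> X(p := 0)" using C'(2) by (auto simp: face_le_def)
    ultimately show ?thesis using CL by blast
  qed
  have sub0: "\<exists>A \<in> L. A \<preceq> X \<and> lex A = - lex X" if X: "X \<in> L'" "X p = 0" "lex X \<noteq> 0" for X
  proof -
    from lex_localization_first[OF X(3)] obtain e where e: "X e \<noteq> 0"
      "\<And>C. C \<preceq> X \<Longrightarrow> C e \<noteq> 0 \<Longrightarrow> lex C = lex X" by blast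
    obtain C where C: "C \<in> cocircuits L'" "C \<preceq> X" "C e \<noteq> 0" using M.cocircuit_below[OF X(1) e(1)] by auto
    have Cp: "C p = 0" using face_le_zero[OF C(2) X(2)] .
    then have C0: "C(p := 0) = C" by (auto simp: fun_eq_iff)
    have C'L: "C \<in> L'" "C \<noteq> zero_vec" using C(1) by (auto simp: cocircuits_def)
    have CL: "C \<in> L" using down[OF C'L(1)] C0 by simp
    have lC: "lex C = lex X" using e(2)[OF C(2,3)] .
    \<comment> \<open>Otherwise the prescribed extension would be a cocircuit of \<open>L'\<close>
      with \<open>C\<close> properly below it.\<close>
    have "C \<notin> cocircuits L"
    proof
      assume "C \<in> cocircuits L"
      from loc[OF this] have c: "C(p := lex X) \<in> cocircuits L'" using lC by simp
      have "C \<preceq> C(p := lex X)" using Cp by (auto simp: face_le_def)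
      then have "C = C(p := lex X)" using c C'L by (auto simp: cocircuits_def)
      then show False using Cp X(3) by (metis fun_upd_same)
    qed
    then obtain D0 where D0: "D0 \<in> L" "D0 \<noteq> zero_vec" "D0 \<preceq> C" "D0 \<noteq> C"
      using CL C'L by (auto simp: cocircuits_def)
    obtain c where c: "D0 c \<noteq> 0" using D0(2) by (rule nonzeroE)
    obtain D where D: "D \<in> cocircuits L" "D \<preceq> D0" "D c \<noteq> 0" using cocircuit_below[OF D0(1) c] by auto
    have DC: "D \<preceq> C" "D \<noteq> C" "D \<in> L"
      using face_le_trans[OF D(2) D0(3)] D0(3,4) D(1,2) by (auto simp: face_le_def fun_eq_iff cocircuits_def) metis
    have DL: "D(p := lex D) \<in> L'" using canon[OF DC(3)] .
    have Dp: "D p = 0" using at_p DC(3) by blast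
    have lDsign: "lex D = lex X \<or> lex D = - lex X \<or> lex D = 0" using lex_sign[OF DC(3)] X(3) lC lex_sign[OF CL] by auto
    then consider "lex D = 0" | "lex D = - lex X" | "lex D = lex X" by blast
    then show ?thesis
    proof cases
      case 1
      then have "D \<in> L'" using DL Dp by (metis fun_upd_triv)
      then show ?thesis using C(1) DC D(3) by (force simp: cocircuits_def)
    next
      case 2 then show ?thesis using DC face_le_trans[OF DC(1) C(2)] by blast
    next
      case 3
      \<comment> \<open>The covector \<open>V\<close> below plays the role of C - D; as
        \<open>C\<close> vanishes at \<open>p\<close>, it has the required opposite sign
        there.\<close>
      let ?V = "- (D(p := lex D))"
      have V: "?V \<in> L'" using M.covector_neg[OF DL] .
      obtain V where V': "V \<in> L'" "sep V C = {}" "\<And>h. h \<notin> sep ?V C \<Longrightarrow> V h = (?V \<circ>\<^sub>s C) h"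
        using M.conformal_elim[OF C'L(1) V] by blast
      have Vp: "V p = - lex X" using V'(3)[of p] Cp 3 X(3) by (auto simp: sep_def comp_vec_def)
      have VC: "V(p := 0) \<preceq> C"
      proof (rule face_leI)
        show "signs (V(p := 0))" "signs C" using down[OF V'(1)] CL covector_signs by auto
        show "sep (V(p := 0)) C = {}" using V'(2) by (auto simp: sep_def split: if_splits)
        fix h assume h: "C h = 0"
        then have "D h = 0" using face_le_zero DC(1) by metis
        then show "(V(p := 0)) h = 0" using V'(3)[of h] h by (auto simp: sep_def comp_vec_def)
      qed
      obtain A where "A \<in> L" "A \<preceq> V(p := 0)" "lex A = - lex X" using sub1[OF V'(1)] Vp X(3) by auto
      then show ?thesis using face_le_trans[OF _ face_le_trans[OF VC C(2)]] by blast
    qed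
  qed
  show ?thesis
  proof
    show "L' \<subseteq> lex_ext es p L"
    proof
      fix X assume X: "X \<in> L'"
      have X0: "X(p := 0) \<in> L" using down X by blast
      have "ext_ok (X(p := 0)) (X p)"
      proof (cases "X p = 0")
        case False
        then show ?thesis using sub1[OF X] ext_ok_pos[OF X0] by blast
      next
        case True
        then have eq: "X(p := 0) = X" by (auto simp: fun_eq_iff)
        show ?thesis
        proof (cases "lex X = 0")
          case True
          then show ?thesis using X0 eq \<open>X p = 0\<close> by (simp add: ext_ok_def)
        next
          case False
          then obtain A where "A \<in> L" "A \<preceq> X" "lex A = - lex X" using sub0[OF X True] by blast
          then show ?thesis using ext_ok_zeroI[of X X "lex X" A] X0 eq True False by simp
        qed
      qed
      then show "X \<in> lex_ext es p L" by (simp add: mem_lex_ext)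
    qed
    show "lex_ext es p L \<subseteq> L'"
    proof
      fix X assume "X \<in> lex_ext es p L"
      then have ok: "ext_ok (X(p := 0)) (X p)" by (simp add: mem_lex_ext)
      let ?X = "X(p := 0)"
      have X0: "?X \<in> L" using ok by (simp add: ext_ok_def)
      have *: "?X(p := s) \<in> L'" if A: "A \<in> L" "A \<preceq> ?X" "lex A = s" "s \<noteq> 0" for A s
      proof -
        obtain t where t: "?X(p := t) \<in> L'" using up[OF X0] by blast
        have "A(p := s) \<circ>\<^sub>s ?X(p := t) \<in> L'" using M.covector_comp[OF _ t] canon[OF A(1)] A(3) by simp
        moreover have "A(p := s) \<circ>\<^sub>s ?X(p := t) = ?X(p := s)"
          using A(2,4) by (auto simp: fun_eq_iff comp_vec_def face_le_def)
        ultimately show ?thesis by simp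
      qed
      show "X \<in> L'"
      proof (cases "X p = 0")
        case False
        then obtain A where "A \<in> L" "A \<preceq> ?X" "lex A = X p" using ok by (auto simp: ext_ok_def)
        from *[OF this False] show ?thesis by simp
      next
        case True
        then have eq: "?X = X" by (auto simp: fun_eq_iff)
        show ?thesis
        proof (cases "lex X = 0")
          case True
          then show ?thesis using canon[OF X0] \<open>X p = 0\<close> eq by simp
        next
          case False
          then obtain A B where "A \<in> L" "A \<preceq> ?X" "lex A = 1" "B \<in> L" "B \<preceq> ?X" "lex B = -1"
            using ok True eq by (auto simp: ext_ok_def)
          then have m: "?X(p := 1) \<in> L'" "?X(p := -1) \<in> L'" using *[of A 1] *[of B "-1"] by auto
          have "p \<in> sep (?X(p := 1)) (?X(p := -1))" by (simp add: sep_def)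
          from M.covector_elim[OF m this] obtain Z where Z: "Z \<in> L'" "Z p = 0"
            "\<And>h. h \<notin> sep (?X(p := 1)) (?X(p := -1)) \<Longrightarrow> Z h = (?X(p := 1) \<circ>\<^sub>s ?X(p := -1)) h" by auto
          have "Z h = X h" for h
            using Z(2) Z(3)[of h] True by (cases "h = p") (auto simp: sep_def comp_vec_def split: if_splits)
          then have "Z = X" by auto
          then show ?thesis using Z by simp
        qed
      qed
    qed
  qed
qed

end

section \<open>Infinitesimally close elements\<close>

text \<open>In \<open>K\<close> the element \<open>p\<close> lies infinitesimally close to \<open>e\<close>, on the side \<open>\<alpha>\<close>, while \<open>N\<close> is an
  extension by \<open>p\<close> of the same oriented matroid that prescribes how \<open>p\<close> meets \<open>e\<close>.\<close>

locale near = K: oriented_matroid E K + N: oriented_matroid E N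
  for E :: "'a set" and K N +
  fixes p e :: 'a and \<alpha> :: int
  assumes pe: "p \<noteq> e" and \<alpha>: "\<alpha> = 1 \<or> \<alpha> = -1"
    and near_face: "X \<in> K \<Longrightarrow> X e \<noteq> 0 \<Longrightarrow> X p \<noteq> \<alpha> * X e \<Longrightarrow>
      \<exists>A \<in> K. A e = 0 \<and> A p = - (\<alpha> * X e) \<and> off_le p A X"
    and same: "X e = 0 \<Longrightarrow> X \<in> K \<longleftrightarrow> X \<in> N"
    and toN: "X \<in> K \<Longrightarrow> \<exists>t. X(p := t) \<in> N"
    and toK: "X \<in> N \<Longrightarrow> X e \<noteq> 0 \<Longrightarrow> X(p := \<alpha> * X e) \<in> K"
    and nocoloop: "X \<in> K \<Longrightarrow> X p \<noteq> 0 \<Longrightarrow> \<exists>h. h \<noteq> p \<and> X h \<noteq> 0"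

text \<open>Off \<open>e\<close> the head of the list decides, on \<open>e\<close> the tail does. A
  face on the side of \<open>p\<close> opposed to \<open>\<alpha> * X e\<close> must therefore lie
  on \<open>e\<close>.\<close>

lemma near_lex_ext:
  assumes "lex_data E L ((e, \<alpha>) # es) p"
  shows "near (insert p E) (lex_ext ((e, \<alpha>) # es) p L) (lex_ext es p L) p e \<alpha>"
proof -
  interpret K: lex_data E L "(e, \<alpha>) # es" p by fact
  interpret N: lex_data E L es p
    using K.es_ground K.es_signs K.p_new by unfold_locales auto
  have pe: "p \<noteq> e" using K.es_ground K.p_new by auto
  have \<alpha>: "\<alpha> = 1 \<or> \<alpha> = -1" using K.es_signs by auto
  have le0: "lex_localization ((e, \<alpha>) # es) A = lex_localization es A" if "A e = 0" for A using that by simp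
  show ?thesis
  proof (intro near.intro near_axioms.intro K.oriented_matroid_lex_ext N.oriented_matroid_lex_ext pe \<alpha>)
    fix X :: "'a signvec" assume X: "X \<in> lex_ext ((e, \<alpha>) # es) p L" "X e \<noteq> 0" "X p \<noteq> \<alpha> * X e"
    let ?X = "X(p := 0)"
    have ok: "K.ext_ok ?X (X p)" using X(1) by (simp add: K.mem_lex_ext)
    have Xe: "?X e \<noteq> 0" "lex_localization ((e, \<alpha>) # es) ?X = \<alpha> * X e" using X(2) pe by auto
    have Xsg: "X e = 1 \<or> X e = -1" using signsD[OF K.covector_signs, of ?X e] ok X(2) pe by (auto simp: K.ext_ok_def)
    have ls: "lex_localization ((e, \<alpha>) # es) X = \<alpha> * X e" using X(2) by simp
    have "\<exists>A \<in> L. A \<preceq> ?X \<and> lex_localization ((e, \<alpha>) # es) A = - (\<alpha> * X e)"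
    proof (cases "X p = 0")
      case True
      have "\<alpha> * X e = 1 \<or> \<alpha> * X e = -1" using \<alpha> Xsg by auto
      moreover from this True have "\<exists>A \<in> L. A \<preceq> ?X \<and> lex_localization ((e, \<alpha>) # es) A = 1"
          "\<exists>A \<in> L. A \<preceq> ?X \<and> lex_localization ((e, \<alpha>) # es) A = -1"
        using ok Xe(2) unfolding K.ext_ok_def by (metis zero_neq_one neg_0_equal_iff_equal)+
      ultimately show ?thesis by (metis minus_minus)
    next
      case False
      then have "X p = - (\<alpha> * X e)" using ok X(3) \<alpha> Xsg by (auto simp: K.ext_ok_def)
      then show ?thesis using ok False by (auto simp: K.ext_ok_def)
    qed
    then obtain A where A: "A \<in> L" "A \<preceq> ?X" "lex_localization ((e, \<alpha>) # es) A = - (\<alpha> * X e)" by blast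
    have Ae: "A e = 0"
    proof (rule ccontr)
      assume "A e \<noteq> 0"
      moreover have "A e = 0 \<or> A e = X e" using A(2) pe by (auto simp: face_le_def dest!: spec[of _ e])
      ultimately show False using A(3) X(2) \<alpha> by auto
    qed
    have "A(p := - (\<alpha> * X e)) \<in> lex_ext ((e, \<alpha>) # es) p L"
      using K.upd_mem_lex_ext[OF A(1)] K.ext_ok_lex[OF A(1)] A(3) by simp
    then show "\<exists>A \<in> lex_ext ((e, \<alpha>) # es) p L. A e = 0 \<and> A p = - (\<alpha> * X e) \<and> off_le p A X"
      using Ae A(2) pe by (intro bexI[of _ "A(p := - (\<alpha> * X e))"]) (auto simp: off_le_def face_le_def)
  next
    fix X :: "'a signvec" assume Xe: "X e = 0"
    have "A e = 0" if "A \<preceq> X(p := 0)" for A using face_le_zero[OF that, of e] Xe pe by simp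
    then have face: "A \<preceq> X(p := 0) \<and> lex_localization ((e, \<alpha>) # es) A = k \<longleftrightarrow>
        A \<preceq> X(p := 0) \<and> lex_localization es A = k" for A k
      using le0 by auto
    have "lex_localization ((e, \<alpha>) # es) (X(p := 0)) = lex_localization es (X(p := 0))"
      using le0 Xe pe by simp
    then show "X \<in> lex_ext ((e, \<alpha>) # es) p L \<longleftrightarrow> X \<in> lex_ext es p L"
      unfolding K.mem_lex_ext N.mem_lex_ext K.ext_ok_def N.ext_ok_def face by (simp only:)
  next
    fix X :: "'a signvec" assume "X \<in> lex_ext ((e, \<alpha>) # es) p L"
    then have X0: "X(p := 0) \<in> L" by (simp add: lex_ext_def)
    then show "\<exists>t. X(p := t) \<in> lex_ext es p L"
      using N.upd_mem_lex_ext[OF X0] N.ext_ok_lex[OF X0] by (metis fun_upd_upd)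
  next
    fix X :: "'a signvec" assume X: "X \<in> lex_ext es p L" "X e \<noteq> 0"
    then have X0: "X(p := 0) \<in> L" by (simp add: lex_ext_def)
    then show "X(p := \<alpha> * X e) \<in> lex_ext ((e, \<alpha>) # es) p L"
      using K.upd_mem_lex_ext[OF X0, of "\<alpha> * X e"] K.ext_ok_lex[OF X0] X(2) pe by simp
  next
    fix X :: "'a signvec" assume X: "X \<in> lex_ext ((e, \<alpha>) # es) p L" "X p \<noteq> 0"
    then obtain A where A: "A \<preceq> X(p := 0)" "lex_localization ((e, \<alpha>) # es) A \<noteq> 0" by (auto simp: lex_ext_def)
    then have "X(p := 0) \<noteq> zero_vec" using K.lex_face[OF A(1)] lex_localization_zero_iff[OF K.es_signs] zero_vec_apply by metis
    then show "\<exists>h. h \<noteq> p \<and> X h \<noteq> 0" by (metis fun_upd_apply nonzeroE)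
  qed
qed

definition scale :: "int \<Rightarrow> 'a signvec \<Rightarrow> 'a signvec" where
  "scale s X = (\<lambda>h. s * X h)"

lemma scale_apply [simp]: "scale s X h = s * X h"
  by (simp add: scale_def)

lemma scale_one: "scale 1 X = X" and scale_minus_one: "scale (-1) X = - X"
  by (simp_all add: scale_def fun_eq_iff)

lemma (in oriented_matroid) cocircuit_rank1: "X \<in> cocircuits L \<Longrightarrow> rank_le L 1 (supp X)"
proof -
  assume X: "X \<in> cocircuits L"
  have "U = zero_vec" if c: "V \<in> covs L (supp X)" "V c \<noteq> 0" "U \<in> covs L (supp X - {c})" for U V c
  proof (rule ccontr)
    assume "U \<noteq> zero_vec"
    moreover have "U \<in> L" "supp U \<subseteq> supp X" "U c = 0" "V \<in> L" "supp V \<subseteq> supp X" "V \<noteq> zero_vec"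
      using c by (auto simp: covs_def supp_def)
    ultimately have "U = X \<or> U = - X" "V = X \<or> V = - X" using cocircuit_minimal[OF X] by blast+
    then show False using \<open>U c = 0\<close> c(2) by auto
  qed
  then show ?thesis by auto
qed

lemma (in oriented_matroid) step_scaleI:
  assumes "rank_le L 2 S" "X \<in> covs L S" "Y \<in> covs L S" "Z \<in> covs L S" "X \<in> cocircuits L" "Y \<in> cocircuits L"
    "X g = \<sigma>" "Y g = \<sigma>" "\<sigma> = 1 \<or> \<sigma> = -1" "Z g = 0" "vsum X Z Y" "X \<noteq> Y"
  shows "step L g (scale \<sigma> X) (scale \<sigma> Z) (scale \<sigma> Y)"
  using assms(9)
proof
  assume "\<sigma> = 1"
  then show ?thesis using stepI[OF assms(1-6) _ _ assms(10-12)] assms(7,8) by (simp add: scale_one)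
next
  assume s: "\<sigma> = -1"
  have "- X \<noteq> - Y" using assms(12) by (metis neg_neg)
  then show ?thesis
    using stepI[OF assms(1) covs_neg[OF assms(2)] covs_neg[OF assms(3)] covs_neg[OF assms(4)]
        cocircuit_neg[OF assms(5)] cocircuit_neg[OF assms(6)] _ _ _ vsum_neg[OF assms(11)]] assms(7,8,10) s
    by (simp add: scale_minus_one)
qed

lemma (in oriented_matroid) cacyc_if_acyc: "acyc L g f \<Longrightarrow> cacyc L g f"
proof -
  have "(cwk L g f)\<^sup>* \<subseteq> (wk L g f 1)\<^sup>*" by (rule rtrancl_mono) (auto simp: cwk_def wk_def)
  then show "acyc L g f \<Longrightarrow> cacyc L g f" unfolding acyc_def cacyc_def by blast
qed

lemma off_le_neg: "off_le p (- A) (- X) \<longleftrightarrow> off_le p A X"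
  by (auto simp: off_le_def)

lemma off_leD: "off_le p A X \<Longrightarrow> h \<noteq> p \<Longrightarrow> A h = 0 \<or> A h = X h"
  by (simp add: off_le_def)

lemma rank_le_SucD: "rank_le L (Suc n) S \<Longrightarrow> U \<in> covs L S \<Longrightarrow> U c \<noteq> 0 \<Longrightarrow> rank_le L n (S - {c})"
  by auto

section \<open>Comparison of the cocircuits of \<open>K\<close> and \<open>N\<close>\<close>

context near
begin

lemma \<alpha>\<alpha> [simp]: "\<alpha> * \<alpha> = 1" "\<alpha> * (\<alpha> * k) = k" "\<alpha> \<noteq> 0"
  using \<alpha> by auto

text \<open>The cocircuits of \<open>K\<close> that come from \<open>N\<close>; all others cross \<open>p\<close> next to \<open>e\<close>.\<close>

definition inherited :: "'a signvec \<Rightarrow> bool" where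
  "inherited X \<longleftrightarrow> X \<in> cocircuits K \<and> (X e = 0 \<or> X p = \<alpha> * X e)"

text \<open>The point on \<open>e\<close> infinitesimally close to a point on \<open>p\<close>.\<close>

definition foot :: "'a signvec \<Rightarrow> 'a signvec" where
  "foot X = (if X e = 0 then X else
    (SOME A. A \<in> K \<and> A e = 0 \<and> A p = - (\<alpha> * X e) \<and> off_le p A X))"

text \<open>Forgets that \<open>p\<close> is close to \<open>e\<close>: only the value at
  \<open>p\<close> may change, and not even that on \<open>e\<close>, where \<open>K\<close> and
  \<open>N\<close> agree.\<close>

definition lift :: "'a signvec \<Rightarrow> 'a signvec" where
  "lift X = (if X e = 0 then X else (SOME U. U \<in> cocircuits N \<and> (\<forall>h. h \<noteq> p \<longrightarrow> U h = X h)))"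

text \<open>With the remaining sign at \<open>p\<close>, the covector from \<open>near_face\<close>
  would be properly below \<open>X\<close>.\<close>

lemma cocircuit_cases:
  assumes "X \<in> cocircuits K"
  shows "X e = 0 \<or> X p = \<alpha> * X e \<or> X p = 0"
proof (rule ccontr)
  assume a: "\<not> ?thesis"
  have X: "X \<in> K" using assms by (simp add: cocircuits_def)
  have "X p = - (\<alpha> * X e)" using a \<alpha> signsD[OF K.covector_signs[OF X], of p] signsD[OF K.covector_signs[OF X], of e] by auto
  moreover obtain A where A: "A \<in> K" "A e = 0" "A p = - (\<alpha> * X e)" "off_le p A X" using near_face[OF X] a by auto
  ultimately have "A \<preceq> X" unfolding off_le_def face_le_def by metis
  moreover have "A \<noteq> zero_vec" using A(3) a by auto
  ultimately have "A = X" using assms A(1) by (auto simp: cocircuits_def)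
  then show False using A(2) a by simp
qed

lemma inherited_p: "X \<in> cocircuits K \<Longrightarrow> X p \<noteq> 0 \<Longrightarrow> inherited X"
  using cocircuit_cases by (auto simp: inherited_def)

lemma inherited_neg: "inherited X \<Longrightarrow> inherited (- X)"
  using K.cocircuit_neg by (auto simp: inherited_def)

lemma inherited_scale: "inherited X \<Longrightarrow> \<sigma> = 1 \<or> \<sigma> = -1 \<Longrightarrow> inherited (scale \<sigma> X)"
  using inherited_neg by (auto simp: scale_one scale_minus_one)

lemma close_line:
  assumes "X \<in> cocircuits K" "X p = 0" "X e \<noteq> 0" "A \<in> K" "A p \<noteq> 0" "off_le p A X"
  shows "rank_le K 2 (insert p (supp X))" "A \<in> covs K (insert p (supp X))"
proof -
  show A: "A \<in> covs K (insert p (supp X))" using assms by (auto simp: covs_def supp_def off_le_def)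
  have "insert p (supp X) - {p} = supp X" using assms(2) by (auto simp: supp_def)
  then have "rank_le K 1 (insert p (supp X) - {p})" using K.cocircuit_rank1[OF assms(1)] by simp
  from K.rank_le_SucI[OF this A assms(5)] show "rank_le K 2 (insert p (supp X))" by (simp add: numeral_2_eq_2)
qed

lemma foot_eq:
  assumes "X \<in> cocircuits K" "X p = 0" "X e \<noteq> 0" "A \<in> K" "A e = 0" "A p = - (\<alpha> * X e)" "off_le p A X"
  shows "foot X = A"
proof -
  let ?P = "\<lambda>A. A \<in> K \<and> A e = 0 \<and> A p = - (\<alpha> * X e) \<and> off_le p A X"
  have "?P (SOME A. ?P A)" by (rule someI[of ?P A]) (use assms in blast)
  then have r: "?P (foot X)" using assms(3) by (simp add: foot_def)
  have X: "X \<in> covs K (insert p (supp X))" using assms(1) by (auto simp: covs_def cocircuits_def)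
  have Ap: "A p \<noteq> 0" "foot X p \<noteq> 0" using assms(3,6) r by auto
  show ?thesis
    by (rule K.line_eq[where c = e and d = p, OF close_line(1)[OF assms(1-4) Ap(1) assms(7)] X assms(3)])
      (use close_line(2)[OF assms(1-3) _ _ ] r assms Ap in auto)
qed

lemma foot_close:
  assumes "X \<in> cocircuits K" "X p = 0"
  shows "foot X \<in> cocircuits K" "foot X \<in> K" "foot X e = 0" "foot X p = - (\<alpha> * X e)" "off_le p (foot X) X"
    "foot X \<noteq> zero_vec" "supp (foot X) \<subseteq> insert p (supp X)"
proof -
  have XK: "X \<in> K" "X \<noteq> zero_vec" using assms(1) by (auto simp: cocircuits_def)
  have *: "foot X \<in> cocircuits K \<and> foot X e = 0 \<and> foot X p = - (\<alpha> * X e) \<and> off_le p (foot X) X"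
  proof (cases "X e = 0")
    case True
    then show ?thesis using assms by (simp add: foot_def off_le_def)
  next
    case False
    then obtain A where A: "A \<in> K" "A e = 0" "A p = - (\<alpha> * X e)" "off_le p A X"
      using near_face[OF XK(1)] assms(2) by auto
    have Ap: "A p \<noteq> 0" using A False by auto
    have X: "X \<in> covs K (insert p (supp X))" using XK by (auto simp: covs_def)
    note cl = close_line[OF assms False A(1) Ap A(4)]
    have "A \<noteq> zero_vec" using Ap by auto
    then have "A \<in> cocircuits K" using K.line_cocircuit[OF cl(1) X False cl(2) A(2)] by blast
    then show ?thesis using foot_eq[OF assms False A] A by simp
  qed
  then show "foot X \<in> cocircuits K" "foot X \<in> K" "foot X e = 0" "foot X p = - (\<alpha> * X e)" "off_le p (foot X) X"
    "foot X \<noteq> zero_vec" by (auto simp: cocircuits_def)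
  show "supp (foot X) \<subseteq> insert p (supp X)" using * by (auto simp: supp_def off_le_def)
qed

lemma foot_line:
  assumes "X \<in> cocircuits K" "X p = 0" "X e \<noteq> 0"
  shows "rank_le K 2 (insert p (supp X))" "foot X \<in> covs K (insert p (supp X))" "X \<in> covs K (insert p (supp X))"
  using close_line[OF assms foot_close(2)[OF assms(1,2)] _ foot_close(5)[OF assms(1,2)]]
    foot_close(4)[OF assms(1,2)] assms by (auto simp: covs_def cocircuits_def)

lemma foot_neg: "X \<in> cocircuits K \<Longrightarrow> X p = 0 \<Longrightarrow> foot (- X) = - foot X"
proof (cases "X e = 0")
  case True
  then show ?thesis by (simp add: foot_def)
next
  case False
  assume X: "X \<in> cocircuits K" "X p = 0"
  show ?thesis
    by (rule foot_eq) (use foot_close[OF X] X False K.cocircuit_neg K.covector_neg in \<open>auto simp: off_le_neg\<close>)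
qed

lemma foot_inherited: "X \<in> cocircuits K \<Longrightarrow> X p = 0 \<Longrightarrow> inherited (foot X)"
  using foot_close by (simp add: inherited_def)

lemma covs_same: "e \<notin> S \<Longrightarrow> covs K S = covs N S"
  using same by (auto simp: covs_def supp_def)

lemma rank_le_same: "e \<notin> S \<Longrightarrow> rank_le K n S \<Longrightarrow> rank_le N n S"
  using rank_le_covs_mono covs_same by blast

lemma cocircuit_same:
  assumes "X e = 0" "X \<in> cocircuits K" shows "X \<in> cocircuits N"
proof (rule N.cocircuitI)
  show "X \<in> N" "X \<noteq> zero_vec" using assms same by (auto simp: cocircuits_def)
  fix Y assume Y: "Y \<in> N" "Y \<noteq> zero_vec" "supp Y \<subseteq> supp X"
  then have "Y e = 0" using assms(1) by (auto simp: supp_def)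
  then show "Y = X \<or> Y = - X" using K.cocircuit_minimal[OF assms(2)] Y same by blast
qed

lemma lift_close:
  assumes "inherited X"
  shows "lift X \<in> cocircuits N" "h \<noteq> p \<Longrightarrow> lift X h = X h" "X e = 0 \<Longrightarrow> lift X = X"
proof -
  have X: "X \<in> cocircuits K" "X \<in> K" using assms by (auto simp: inherited_def cocircuits_def)
  have "lift X \<in> cocircuits N \<and> (\<forall>h. h \<noteq> p \<longrightarrow> lift X h = X h)"
  proof (cases "X e = 0")
    case True
    then show ?thesis using cocircuit_same X by (simp add: lift_def)
  next
    case False
    obtain t where t: "X(p := t) \<in> N" using toN X by blast
    have "(X(p := t)) e \<noteq> 0" using False pe by simp
    then obtain U where U: "U \<in> cocircuits N" "U \<preceq> X(p := t)" "U e \<noteq> 0" using N.cocircuit_below[OF t] by blast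
    have Ue: "U e = X e" using U(2,3) pe by (auto simp: face_le_def dest!: spec[of _ e])
    have m: "U(p := \<alpha> * U e) \<in> K" using toK U by (simp add: cocircuits_def)
    have Xp: "X p = \<alpha> * X e" using assms False by (simp add: inherited_def)
    have "U(p := \<alpha> * U e) \<preceq> X" using U(2) Ue Xp by (auto simp: face_le_def split: if_splits)
    moreover have "U(p := \<alpha> * U e) \<noteq> zero_vec" using U(3) pe by (auto simp: fun_eq_iff)
    ultimately have "U(p := \<alpha> * U e) = X" using X(1) m by (auto simp: cocircuits_def)
    then have "\<forall>h. h \<noteq> p \<longrightarrow> U h = X h" by auto
    then have "\<exists>U. U \<in> cocircuits N \<and> (\<forall>h. h \<noteq> p \<longrightarrow> U h = X h)" using U by blast
    from someI_ex[OF this] show ?thesis using False by (simp add: lift_def)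
  qed
  then show "lift X \<in> cocircuits N" "h \<noteq> p \<Longrightarrow> lift X h = X h" by auto
  show "X e = 0 \<Longrightarrow> lift X = X" by (simp add: lift_def)
qed

text \<open>Both ranks are compared after cutting by \<open>e\<close>, where the covectors of
  \<open>K\<close> and \<open>N\<close> coincide. The cut lowers the rank in \<open>K\<close>
  because a covector off \<open>e\<close> can be moved from \<open>N\<close> to \<open>K\<close>,
  which may require \<open>p\<close> in its support.\<close>

lemma line_transfer:
  assumes "rank_le K 2 S" "e \<notin> S \<or> p \<in> S"
  shows "rank_le N 2 S"
proof (cases "\<exists>U \<in> covs N S. U e \<noteq> 0")
  case True
  then obtain U where U: "U \<in> covs N S" "U e \<noteq> 0" by blast
  then have "p \<in> S" using assms(2) covs_out by metis
  then have V: "U(p := \<alpha> * U e) \<in> covs K S" using toK U by (auto simp: covs_def supp_def split: if_splits)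
  have "rank_le K 1 (S - {e})" 
    using rank_le_SucD[of K 1 S, OF _ V, of e] assms(1) U(2) pe by (simp add: numeral_2_eq_2 del: rank_le.simps)
  then have "rank_le N 1 (S - {e})" by (rule rank_le_same[rotated]) simp
  from N.rank_le_SucI[OF this U] show ?thesis by (simp add: numeral_2_eq_2)
next
  case False
  have "rank_le K 2 (S - {e})" using assms(1) by (rule rank_le_mono) auto
  moreover have "covs N S \<subseteq> covs K (S - {e})" using False covs_same[of "S - {e}"] by (auto simp: covs_diff)
  ultimately show ?thesis by (rule rank_le_covs_mono[rotated])
qed

lemma inherited_eq:
  assumes "inherited X" "inherited Y" "\<And>h. h \<noteq> p \<Longrightarrow> X h = Y h"
  shows "X = Y"
proof (cases "X p = Y p")
  case True
  then show ?thesis using assms(3) by (metis ext)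
next
  case False
  have X: "X \<in> cocircuits K" "X \<in> K" "X \<noteq> zero_vec" and Y: "Y \<in> cocircuits K" "Y \<in> K" "Y \<noteq> zero_vec"
    using assms by (auto simp: inherited_def cocircuits_def)
  have e: "X e = Y e" using assms(3) pe by simp
  have neq: "X \<noteq> Y" using False by auto
  have nn: "X \<noteq> - Y"
  proof
    assume a: "X = - Y"
    have z: "X h = 0" if "h \<noteq> p" for h using assms(3)[OF that] a by (metis eq_neg_iff_add_eq_0 neg_equal_zero uminus_apply)
    have "X p \<noteq> 0" using X(3) z by (metis nonzeroE)
    then show False using nocoloop[OF X(2)] z by blast
  qed
  have "supp X \<subseteq> supp Y \<or> supp Y \<subseteq> supp X"
  proof -
    have "X h = 0 \<longleftrightarrow> Y h = 0" if "h \<noteq> p" for h using assms(3)[OF that] by simp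
    then have "supp X - {p} = supp Y - {p}" unfolding supp_def by auto
    then show ?thesis by blast
  qed
  then have "X = Y \<or> X = - Y"
    using K.cocircuit_minimal[OF X(1) Y(2,3)] K.cocircuit_minimal[OF Y(1) X(2,3)] by (metis neg_neg)
  then show ?thesis using neq nn by blast
qed

lemma step_p_or_e:
  assumes "step K g X Z Y" "inherited X" "inherited Y"
  shows "e \<notin> supp X \<union> supp Y \<or> p \<in> supp X \<union> supp Y"
  using assms(2,3) by (auto simp: supp_def inherited_def)

text \<open>Otherwise \<open>foot Z\<close> would be a second point at infinity on the line of the
  step: it stays on that line because \<open>p\<close> lies in
  \<open>supp X \<union> supp Y\<close>, and it vanishes at \<open>g\<close> because
  \<open>g \<noteq> p\<close>.\<close>

lemma step_inherited:
  assumes st: "step K g X Z Y" and "inherited X" "inherited Y" "g \<noteq> p"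
  shows "inherited Z"
proof (rule ccontr)
  assume a: "\<not> inherited Z"
  note s = K.step_covs[OF st]
  have Z: "Z e \<noteq> 0" "Z p = 0" using a s(14) cocircuit_cases[OF s(14)] by (auto simp: inherited_def)
  have "e \<in> supp X \<union> supp Y" using Z(1) covs_out[OF s(3)] by blast
  then have p: "p \<in> supp X \<union> supp Y" using step_p_or_e[OF st assms(2,3)] by blast
  note r = foot_close[OF s(14) Z(2)]
  have "foot Z \<in> covs K (supp X \<union> supp Y)" using r(2,7) s(3) p by (auto simp: covs_def)
  moreover have "foot Z g = 0" using off_leD[OF r(5) assms(4)] s(8) by auto
  ultimately have "foot Z = Z \<or> foot Z = - Z"
    using K.line_unique[OF s(4) s(1) _ _ s(3) _ s(8) r(6) s(11)] s(6) by simp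
  then show False using r(3) Z(1) by auto
qed

lemma step_transfer:
  assumes st: "step K g X Z Y" and t: "inherited X" "inherited Y" and g: "g \<noteq> p"
  shows "step N g (lift X) (lift Z) (lift Y)"
proof -
  let ?S = "supp X \<union> supp Y"
  note s = K.step_covs[OF st]
  have tZ: "inherited Z" using step_inherited[OF st t g] .
  note pX = lift_close[OF t(1)] and pY = lift_close[OF t(2)] and pZ = lift_close[OF tZ]
  have pe': "e \<notin> ?S \<or> p \<in> ?S" using step_p_or_e[OF st t] .
  have r: "rank_le N 2 ?S" using line_transfer[OF s(4) pe'] .
  have cov: "lift U \<in> covs N ?S" if U: "inherited U" "U \<in> covs K ?S" for U
  proof -
    note pU = lift_close[OF U(1)]
    have "lift U h = 0" if "h \<notin> ?S" for h
    proof (cases "h = p")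
      case False
      then show ?thesis using pU(2) covs_out[OF U(2) that] by simp
    next
      case True
      then have "U e = 0" using pe' that covs_out[OF U(2)] by blast
      then show ?thesis using pU(3) covs_out[OF U(2) that] by simp
    qed
    then show ?thesis using cocircuit_in[OF pU(1)] unfolding covs_def supp_def by blast
  qed
  note cX = cov[OF t(1) s(1)] and cY = cov[OF t(2) s(2)] and cZ = cov[OF tZ s(3)]
  have g1: "lift X g = 1" "lift Y g = 1" "lift Z g = 0" using pX(2) pY(2) pZ(2) g s by auto
  have ne: "lift X \<noteq> lift Y"
  proof
    assume "lift X = lift Y"
    then have "X = Y" using inherited_eq[OF t] pX(2) pY(2) by metis
    then show False using s(9) by simp
  qed
  obtain Z' where Z': "Z' \<in> covs N ?S" "Z' g = 0" "Z' \<noteq> zero_vec" "vsum (lift X) Z' (lift Y)"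
    using N.line_diff[OF cX cY _ _ ne, of g] g1 by auto
  have "Z' = lift Z \<or> Z' = - lift Z"
    using N.line_unique[OF r cX _ Z'(1) cZ Z'(2) g1(3) Z'(3) cocircuit_nonzero[OF pZ(1)]] g1(1) by simp
  moreover have "Z' \<noteq> - lift Z"
  proof
    assume a: "Z' = - lift Z"
    have sg: "signs (lift X)" "signs Z'" using cX Z' N.covs_signs by auto
    \<comment> \<open>\<open>c\<close> tests the sign. If it is \<open>p\<close>, where
      \<open>lift\<close> gives no information, the roles of \<open>X\<close> and \<open>Y\<close>
      are exchanged.\<close>
    obtain c where c: "X c = 0" "Y c \<noteq> 0" using K.cocircuit_zero[OF s(12,13,9,10)] by blast
    show False
    proof (cases "c = p")
      case False
      have "Z c = Y c" using vsum_l0[OF s(5) c(1)] by simp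
      moreover have "Z' c = Y c" using vsum_l0[OF Z'(4), of c] pX(2) pY(2) False c(1) by simp
      ultimately show False using a pZ(2)[OF False] c(2) by simp
    next
      case True
      have "Y \<noteq> X" "Y \<noteq> - X" using s(9,10) by (metis neg_neg)+
      then obtain d where d: "Y d = 0" "X d \<noteq> 0" using K.cocircuit_zero[OF s(13,12)] by blast
      have dp: "d \<noteq> p" using d c True by auto
      have "X d = - Z d" using vsum_zero[OF s(15,17,5) d(1)] .
      moreover have "X d = - Z' d" using vsum_zero[OF sg Z'(4), of d] pX(2) pY(2) dp d(1) by simp
      ultimately show False using a pZ(2)[OF dp] d(2) by simp
    qed
  qed
  ultimately have "Z' = lift Z" by blast
  then show ?thesis using N.stepI[OF r cX cY cZ pX(1) pY(1) g1 _ ne] Z'(4) by simp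
qed

lemma step_transfer0:
  assumes st: "step K g X Z Y" and "X e = 0" "Y e = 0"
  shows "step N g X Z Y"
proof -
  note s = K.step_covs[OF st]
  have Ze: "Z e = 0" using vsum_l0[OF s(5), of e] assms by simp
  have "e \<notin> supp X \<union> supp Y" using assms by (auto simp: supp_def)
  then have "rank_le N 2 (supp X \<union> supp Y)" using rank_le_same s(4) by blast
  then show ?thesis using st cocircuit_same assms Ze by (simp add: step_def)
qed

section \<open>Programs with the new element as objective or at infinity\<close>

text \<open>The sign at \<open>p\<close> is constant and cannot be zero, since then the strict
  direction would vanish at \<open>p\<close>. So all vertices are inherited, and directions with
  nonnegative \<open>p\<close> have nonnegative \<open>\<alpha> * e\<close>. A tie for
  \<open>e\<close> in \<open>N\<close> puts the directions on \<open>e\<close>, where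
  \<open>p\<close> has the same values in \<open>K\<close> and \<open>N\<close>.\<close>

lemma acyc_new_objective:
  assumes N: "\<And>g f. acyc N g f" and g: "g \<noteq> p"
  shows "acyc K g p"
  unfolding acyc_def
proof (intro allI impI notI)
  fix X0 Z0 Y0 assume st0: "step K g X0 Z0 Y0" "0 < Z0 p" "(Y0, X0) \<in> (wk K g p 1)\<^sup>*"
  have "(X0, Y0) \<in> wk K g p 1" using st0 by (auto simp: wk_def)
  then obtain R where R: "strongly_connected R" "(X0, Y0) \<in> R" "R \<subseteq> wk K g p 1"
    using strongly_connected_component st0(3) by metis
  have ex: "\<exists>z. step K g x z y \<and> 0 \<le> z p" if "(x, y) \<in> R" for x y
    using R(3) that by (auto simp: wk_def)
  have eq: "x p = y p" if "(x, y) \<in> R" for x y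
  proof (rule strongly_connected_mono[OF R(1) _ that, where q = "\<lambda>x. x p"])
    fix x y assume "(x, y) \<in> R"
    then obtain z where z: "step K g x z y" "0 \<le> z p" using ex by blast
    note s = K.step_covs[OF z(1)]
    show "x p \<le> y p" using vsum_mono(1)[OF s(15,17,16,5) z(2)] .
  qed
  have const: "x p = X0 p" "y p = X0 p" if "(x, y) \<in> R" for x y
    using strongly_connected_const[where q = "\<lambda>x. x p" and R = R, OF R(1) _ R(2) that] eq by blast+
  note s0 = K.step_covs[OF st0(1)]
  have nz: "X0 p \<noteq> 0" using vsum_l0[OF s0(5), of p] const(2)[OF R(2)] st0(2) by auto
  have t: "inherited x" "inherited y" if "(x, y) \<in> R" for x y
  proof -
    obtain z where z: "step K g x z y" using ex[OF \<open>(x, y) \<in> R\<close>] by blast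
    note s = K.step_covs[OF z]
    show "inherited x" "inherited y" using inherited_p s(12,13) const[OF \<open>(x, y) \<in> R\<close>] nz by auto
  qed
  have tz: "step N g (lift x) (lift z) (lift y) \<and> (lift z) e = z e \<and> 0 \<le> \<alpha> * lift z e"
    if "(x, y) \<in> R" "step K g x z y" "0 \<le> z p" for x y z
  proof -
    have tst: "inherited z" using step_inherited[OF that(2) t[OF that(1)] g] .
    have "lift z e = z e" using lift_close(2)[OF tst] pe by simp
    moreover have "0 \<le> \<alpha> * z e" using tst that(3) by (auto simp: inherited_def)
    ultimately show ?thesis using step_transfer[OF that(2) t[OF that(1)] g] by simp
  qed
  have e0: "z e = 0" if h: "(x, y) \<in> R" "step K g x z y" "0 \<le> z p" for x y z
  proof -
    have "lift z e = 0"
    proof (rule N.acyc_tie1[where Z = "lift z" and f = e and \<phi> = lift, OF N R(1) \<alpha> _ h(1)])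
      show "lift x = lift y \<or> (\<exists>Z. step N g (lift x) Z (lift y) \<and> 0 \<le> \<alpha> * Z e)" if "(x, y) \<in> R" for x y
        using ex[OF that] tz[OF that] by blast
    qed (use tz[OF h] in auto)
    then show ?thesis using tz[OF h] by simp
  qed
  have p1: "step N g (lift x) z (lift y)" if h: "(x, y) \<in> R" "step K g x z y" "0 \<le> z p" for x y z
    using tz[OF h] e0[OF h] by (simp add: lift_def)
  have "Z0 p = 0"
  proof (rule N.acyc_tie1[OF N R(1) _ _ R(2), where \<phi> = lift and \<tau> = 1])
    show "lift x = lift y \<or> (\<exists>Z. step N g (lift x) Z (lift y) \<and> 0 \<le> 1 * Z p)" if "(x, y) \<in> R" for x y
      using ex[OF that] p1[OF that] by auto
  qed (use p1[OF R(2) st0(1)] st0(2) in auto)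
  then show False using st0(2) by simp
qed

text \<open>The vertices are inherited, but the directions lie on \<open>p\<close> and need not be.
  If the vertices are off \<open>e\<close>, the close element \<open>e\<close> replaces
  \<open>p\<close> at infinity and each direction is replaced by its foot.\<close>

lemma acyc_new_infinity:
  assumes N: "\<And>g f. acyc N g f" and f: "f \<noteq> p"
  shows "acyc K p f"
  unfolding acyc_def
proof (intro allI impI notI)
  fix X0 Z0 Y0 assume st0: "step K p X0 Z0 Y0" "0 < Z0 f" "(Y0, X0) \<in> (wk K p f 1)\<^sup>*"
  have "(X0, Y0) \<in> wk K p f 1" using st0 by (auto simp: wk_def)
  then obtain R where R: "strongly_connected R" "(X0, Y0) \<in> R" "R \<subseteq> wk K p f 1"
    using strongly_connected_component st0(3) by metis
  have ex: "\<exists>z. step K p x z y \<and> 0 \<le> z f" if "(x, y) \<in> R" for x y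
    using R(3) that by (auto simp: wk_def)
  have eq: "x f = y f" if "(x, y) \<in> R" for x y
  proof (rule strongly_connected_mono[OF R(1) _ that, where q = "\<lambda>x. x f"])
    fix x y assume "(x, y) \<in> R"
    then obtain z where z: "step K p x z y" "0 \<le> z f" using ex by blast
    note s = K.step_covs[OF z(1)]
    show "x f \<le> y f" using vsum_mono(1)[OF s(15,17,16,5) z(2)] .
  qed
  define \<nu> where "\<nu> = X0 f"
  have const: "x f = \<nu>" "y f = \<nu>" if "(x, y) \<in> R" for x y
    unfolding \<nu>_def using strongly_connected_const[where q = "\<lambda>x. x f" and R = R, OF R(1) _ R(2) that] eq by blast+
  note s0 = K.step_covs[OF st0(1)]
  have nz: "\<nu> \<noteq> 0" using vsum_l0[OF s0(5), of f] const[OF R(2)] st0(2) by auto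
  have \<nu>: "\<nu> = 1 \<or> \<nu> = -1" using signsD[OF s0(15), of f] nz by (auto simp: \<nu>_def)
  \<comment> \<open>The foot of such a direction is \<open>- x\<close>. Hence all edges leaving
    \<open>e\<close> change \<open>f\<close> with the same sign, and a component cannot mix vertices
    on and off \<open>e\<close>.\<close>
  have leave: "z f = - \<nu>" if h: "step K p x z y" "x f = \<nu>" "x e = 0" "y e \<noteq> 0" for x y z
  proof -
    note s = K.step_covs[OF h(1)]
    have ze: "z e = y e" using vsum_l0[OF s(5) h(3)] by simp
    note r = foot_close[OF s(14,8)]
    have ty: "\<alpha> * y e = 1" using inherited_p[OF s(13)] s(7) h(4) by (auto simp: inherited_def)
    then have rp: "foot z p = -1" using r(4) ze by simp
    have pS: "p \<in> supp x \<union> supp y" using s(6) by (auto simp: supp_def)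
    have rS: "foot z \<in> covs K (supp x \<union> supp y)" using r(2,7) s(3) pS by (auto simp: covs_def)
    have "foot z = x \<or> foot z = - x"
      using K.line_unique[OF s(4) s(2) h(4) rS s(1) r(3) h(3) r(6) cocircuit_nonzero[OF s(12)]] .
    then have "foot z = - x" using rp s(6) by auto
    then show ?thesis using off_leD[OF r(5) f] h(2) nz by auto
  qed
  have e_eq: "x e = 0 \<longleftrightarrow> y e = 0" if h: "(x, y) \<in> R" for x y
  proof -
    let ?q = "\<lambda>x. if x e = 0 then \<nu> else 0"
    have "?q x = ?q y"
    proof (rule strongly_connected_mono[OF R(1) _ h, where q = ?q])
      fix x y assume xy: "(x, y) \<in> R"
      then obtain z where z: "step K p x z y" "0 \<le> z f" using ex by blast
      show "?q x \<le> ?q y"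
        using leave[OF z(1)] leave[OF K.step_rev[OF z(1)]] const[OF xy] z(2) by auto
    qed
    then show ?thesis using nz by (auto split: if_splits)
  qed
  have e_const: "x e = 0 \<longleftrightarrow> X0 e = 0" "y e = 0 \<longleftrightarrow> X0 e = 0" if "(x, y) \<in> R" for x y
    using strongly_connected_const[where q = "\<lambda>x. x e = 0" and R = R, OF R(1) _ R(2) that] e_eq by blast+
  have "Z0 f = 0"
  proof (cases "X0 e = 0")
    case True
    have stN: "step N p x z y" if "(x, y) \<in> R" "step K p x z y" for x y z
      using step_transfer0[OF that(2)] e_const[OF that(1)] True by simp
    show ?thesis
    proof (rule N.acyc_tie1[OF N R(1) _ _ R(2), where \<phi> = "\<lambda>x. x" and \<tau> = 1])
      show "x = y \<or> (\<exists>Z. step N p x Z y \<and> 0 \<le> 1 * Z f)" if "(x, y) \<in> R" for x y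
        using ex[OF that] stN[OF that] by auto
    qed (use stN[OF R(2) st0(1)] st0(2) in auto)
  next
    case False
    have xe: "x e = \<alpha>" if "x \<in> cocircuits K" "x p = 1" "x e \<noteq> 0" for x
    proof -
      have "\<alpha> * x e = 1" using inherited_p[of x] that by (auto simp: inherited_def)
      then show ?thesis using \<alpha> by auto
    qed
    have edge: "step K e (scale \<alpha> x) (scale \<alpha> (foot z)) (scale \<alpha> y) \<and>
        (foot z f = 0 \<or> foot z f = z f) \<and> (foot z f = 0 \<longrightarrow> z f = - \<nu> * foot z p)"
      if h: "(x, y) \<in> R" "step K p x z y" for x y z
    proof -
      note s = K.step_covs[OF h(2)]
      have e\<alpha>: "x e = \<alpha>" "y e = \<alpha>" using xe s e_const[OF h(1)] False by auto
      note r = foot_close[OF s(14,8)]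
      have pS: "p \<in> supp x \<union> supp y" using s(6) by (auto simp: supp_def)
      have rS: "foot z \<in> covs K (supp x \<union> supp y)" using r(2,7) s(3) pS by (auto simp: covs_def)
      obtain C where C: "C \<in> covs K (supp x \<union> supp y)" "C e = 0" "C \<noteq> zero_vec" "vsum x C y"
        using K.line_diff[OF s(1,2) _ _ s(9), of e] e\<alpha> by auto
      obtain d where d: "x d = 0" "y d \<noteq> 0" using K.cocircuit_zero[OF s(12,13,9,10)] by blast
      have dp: "d \<noteq> p" using d s by auto
      have zd: "z d = C d" "C d \<noteq> 0" using vsum_l0[OF s(5) d(1)] vsum_l0[OF C(4) d(1)] d by auto
      have xe0: "x e \<noteq> 0" using e\<alpha> by simp
      have "foot z = C \<or> foot z = - C"
        using K.line_unique[OF s(4) s(1) xe0 rS C(1) r(3) C(2) r(6) C(3)] .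
      then have rC: "foot z = C" using off_leD[OF r(5) dp] zd by auto
      have "step K e (scale \<alpha> x) (scale \<alpha> (foot z)) (scale \<alpha> y)"
        using K.step_scaleI[OF s(4) s(1,2) C(1) s(12,13) e\<alpha> \<alpha> C(2,4) s(9)] rC by simp
      \<comment> \<open>\<open>foot z\<close> is a common zero of \<open>e\<close> and
        \<open>f\<close> on the line, so the two are proportional there and \<open>z\<close> can be
        compared with \<open>x\<close>.\<close>
      moreover have "z f = - \<nu> * foot z p" if rf: "foot z f = 0"
      proof (cases "z e = 0")
        case True
        then show ?thesis using rf s(8) by (simp add: foot_def)
      next
        case ze: False
        then have "z e = \<alpha> \<or> (- z) e = \<alpha>" using signsD[OF s(17), of e] \<alpha> by auto
        then show ?thesis
        proof
          assume a: "z e = \<alpha>"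
          have "z f = x f" using K.line_prop[OF s(4) rS r(6) r(3) rf s(3) s(1)] a e\<alpha> by simp
          then show ?thesis using r(4) a const[OF h(1)] by simp
        next
          assume a: "(- z) e = \<alpha>"
          then have ze': "z e = - \<alpha>" by simp
          have "(- z) f = x f" using K.line_prop[OF s(4) rS r(6) r(3) rf K.covs_neg[OF s(3)] s(1)] a e\<alpha> by simp
          then show ?thesis using r(4) ze' const[OF h(1)] by simp
        qed
      qed
      ultimately show ?thesis using off_leD[OF r(5) f] by blast
    qed
    have tsc: "inherited (scale \<alpha> x)" "inherited (scale \<alpha> y)" if h: "(x, y) \<in> R" for x y
    proof -
      obtain z where z: "step K p x z y" using ex[OF h] by blast
      note s = K.step_covs[OF z]
      show "inherited (scale \<alpha> x)" "inherited (scale \<alpha> y)"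
        using inherited_scale[OF inherited_p[OF s(12)] \<alpha>] inherited_scale[OF inherited_p[OF s(13)] \<alpha>] s by auto
    qed
    have ep: "e \<noteq> p" using pe by simp
    have edgeN: "step N e (lift (scale \<alpha> x)) (lift (scale \<alpha> (foot z))) (lift (scale \<alpha> y)) \<and>
        lift (scale \<alpha> (foot z)) f = \<alpha> * foot z f"
      if h: "(x, y) \<in> R" "step K p x z y" for x y z
      using step_transfer[OF _ tsc[OF h(1)] ep] edge[OF h] lift_close(2)[OF step_inherited[OF _ tsc[OF h(1)] ep] f] by auto
    have rf0: "foot z f = 0" if h: "(x, y) \<in> R" "step K p x z y" "0 \<le> z f" for x y z
    proof -
      have nonneg: "0 \<le> foot z f" if "(x, y) \<in> R" "step K p x z y" "0 \<le> z f" for x y z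
        using edge[OF that(1,2)] that(3) by auto
      have "lift (scale \<alpha> (foot z)) f = 0"
      proof (rule N.acyc_tie1[where Z = "lift (scale \<alpha> (foot z))" and f = f and \<phi> = "\<lambda>x. lift (scale \<alpha> x)",
            OF N R(1) \<alpha> _ h(1)])
        show "lift (scale \<alpha> x) = lift (scale \<alpha> y) \<or>
            (\<exists>Z. step N e (lift (scale \<alpha> x)) Z (lift (scale \<alpha> y)) \<and> 0 \<le> \<alpha> * Z f)" if "(x, y) \<in> R" for x y
          using ex[OF that] edgeN[OF that] nonneg[OF that] by (metis \<alpha>\<alpha>(2))
      qed (use edgeN[OF h(1,2)] nonneg[OF h] in auto)
      then show ?thesis using edgeN[OF h(1,2)] by simp
    qed
    \<comment> \<open>The signs come from \<open>z f = - \<nu> * foot z p\<close> and from the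
      scaling by \<open>\<alpha>\<close>.\<close>
    have \<tau>: "- \<nu> * \<alpha> = 1 \<or> - \<nu> * \<alpha> = -1" using \<alpha> \<nu> by auto
    have fin: "step K e (scale \<alpha> x) (scale \<alpha> (foot z)) (scale \<alpha> y) \<and> 0 \<le> - \<nu> * \<alpha> * scale \<alpha> (foot z) p \<and>
        z f = - \<nu> * foot z p"
      if h: "(x, y) \<in> R" "step K p x z y" "0 \<le> z f" for x y z
      using edge[OF h(1,2)] rf0[OF h] h(3) by (simp add: mult.assoc)
    have "scale \<alpha> (foot Z0) p = 0"
    proof (rule K.acyc_tie1[where Z = "scale \<alpha> (foot Z0)" and f = p and \<phi> = "scale \<alpha>",
          OF acyc_new_objective[OF N ep] R(1) \<tau> _ R(2)])
      show "scale \<alpha> x = scale \<alpha> y \<or> (\<exists>Z. step K e (scale \<alpha> x) Z (scale \<alpha> y) \<and> 0 \<le> - \<nu> * \<alpha> * Z p)"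
        if "(x, y) \<in> R" for x y
        using ex[OF that] fin[OF that] by blast
    qed (use fin[OF R(2) st0(1)] st0(2) in auto)
    then show ?thesis using fin[OF R(2) st0(1)] st0(2) by simp
  qed
  then show False using st0(2) by simp
qed

end

section \<open>Programs avoiding the new element\<close>

lemma (in oriented_matroid) normalize:
  assumes "U \<in> covs L S" "U g \<noteq> 0" shows "\<exists>V \<in> covs L S. V g = 1 \<and> (V = U \<or> V = - U)"
proof -
  have "U g = 1 \<or> (- U) g = 1" using signsD[OF covs_signs[OF assms(1)], of g] assms(2) by auto
  then show ?thesis using assms(1) covs_neg by blast
qed

locale near_program = near +
  fixes g f :: 'a
  assumes g: "g \<noteq> p" and f: "f \<noteq> p"
begin

definition crossing :: "'a signvec \<Rightarrow> bool" where
  "crossing W \<longleftrightarrow> W \<in> cocircuits K \<and> W p = 0 \<and> W e \<noteq> 0"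

text \<open>Position of \<open>foot W\<close> in the affine chart \<open>g = 1\<close>: it is a finite point (\<open>fin\<close>), or at infinity with
  objective value \<open>\<nu> \<cdot> \<infinity>\<close> (\<open>inf \<nu>\<close>), or at infinity in a direction where the objective is constant (\<open>null\<close>).\<close>

definition fin :: "'a signvec \<Rightarrow> bool" where "fin W \<longleftrightarrow> crossing W \<and> W g = 1 \<and> foot W g = 1"

definition null :: "'a signvec \<Rightarrow> bool" where "null W \<longleftrightarrow> crossing W \<and> W g = 1 \<and> foot W g = 0 \<and> foot W f = 0"

definition inf :: "int \<Rightarrow> 'a signvec \<Rightarrow> bool" where "inf \<nu> W \<longleftrightarrow> crossing W \<and> foot W g = 0 \<and> foot W f = \<nu>"

text \<open>The direction from \<open>foot W\<close> to \<open>W\<close>; its objective value \<open>slope W\<close> breaks the tie between the two.\<close>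

definition escape :: "'a signvec \<Rightarrow> 'a signvec" where
  "escape W = (SOME Z. Z \<in> covs K (insert p (supp W)) \<and> Z g = 0 \<and> Z \<noteq> zero_vec \<and> vsum (foot W) Z W)"

definition slope :: "'a signvec \<Rightarrow> int" where "slope W = (if fin W then escape W f else 0)"

text \<open>For a \<open>null\<close> vertex the objective is constant along the line through
  \<open>W\<close> and its foot, so any inherited vertex of that line can represent
  \<open>W\<close>.\<close>

definition anchor :: "'a signvec \<Rightarrow> 'a signvec" where
  "anchor W = (SOME R. inherited R \<and> R g = 1 \<and> R \<in> covs K (insert p (supp W)))"

text \<open>The vertex of the program of \<open>N\<close> that has the same objective value as \<open>W\<close> up to an infinitesimal.\<close>

definition shadow :: "'a signvec \<Rightarrow> 'a signvec" where
  "shadow W = (if fin W then foot W else if null W then lift (anchor W) else lift W)"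

text \<open>Unlike \<open>wk\<close>, a step must be a tie or change the objective with the exact
  sign \<open>\<zeta>\<close>. Reversing edges then just negates \<open>\<zeta>\<close>, and
  \<open>\<zeta> = 0\<close> allows only ties.\<close>

definition wz :: "int \<Rightarrow> ('a signvec \<times> 'a signvec) set" where
  "wz \<zeta> = {(X, Y). \<exists>Z. step N g X Z Y \<and> (Z f = 0 \<or> Z f = \<zeta>)}"

definition spath :: "int \<Rightarrow> 'a signvec \<Rightarrow> 'a signvec \<Rightarrow> bool" where
  "spath \<zeta> a b \<longleftrightarrow> \<zeta> \<noteq> 0 \<and>
    (\<exists>u v Z. (a, u) \<in> (wz \<zeta>)\<^sup>* \<and> step N g u Z v \<and> Z f = \<zeta> \<and> (v, b) \<in> (wz \<zeta>)\<^sup>*)"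

text \<open>Monotonicity of the infinitesimal part of the objective. By the last clause, an edge
  without strict change of the shadow and without slope at either end is undirected.\<close>

definition slope_compat :: "int \<Rightarrow> int \<Rightarrow> int \<Rightarrow> bool" where
  "slope_compat \<zeta> a b \<longleftrightarrow> (0 \<le> \<zeta> \<longrightarrow> a \<le> b) \<and> (\<zeta> \<le> 0 \<longrightarrow> b \<le> a) \<and> (a = 0 \<and> b = 0 \<longrightarrow> \<zeta> = 0)"

definition compat :: "'a signvec \<Rightarrow> 'a signvec \<Rightarrow> 'a signvec \<Rightarrow> bool" where
  "compat x Z y \<longleftrightarrow> (shadow x, shadow y) \<in> (wz (Z f))\<^sup>* \<and> (spath (Z f) (shadow x) (shadow y) \<or> slope_compat (Z f) (slope x) (slope y))"

lemma wz_converse: "wz (- \<zeta>) = (wz \<zeta>)\<inverse>"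
proof -
  have *: "(Y, X) \<in> wz (- \<zeta>)" if w: "(X, Y) \<in> wz \<zeta>" for X Y \<zeta>
  proof -
    obtain Z where "step N g X Z Y" "Z f = 0 \<or> Z f = \<zeta>" using w by (auto simp: wz_def)
    then show ?thesis unfolding wz_def using N.step_rev by (auto intro!: exI[of _ "- Z"])
  qed
  show ?thesis using *[of _ _ \<zeta>] *[of _ _ "- \<zeta>"] by auto
qed

lemma wz_rev: "(a, b) \<in> (wz \<zeta>)\<^sup>* \<Longrightarrow> (b, a) \<in> (wz (- \<zeta>))\<^sup>*"
  by (simp add: wz_converse rtrancl_converse)

lemma spath_rev: "spath \<zeta> a b \<Longrightarrow> spath (- \<zeta>) b a"
proof -
  assume "spath \<zeta> a b"
  then obtain u v Z where sp: "\<zeta> \<noteq> 0" "(a, u) \<in> (wz \<zeta>)\<^sup>*" "step N g u Z v" "Z f = \<zeta>" "(v, b) \<in> (wz \<zeta>)\<^sup>*"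
    unfolding spath_def by blast
  have "(- Z) f = - \<zeta>" using sp(4) by simp
  then show ?thesis
    unfolding spath_def using wz_rev[OF sp(2)] wz_rev[OF sp(5)] N.step_rev[OF sp(3)] sp(1)
    by (metis neg_equal_0_iff_equal)
qed

lemma compat_rev: "compat x Z y \<Longrightarrow> compat y (- Z) x"
  using wz_rev spath_rev unfolding compat_def slope_compat_def by auto

lemma wz_step: "step N g X Z Y \<Longrightarrow> Z f = 0 \<or> Z f = \<zeta> \<Longrightarrow> (X, Y) \<in> (wz \<zeta>)\<^sup>*"
  by (auto simp: wz_def)

lemma goodI:
  assumes "(shadow x, u) \<in> (wz (Z f))\<^sup>*" "step N g u Z' v" "Z' f = Z f" "(v, shadow y) \<in> (wz (Z f))\<^sup>*"
    "Z f = 0 \<Longrightarrow> slope x = 0 \<and> slope y = 0"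
  shows "compat x Z y"
proof -
  have "(shadow x, shadow y) \<in> (wz (Z f))\<^sup>*"
    using assms(1,4) wz_step[OF assms(2), of "Z f"] assms(3) by (meson rtrancl_trans)
  moreover have "spath (Z f) (shadow x) (shadow y) \<or> slope_compat (Z f) (slope x) (slope y)"
  proof (cases "Z f = 0")
    case True
    then show ?thesis using assms(5) by (simp add: slope_compat_def)
  next
    case False
    then show ?thesis using assms(1-4) by (auto simp: spath_def)
  qed
  ultimately show ?thesis by (simp add: compat_def)
qed

lemma compat_flatI:
  "(shadow x, shadow y) \<in> (wz 0)\<^sup>* \<Longrightarrow> Z f = 0 \<Longrightarrow> slope x = 0 \<Longrightarrow> slope y = 0 \<Longrightarrow> compat x Z y"
  by (simp add: compat_def slope_compat_def)

lemma crossing_close: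
  assumes "crossing W"
  shows "W \<in> cocircuits K" "W p = 0" "W e \<noteq> 0" "W \<in> K" "W \<noteq> zero_vec" "\<not> inherited W" "foot W p \<noteq> 0"
    "foot W \<noteq> W" "foot W \<noteq> - W" "W \<noteq> foot W" "W \<noteq> - foot W"
proof -
  show 1: "W \<in> cocircuits K" "W p = 0" "W e \<noteq> 0" "W \<in> K" "W \<noteq> zero_vec" "\<not> inherited W"
    using assms by (auto simp: crossing_def cocircuits_def inherited_def)
  show "foot W p \<noteq> 0" using foot_close(4)[OF 1(1,2)] 1(3) by simp
  show "foot W \<noteq> W" "foot W \<noteq> - W" "W \<noteq> foot W" "W \<noteq> - foot W" 
    using foot_close(3)[OF 1(1,2)] 1(3) by (metis neg_0_equal_iff_equal uminus_apply)+
qed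

lemma not_inherited: "X \<in> cocircuits K \<Longrightarrow> \<not> inherited X \<Longrightarrow> crossing X"
  using cocircuit_cases by (auto simp: inherited_def crossing_def)

lemma shadow_inherited: "inherited X \<Longrightarrow> shadow X = lift X" "inherited X \<Longrightarrow> slope X = 0"
  using crossing_close(6) by (auto simp: shadow_def slope_def fin_def null_def)

lemma escape_close:
  assumes "fin W"
  shows "escape W \<in> covs K (insert p (supp W))" "escape W g = 0" "escape W \<noteq> zero_vec" "vsum (foot W) (escape W) W"
    "escape W e = W e" "escape W p = \<alpha> * W e" "escape W \<in> cocircuits K" "inherited (escape W)"
proof -
  have t: "crossing W" "W g = 1" "foot W g = 1" using assms by (auto simp: fin_def)
  note w = crossing_close[OF t(1)] and r = foot_close[OF crossing_close(1,2)[OF t(1)]] and l = foot_line[OF crossing_close(1,2,3)[OF t(1)]]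
  have "\<exists>Z. Z \<in> covs K (insert p (supp W)) \<and> Z g = 0 \<and> Z \<noteq> zero_vec \<and> vsum (foot W) Z W"
    using K.line_diff[OF l(2,3) _ _ w(8), of g] t by auto
  from someI_ex[OF this] show z: "escape W \<in> covs K (insert p (supp W))" "escape W g = 0" "escape W \<noteq> zero_vec" "vsum (foot W) (escape W) W"
    unfolding escape_def by auto
  show e: "escape W e = W e" using vsum_l0[OF z(4) r(3)] by simp
  show p: "escape W p = \<alpha> * W e"
    using vsum_zero[OF K.covector_signs[OF r(2)] K.covs_signs[OF z(1)] z(4) w(2)] r(4) by simp
  show c: "escape W \<in> cocircuits K" by (rule K.line_cocircuit[OF l(1) l(3) _ z(1,2,3)]) (use t in simp)
  show "inherited (escape W)" using c e p by (simp add: inherited_def)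
qed

text \<open>\<open>R\<close> is the point of the line on \<open>h\<close>. It is finite because
  \<open>foot W\<close> is the only point at infinity, and off \<open>p\<close> because
  \<open>W\<close> is the only point on \<open>p\<close>; neither lies on \<open>h\<close>.\<close>

lemma foot_line_point:
  assumes l: "rank_le K 2 S" and m: "W \<in> covs K S" "foot W \<in> covs K S" and t: "crossing W" and W: "W g = 1" "foot W g = 0"
    and h: "h \<noteq> p" "foot W h \<noteq> 0"
  obtains R where "inherited R" "R \<in> cocircuits K" "R g = 1" "R h = 0" "R \<in> covs K S"
proof -
  note w = crossing_close[OF t] and r = foot_close[OF crossing_close(1,2)[OF t]]
  have Wh: "W h \<noteq> 0" using off_leD[OF r(5) h(1)] h(2) by auto
  have Wg: "W g \<noteq> 0" using W(1) by simp
  obtain R0 where R0: "R0 \<in> covs K S" "R0 h = 0" "R0 \<noteq> zero_vec"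
    using K.line_point[OF m w(5) r(6) w(10,11)] by blast
  have "R0 g \<noteq> 0"
  proof
    assume "R0 g = 0"
    then have "R0 = foot W \<or> R0 = - foot W" using K.line_unique[OF l m(1) Wg R0(1) m(2) _ W(2) R0(3) r(6)] by blast
    then show False using R0(2) h(2) by auto
  qed
  then obtain R where R: "R \<in> covs K S" "R g = 1" "R = R0 \<or> R = - R0" using K.normalize[OF R0(1)] by blast
  have R': "R h = 0" "R \<noteq> zero_vec" using R R0 by auto
  have c: "R \<in> cocircuits K" using K.line_cocircuit[OF l m(1) Wh R(1) R'] .
  have "R p \<noteq> 0"
  proof
    assume "R p = 0"
    then have "R = W \<or> R = - W" using K.line_unique[OF l m(2) w(7) R(1) m(1) _ w(2) R'(2) w(5)] by blast
    then show False using R'(1) Wh by auto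
  qed
  from that[OF inherited_p[OF c this] c R(2) R'(1) R(1)] show ?thesis .
qed

lemma anchor_close:
  assumes "null W"
  shows "inherited (anchor W)" "anchor W g = 1" "anchor W \<in> covs K (insert p (supp W))"
proof -
  have t: "crossing W" "W g = 1" "foot W g = 0" using assms by (auto simp: null_def)
  note w = crossing_close[OF t(1)] and l = foot_line[OF crossing_close(1,2,3)[OF t(1)]]
  obtain h where h: "h \<noteq> p" "foot W h \<noteq> 0" using nocoloop[OF foot_close(2)[OF w(1,2)] w(7)] by blast
  have "\<exists>R. inherited R \<and> R g = 1 \<and> R \<in> covs K (insert p (supp W))"
    using foot_line_point[OF l(1,3,2) t h] by metis
  from someI_ex[OF this] show "inherited (anchor W)" "anchor W g = 1" "anchor W \<in> covs K (insert p (supp W))"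
    unfolding anchor_def by auto
qed

text \<open>The only direction of the line is \<open>A\<close>, up to sign, and \<open>A\<close>
  does not change \<open>f\<close>.\<close>

lemma null_connection:
  assumes "rank_le K 2 S" "A \<in> covs K S" "A \<noteq> zero_vec" "A g = 0" "A f = 0" "A e = 0"
    "inherited X" "X \<in> covs K S" "X g = 1" "inherited Y" "Y \<in> covs K S" "Y g = 1"
  shows "(lift X, lift Y) \<in> (wz \<zeta>)\<^sup>*"
proof (cases "X = Y")
  case False
  obtain Z where Z: "Z \<in> covs K S" "Z g = 0" "Z \<noteq> zero_vec" "vsum X Z Y"
    using K.line_diff[OF assms(8,11) _ _ False, of g] assms by auto
  have "Z = A \<or> Z = - A" using K.line_unique[OF assms(1,8) _ Z(1) assms(2) Z(2) assms(4) Z(3) assms(3)] assms(9) by simp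
  then have Zf: "Z f = 0" using assms(5) by auto
  have "X \<in> cocircuits K" "Y \<in> cocircuits K" using assms by (auto simp: inherited_def)
  from K.stepI[OF assms(1,8,11) Z(1) this assms(9,12) Z(2,4) False] have st: "step K g X Z Y" .
  have "lift Z f = 0" using lift_close(2)[OF step_inherited[OF st assms(7,10) g] f] Zf by simp
  then show ?thesis using wz_step[OF step_transfer[OF st assms(7,10) g]] by simp
qed simp

text \<open>As \<open>y\<close> is off \<open>p\<close>, the edge runs along the line joining
  \<open>x\<close> to its foot. In the finite case \<open>x\<close> is replaced by its foot with the
  same direction, and if \<open>y\<close> is that foot, the slope accounts for the edge. In the null
  case the objective is constant on the line.\<close>

lemma compat_line:
  assumes st: "step K g x Z y" and t: "crossing x" "fin x \<or> null x" and y: "y p \<noteq> 0"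
  shows "compat x Z y"
proof -
  let ?S = "supp x \<union> supp y"
  note s = K.step_covs[OF st] and w = crossing_close[OF t(1)] and r = foot_close[OF crossing_close(1,2)[OF t(1)]]
  have ty: "inherited y" using inherited_p[OF s(13) y] .
  have sub: "insert p (supp x) \<subseteq> ?S" using y by (auto simp: supp_def)
  have rS: "foot x \<in> covs K ?S" using covs_mono[OF sub foot_line(2)[OF w(1-3)]] .
  have xg: "x g \<noteq> 0" using s(6) by simp
  show ?thesis
  proof (cases "fin x")
    case False
    then have n: "null x" using t by blast
    then have A: "foot x g = 0" "foot x f = 0" by (auto simp: null_def)
    have "Z = foot x \<or> Z = - foot x" using K.line_unique[OF s(4) s(1) xg s(3) rS s(8) A(1) s(11) r(6)] .
    then have Zf: "Z f = 0" using A by auto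
    note R = anchor_close[OF n]
    have "(lift (anchor x), lift y) \<in> (wz 0)\<^sup>*"
      using null_connection[OF s(4) rS r(6) A r(3) R(1) covs_mono[OF sub R(3)] R(2) ty s(2) s(7)] .
    then show ?thesis using Zf False n shadow_inherited[OF ty] by (intro compat_flatI) (auto simp: shadow_def slope_def)
  next
    case True
    then have Ag: "foot x g = 1" by (simp add: fin_def)
    note z = escape_close[OF True]
    have zS: "escape x \<in> covs K ?S" using covs_mono[OF sub z(1)] .
    have px: "shadow x = foot x" "slope x = escape x f" using True by (auto simp: shadow_def slope_def)
    show ?thesis
    proof (cases "y = foot x")
      case yA: True
      have "x e = - Z e" using vsum_zero[OF s(15,17,5)] yA r(3) by simp
      then have "escape x = - Z"
        using K.line_eq[where c = g and d = e, OF s(4) s(1) xg zS K.covs_neg[OF s(3)] z(2)] s(8) z(5) w(3) by simp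
      then have "slope x = - Z f" using px by simp
      moreover have "shadow y = foot x" using shadow_inherited[OF ty] lift_close(3)[OF ty] yA r(3) by simp
      ultimately show ?thesis using px shadow_inherited[OF ty] by (simp add: compat_def slope_compat_def)
    next
      case False
      have Ay: "foot x \<noteq> y" "foot x \<noteq> - y" "y \<noteq> foot x" "y \<noteq> - foot x" using False Ag s(7) by auto
      obtain Z' where Z': "Z' \<in> covs K ?S" "Z' g = 0" "Z' \<noteq> zero_vec" "vsum (foot x) Z' y"
        using K.line_diff[OF rS s(2) _ _ Ay(1), of g] Ag s(7) by auto
      obtain d where d: "y d = 0" "foot x d \<noteq> 0" using K.cocircuit_zero[OF s(13) r(1) Ay(3,4)] by blast
      have dp: "d \<noteq> p" using d y by auto
      have "x d = foot x d" using off_leD[OF r(5) dp] d(2) by auto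
      moreover have "x d = - Z d" using vsum_zero[OF s(15,17,5) d(1)] .
      moreover have "foot x d = - Z' d"
        using vsum_zero[OF K.covector_signs[OF r(2)] K.covs_signs[OF Z'(1)] Z'(4) d(1)] .
      ultimately have "Z' d = Z d" "Z' d \<noteq> 0" using d(2) by auto
      then have "Z' = Z" by (rule K.line_eq[OF s(4) s(1) xg Z'(1) s(3) Z'(2) s(8)])
      then have stA: "step K g (foot x) Z y" using K.stepI[OF s(4) rS s(2) Z'(1) r(1) s(13) Ag s(7) Z'(2,4) Ay(1)] by simp
      have tA: "inherited (foot x)" using foot_inherited w by blast
      have pA: "lift (foot x) = foot x" using lift_close(3)[OF tA r(3)] .
      have stN: "step N g (shadow x) (lift Z) (shadow y)" using step_transfer[OF stA tA ty g] pA px shadow_inherited[OF ty] by simp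
      have "lift Z f = Z f" using lift_close(2)[OF step_inherited[OF stA tA ty g] f] .
      moreover have "slope x = 0" if "Z f = 0"
      proof -
        have "escape x = Z \<or> escape x = - Z" using K.line_unique[OF s(4) s(1) xg zS s(3) z(2) s(8) z(3) s(11)] .
        then show ?thesis using that px by auto
      qed
      ultimately show ?thesis using stN shadow_inherited[OF ty] by (intro goodI[OF _ stN]) auto
    qed
  qed
qed

end

section \<open>Planes\<close>

text \<open>The line through the points \<open>x\<close>, \<open>y\<close> of \<open>p\<close> together with \<open>foot x\<close> spans a plane, which meets
  \<open>e\<close> in a line; \<open>foot\<close> maps points of the former line to the latter.\<close>

locale plane = near_program +
  fixes x Z y :: "'a signvec"
  assumes st: "step K g x Z y" and t1x: "crossing x" and yp: "y p = 0" and ye: "y e \<noteq> 0 \<Longrightarrow> y e = x e"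
begin

abbreviation "S \<equiv> supp x \<union> supp y"
abbreviation "P \<equiv> insert p S"

lemmas s = K.step_covs[OF st]
lemmas w = crossing_close[OF t1x]
lemmas r = foot_close[OF crossing_close(1,2)[OF t1x]]

lemma pS: "p \<notin> S" using w(2) yp by (auto simp: supp_def)
lemma Zp: "Z p = 0" using covs_out[OF s(3) pS] .

lemmas ry = foot_close[OF s(13) yp]
lemmas rZ = foot_close[OF s(14) Zp]

lemma inP: "x \<in> covs K P" "y \<in> covs K P" "Z \<in> covs K P" "foot x \<in> covs K P" "foot y \<in> covs K P" "foot Z \<in> covs K P"
proof -
  show "x \<in> covs K P" "y \<in> covs K P" "Z \<in> covs K P" using s(1-3) covs_mono[of S P] by blast+
  have "supp Z \<subseteq> S" using s(3) by (simp add: covs_def)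
  then show "foot x \<in> covs K P" "foot y \<in> covs K P" "foot Z \<in> covs K P"
    using r(2,7) ry(2,7) rZ(2,7) by (auto simp: covs_def)
qed

text \<open>\<open>P\<close> has rank three: its section by \<open>p\<close> is the line
  \<open>S\<close>, and \<open>foot x\<close> is off \<open>p\<close>.\<close>

lemma line: "U \<in> covs K P \<Longrightarrow> U c \<noteq> 0 \<Longrightarrow> rank_le K 2 (P - {c})"
proof -
  have "P - {p} = S" using pS by auto
  then have "rank_le K 2 (P - {p})" using s(4) by simp
  from K.rank_le_SucI[OF this inP(4) w(7)] show "U \<in> covs K P \<Longrightarrow> U c \<noteq> 0 \<Longrightarrow> rank_le K 2 (P - {c})"
    by (rule rank_le_SucD)
qed

lemma unique:
  assumes "U \<in> covs K P" "U c \<noteq> 0" "T \<in> covs K P" "T c = 0" "T d \<noteq> 0"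
    "V \<in> covs K P" "V c = 0" "V d = 0" "V \<noteq> zero_vec" "V' \<in> covs K P" "V' c = 0" "V' d = 0" "V' \<noteq> zero_vec"
  shows "V = V' \<or> V = - V'"
  by (rule K.line_unique[OF line[OF assms(1,2)], of T d]) (use assms in \<open>auto simp: covs_diff\<close>)

lemma prop_plane:
  assumes "U0 \<in> covs K P" "U0 c \<noteq> 0" "A \<in> covs K P" "A c = 0" "A \<noteq> zero_vec" "A d = 0" "A k = 0"
    "U \<in> covs K P" "U c = 0" "V \<in> covs K P" "V c = 0" "U d = V d" "U d \<noteq> 0"
  shows "U k = V k"
  by (rule K.line_prop[OF line[OF assms(1,2)], of A d]) (use assms in \<open>auto simp: covs_diff\<close>)

lemma in_diff: "U \<in> covs K P \<Longrightarrow> U c = 0 \<Longrightarrow> U \<in> covs K (P - {c})"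
  by (simp add: covs_diff)

lemma xg: "x g \<noteq> 0" using s(6) by simp
lemma Qex: "\<exists>Q \<in> covs K S. Q e = 0 \<and> Q \<noteq> zero_vec"
  using K.line_point[OF s(1,2) cocircuit_nonzero[OF s(12)] cocircuit_nonzero[OF s(13)] s(9,10)] .

text \<open>\<open>c1\<close>, and \<open>c2\<close> below, are the sign tests of the edge: each
  cuts the plane in a line through one end and its foot that misses the other end.\<close>

definition c1 :: 'a where "c1 = (SOME c. x c = 0 \<and> y c \<noteq> 0)"

lemma c1: "x c1 = 0" "y c1 \<noteq> 0" "c1 \<noteq> p" "foot x c1 = 0" "Z c1 = y c1"
proof -
  show 1: "x c1 = 0" "y c1 \<noteq> 0"
    using someI_ex[OF K.cocircuit_zero[OF s(12,13,9,10)]] by (auto simp: c1_def)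
  show 2: "c1 \<noteq> p" using 1 yp by auto
  show "foot x c1 = 0" using off_leD[OF r(5) 2] 1 by auto
  show "Z c1 = y c1" using vsum_l0[OF s(5) 1(1)] by simp
qed

definition c2 :: 'a where "c2 = (SOME c. y c = 0 \<and> x c \<noteq> 0)"

lemma c2: "y c2 = 0" "x c2 \<noteq> 0" "c2 \<noteq> p" "foot y c2 = 0"
proof -
  have "y \<noteq> x" "y \<noteq> - x" using s(9,10) by (metis neg_neg)+
  then show 1: "y c2 = 0" "x c2 \<noteq> 0"
    using someI_ex[OF K.cocircuit_zero[OF s(13,12)]] by (auto simp: c2_def)
  show 2: "c2 \<noteq> p" using 1 w(2) by auto
  show "foot y c2 = 0" using off_leD[OF ry(5) 2] 1 by auto
qed

text \<open>\<open>Q\<close> is the intersection of the lines \<open>p\<close> and \<open>e\<close>.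
  On the line \<open>p\<close>, only \<open>x\<close> lies on \<open>c1\<close>, and
  \<open>x\<close> is off \<open>e\<close>; similarly for \<open>y\<close> and
  \<open>c2\<close>.\<close>

lemma Q: "\<exists>Q \<in> covs K P. Q e = 0 \<and> Q \<noteq> zero_vec \<and> Q p = 0 \<and> Q c1 \<noteq> 0 \<and> (y e \<noteq> 0 \<longrightarrow> Q c2 \<noteq> 0)"
proof -
  obtain Q where Q: "Q \<in> covs K S" "Q e = 0" "Q \<noteq> zero_vec" using Qex by blast
  have "Q c1 \<noteq> 0"
  proof
    assume "Q c1 = 0"
    then have "Q = x \<or> Q = - x" using K.line_unique[OF s(4) s(2) c1(2) Q(1) s(1) _ c1(1) Q(3) w(5)] by blast
    then show False using Q(2) w(3) by auto
  qed
  moreover have "Q c2 \<noteq> 0" if "y e \<noteq> 0"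
  proof
    assume "Q c2 = 0"
    then have "Q = y \<or> Q = - y"
      using K.line_unique[OF s(4) s(1) c2(2) Q(1) s(2) _ c2(1) Q(3) cocircuit_nonzero[OF s(13)]] by blast
    then show False using Q(2) that by auto
  qed
  ultimately show ?thesis using Q covs_out[OF Q(1) pS] covs_mono[of S P Q] by blast
qed

lemma on_e_c1:
  assumes "U \<in> covs K P" "U e = 0" "U c1 = 0" "U \<noteq> zero_vec" shows "U = foot x \<or> U = - foot x"
proof -
  obtain Q where "Q \<in> covs K P" "Q e = 0" "Q c1 \<noteq> 0" using Q by blast
  from unique[OF inP(1) w(3) this assms inP(4) r(3) c1(4) r(6)] show ?thesis .
qed

text \<open>Comparing values at \<open>p\<close> would give \<open>y e = - x e\<close>, which
  \<open>ye\<close>, the trace of conformality, excludes.\<close>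

lemma foot_opposite: "foot y \<noteq> - foot x"
proof
  assume a: "foot y = - foot x"
  then have "foot y p = - foot x p" by simp
  then have "\<alpha> * y e = \<alpha> * (- x e)" using ry(4) r(4) by simp
  then have "y e = - x e" by (metis \<alpha>\<alpha>(2))
  then show False using ye w(3) by auto
qed

lemma foot_y_c1: "foot y \<noteq> foot x \<Longrightarrow> foot y c1 = y c1"
  using on_e_c1[OF inP(5) ry(3)] ry(6) foot_opposite off_leD[OF ry(5) c1(3)] by auto

lemma foot_x_c2: "y e \<noteq> 0 \<Longrightarrow> foot y \<noteq> foot x \<Longrightarrow> foot x c2 \<noteq> 0"
proof
  assume y: "y e \<noteq> 0" "foot y \<noteq> foot x" and a: "foot x c2 = 0"
  obtain Q where Q: "Q \<in> covs K P" "Q e = 0" "Q c2 \<noteq> 0" using Q y by auto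
  from unique[OF inP(1) w(3) Q inP(5) ry(3) c2(4) ry(6) inP(4) r(3) a r(6)] show False using y foot_opposite by blast
qed

section \<open>Feet and escape directions of the ends of an edge\<close>

lemma foot_Z_g: "foot Z g = 0" using off_leD[OF rZ(5) g] s(8) by auto
lemma foot_Z_f: "foot Z f = 0 \<or> foot Z f = Z f" using off_leD[OF rZ(5) f] .

text \<open>All three feet lie on the line \<open>e\<close> of the plane, so the difference of the
  first two is \<open>foot Z\<close> up to sign; \<open>c1\<close> decides the sign.\<close>

lemma foot_sum:
  assumes "foot x g = 1" "foot y g = 1" "foot x \<noteq> foot y"
  shows "step K g (foot x) (foot Z) (foot y)" "step N g (foot x) (foot Z) (foot y)"
proof -
  have l: "rank_le K 2 (P - {e})" using line[OF inP(1) w(3)] .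
  note m = in_diff[OF inP(4) r(3)] in_diff[OF inP(5) ry(3)] in_diff[OF inP(6) rZ(3)]
  obtain C where C: "C \<in> covs K (P - {e})" "C g = 0" "C \<noteq> zero_vec" "vsum (foot x) C (foot y)"
    using K.line_diff[OF m(1,2) _ _ assms(3), of g] assms by auto
  have Ag: "foot x g \<noteq> 0" using assms by simp
  have "foot Z = C \<or> foot Z = - C" using K.line_unique[OF l m(1) Ag m(3) C(1) foot_Z_g C(2) rZ(6) C(3)] .
  moreover have "C c1 = y c1" using vsum_l0[OF C(4) c1(4)] foot_y_c1 assms(3) by simp
  ultimately have "foot Z = C" using off_leD[OF rZ(5) c1(3)] c1(2,5) by auto
  then show st: "step K g (foot x) (foot Z) (foot y)"
    using K.stepI[OF l m r(1) ry(1) assms(1,2) foot_Z_g] C(4) assms(3) by simp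
  show "step N g (foot x) (foot Z) (foot y)" using step_transfer0[OF st r(3) ry(3)] .
qed

lemma escape_P: "fin x \<Longrightarrow> escape x \<in> covs K P" "fin y \<Longrightarrow> escape y \<in> covs K P"
  using escape_close(1) covs_mono[of "insert p (supp x)" P] covs_mono[of "insert p (supp y)" P] by blast+

text \<open>On the line at infinity of the plane, \<open>foot Z\<close> is a common zero of
  \<open>e\<close> and \<open>f\<close>, which are therefore proportional there. The formula
  compares the points \<open>escape x\<close> and \<open>Z\<close> of this line.\<close>

lemma obj_formula:
  assumes "fin x" "foot Z f = 0"
  shows "Z f = slope x * x e * Z e"
proof (cases "Z e = 0")
  case True
  then show ?thesis using assms(2) by (simp add: foot_def)
next
  case False
  note z = escape_close[OF assms(1)]
  have k: "escape x f = V f" if "V \<in> covs K P" "V g = 0" "V e = x e" for V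
    by (rule prop_plane[OF inP(1) xg inP(6) foot_Z_g rZ(6) rZ(3) assms(2) escape_P(1)[OF assms(1)] z(2) that(1,2)])
      (use that z(5) w(3) in auto)
  have "Z e = x e \<or> (- Z) e = x e" using False w(3) signsD[OF s(17), of e] signsD[OF s(15), of e] by auto
  then show ?thesis
  proof
    assume a: "Z e = x e"
    then have "slope x = Z f" using k[OF inP(3) s(8)] assms(1) by (simp add: slope_def)
    moreover have "x e * x e = 1" using w(3) signsD[OF s(15), of e] by auto
    ultimately show ?thesis using a by (simp add: mult.assoc)
  next
    assume a: "(- Z) e = x e"
    then have "slope x = - Z f" using k[OF K.covs_neg[OF inP(3)]] s(8) assms(1) by (simp add: slope_def)
    moreover have "x e * x e = 1" using w(3) signsD[OF s(15), of e] by auto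
    moreover have "Z e = - x e" using a by simp
    ultimately show ?thesis by (simp add: mult.assoc)
  qed
qed

text \<open>Both escape directions lie at infinity and agree at \<open>e\<close>, so their
  difference is the point at infinity on \<open>e\<close>, which is \<open>foot Z\<close> up to
  sign. Only with equal feet can \<open>c1\<close> test the sign.\<close>

lemma escape_sum:
  assumes "fin x" "fin y"
  shows "foot x = foot y \<Longrightarrow> escape x \<noteq> escape y \<and> vsum (escape x) (foot Z) (escape y)"
    and "escape x \<noteq> escape y \<Longrightarrow> vsum (escape x) (foot Z) (escape y) \<or> vsum (escape x) (- foot Z) (escape y)"
proof -
  note zx = escape_close[OF assms(1)] and zy = escape_close[OF assms(2)]
  have yx: "y e = x e" using assms(2) ye by (auto simp: fin_def crossing_def)
  have l: "rank_le K 2 (P - {g})" using line[OF inP(1) xg] .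
  note m = in_diff[OF escape_P(1)[OF assms(1)] zx(2)] in_diff[OF escape_P(2)[OF assms(2)] zy(2)] in_diff[OF inP(6) foot_Z_g]
  have ze: "escape x e \<noteq> 0" "escape x e = escape y e" using zx(5) zy(5) yx w(3) by auto
  have ex: "\<exists>C. vsum (escape x) C (escape y) \<and> (foot Z = C \<or> foot Z = - C)" if ne: "escape x \<noteq> escape y"
  proof -
    obtain C where C: "C \<in> covs K (P - {g})" "C e = 0" "C \<noteq> zero_vec" "vsum (escape x) C (escape y)"
      using K.line_diff[OF m(1,2) ze(2,1) ne] by blast
    then show ?thesis using K.line_unique[OF l m(1) ze(1) m(3) C(1) rZ(3) C(2) rZ(6) C(3)] by blast
  qed
  show "escape x \<noteq> escape y \<Longrightarrow> vsum (escape x) (foot Z) (escape y) \<or> vsum (escape x) (- foot Z) (escape y)" using ex neg_neg by metis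
  assume A: "foot x = foot y"
  have z1: "escape x c1 = 0" using vsum_l0[OF zx(4) c1(4)] c1(1) by simp
  have z2: "escape y c1 = y c1" using vsum_l0[OF zy(4), of c1] A c1(4) by simp
  then have ne: "escape x \<noteq> escape y" using z1 c1(2) by auto
  then obtain C where C: "vsum (escape x) C (escape y)" "foot Z = C \<or> foot Z = - C" using ex by blast
  have "C c1 = y c1" using vsum_l0[OF C(1) z1] z2 by simp
  then have "foot Z = C" using C(2) off_leD[OF rZ(5) c1(3)] c1(2,5) by auto
  then show "escape x \<noteq> escape y \<and> vsum (escape x) (foot Z) (escape y)" using C ne by simp
qed

lemma f_vanishes:
  assumes "U \<in> covs K P" "U g = 0" "U f = 0" "U \<noteq> zero_vec" "V \<in> covs K P" "V g = 0" "V f = 0" "V \<noteq> zero_vec"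
    "U \<noteq> V" "U \<noteq> - V" "T \<in> covs K P" "T g = 0"
  shows "T f = 0"
  using unique[OF inP(1) xg assms(11,12) _ assms(1,2,3,4) assms(5-8)] assms(9,10) by blast

lemma compat_fin_zero:
  assumes "fin x" "y e = 0"
  shows "compat x Z y"
proof -
  have ty: "inherited y" using assms(2) s(13) by (simp add: inherited_def)
  have B: "foot y = y" using assms(2) by (simp add: foot_def)
  have py: "shadow y = y" "slope y = 0" using shadow_inherited[OF ty] lift_close(3)[OF ty assms(2)] by auto
  have px: "shadow x = foot x" using assms(1) by (simp add: shadow_def)
  have ne: "foot x \<noteq> foot y" using w(7) yp B by auto
  have stN: "step N g (foot x) (foot Z) y" using foot_sum(2)[OF _ _ ne] assms(1) B s(7) by (simp add: fin_def)
  have path: "(shadow x, shadow y) \<in> (wz (Z f))\<^sup>*" using wz_step[OF stN foot_Z_f] px py by simp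
  show ?thesis
  proof (cases "foot Z f = 0")
    case False
    then have "spath (Z f) (shadow x) (shadow y)" using foot_Z_f stN px py unfolding spath_def by auto
    then show ?thesis using path by (simp add: compat_def)
  next
    case True
    have "x e = - Z e" using vsum_zero[OF s(15,17,5) assms(2)] .
    moreover have "x e * x e = 1" using w(3) signsD[OF s(15), of e] by auto
    ultimately have "Z f = - slope x" using obj_formula[OF assms(1) True] by (simp add: mult.assoc)
    then show ?thesis using path py by (simp add: compat_def slope_compat_def)
  qed
qed

text \<open>With equal feet the slopes change in direction \<open>foot Z\<close>. With different
  feet the shadow moves in this direction; if that is a tie, \<open>e\<close> and \<open>f\<close>
  are proportional at infinity, the slopes agree and determine \<open>Z f\<close>.\<close>

lemma compat_fin_fin:
  assumes "fin x" "fin y"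
  shows "compat x Z y"
proof -
  have yx: "y e = x e" using assms(2) ye by (auto simp: fin_def crossing_def)
  have px: "shadow x = foot x" "shadow y = foot y" "slope x = escape x f" "slope y = escape y f" using assms by (auto simp: shadow_def slope_def)
  note zx = escape_close[OF assms(1)] and zy = escape_close[OF assms(2)]
  note zP = escape_P(1)[OF assms(1)] escape_P(2)[OF assms(2)]
  show ?thesis
  proof (cases "foot x = foot y")
    case True
    note v = escape_sum(1)[OF assms True]
    have sg: "signs (escape x)" "signs (foot Z)" "signs (escape y)" using zP rZ(2) K.covs_signs K.covector_signs by auto
    have ne: "escape x \<noteq> escape y" "escape x \<noteq> - escape y" using v zx(5) zy(5) yx w(3) by auto
    have "Z f = 0" if "escape x f = 0" "escape y f = 0"
      using f_vanishes[OF zP(1) zx(2) that(1) zx(3) zP(2) zy(2) that(2) zy(3) ne inP(3) s(8)] .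
    moreover have "0 \<le> Z f \<Longrightarrow> escape x f \<le> escape y f" "Z f \<le> 0 \<Longrightarrow> escape y f \<le> escape x f"
      using vsum_mono[OF sg conjunct2[OF v], of f] foot_Z_f by auto
    ultimately show ?thesis using px True by (simp add: compat_def slope_compat_def)
  next
    case False
    have stN: "step N g (foot x) (foot Z) (foot y)" using foot_sum(2)[OF _ _ False] assms by (simp add: fin_def)
    have path: "(shadow x, shadow y) \<in> (wz (Z f))\<^sup>*" using wz_step[OF stN foot_Z_f] px by simp
    show ?thesis
    proof (cases "foot Z f = 0")
      case f0: False
      then have "spath (Z f) (shadow x) (shadow y)" using foot_Z_f stN px unfolding spath_def by auto
      then show ?thesis using path by (simp add: compat_def)
    next
      case True
      have "escape x f = escape y f"
        by (rule prop_plane[OF inP(1) xg inP(6) foot_Z_g rZ(6) rZ(3) True zP(1) zx(2) zP(2) zy(2)])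
          (use zx(5) zy(5) yx w(3) in auto)
      moreover have "Z f = 0" if "escape x f = 0" using obj_formula[OF assms(1) True] that px(3) by simp
      ultimately show ?thesis using path px by (simp add: compat_def slope_compat_def)
    qed
  qed
qed

text \<open>Along lines through \<open>foot x\<close> the objective is constant. The change from one
  such line to another happens on a line \<open>h\<close> avoiding \<open>foot x\<close>, from its
  point \<open>R\<close> on the line of \<open>x\<close> to its point \<open>Y\<close> on the line
  of \<open>X\<close>. This direction and \<open>Z\<close> agree at \<open>c1\<close>, hence differ
  only by \<open>foot x\<close>, which does not affect \<open>f\<close>. The assumption
  \<open>H\<close> makes \<open>Y\<close> inherited.\<close>

lemma null_path:
  assumes n: "null x" and X: "inherited X" "X \<in> covs K P" "X g = 1" "X c1 = y c1"
    and d: "d \<noteq> p" "X d = 0" "foot x d = 0" "D \<in> covs K P" "D d \<noteq> 0"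
    and H: "\<And>U h. U \<in> cocircuits K \<Longrightarrow> U \<in> covs K P \<Longrightarrow> U d = 0 \<Longrightarrow> \<not> inherited U \<Longrightarrow> h \<noteq> p \<Longrightarrow>
      foot x h \<noteq> 0 \<Longrightarrow> U h \<noteq> 0"
  shows "\<exists>u v Z'. (lift (anchor x), u) \<in> (wz (Z f))\<^sup>* \<and> step N g u Z' v \<and> Z' f = Z f \<and> (v, lift X) \<in> (wz (Z f))\<^sup>*"
proof -
  have A: "foot x g = 0" "foot x f = 0" using n by (auto simp: null_def)
  obtain h where h: "h \<noteq> p" "foot x h \<noteq> 0" using nocoloop[OF r(2) w(7)] by blast
  have l1: "rank_le K 2 (P - {c1})" using line[OF inP(2) c1(2)] .
  note m1 = in_diff[OF inP(1) c1(1)] in_diff[OF inP(4) c1(4)]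
  obtain R where tR: "inherited R" and Rc: "R \<in> cocircuits K" and R: "R g = 1" "R h = 0" "R \<in> covs K (P - {c1})"
    using foot_line_point[OF l1 m1 t1x s(6) A(1) h] .
  have l2: "rank_le K 2 (P - {d})" using line[OF d(4,5)] .
  note m2 = in_diff[OF X(2) d(2)] in_diff[OF inP(4) d(3)]
  have Xg: "X g \<noteq> 0" using X(3) by simp
  have Xnz: "X \<noteq> zero_vec" using X(3) by auto
  have XA: "X \<noteq> foot x" "X \<noteq> - foot x" using X(3) A(1) by auto
  obtain Y0 where Y0: "Y0 \<in> covs K (P - {d})" "Y0 h = 0" "Y0 \<noteq> zero_vec"
    using K.line_point[OF m2 Xnz r(6) XA] by blast
  have "Y0 g \<noteq> 0"
  proof
    assume "Y0 g = 0"
    then have "Y0 = foot x \<or> Y0 = - foot x"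
      using K.line_unique[OF l2 m2(1) Xg Y0(1) m2(2) _ A(1) Y0(3) r(6)] by blast
    then show False using Y0(2) h(2) by auto
  qed
  then obtain Y where Y: "Y \<in> covs K (P - {d})" "Y g = 1" "Y = Y0 \<or> Y = - Y0" using K.normalize[OF Y0(1)] by blast
  have Y': "Y h = 0" "Y \<noteq> zero_vec" using Y Y0 by auto
  have Yc: "Y \<in> cocircuits K" using K.line_cocircuit[OF l2 m2(2) h(2) Y(1) Y'] .
  have YP: "Y \<in> covs K P" "Y d = 0" using Y(1) by (auto simp: covs_diff)
  have tY: "inherited Y" using H[OF Yc YP _ h] Y'(1) by blast
  have "Y c1 = X c1" by (rule K.line_prop[OF l2 m2(2) r(6) A(1) c1(4) Y(1) m2(1)]) (use Y(2) X(3) in auto)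
  then have Yc1: "Y c1 = y c1" using X(4) by simp
  have RP: "R \<in> covs K P" "R c1 = 0" using R(3) by (auto simp: covs_diff)
  have RY: "R \<noteq> Y" using RP(2) Yc1 c1(2) by auto
  have l3: "rank_le K 2 (P - {h})" using line[OF inP(4) h(2)] .
  note m3 = in_diff[OF RP(1) R(2)] in_diff[OF YP(1) Y'(1)]
  obtain Z3 where Z3: "Z3 \<in> covs K (P - {h})" "Z3 g = 0" "Z3 \<noteq> zero_vec" "vsum R Z3 Y"
    using K.line_diff[OF m3 _ _ RY, of g] R(1) Y(2) by auto
  have st3: "step K g R Z3 Y" using K.stepI[OF l3 m3 Z3(1) Rc Yc R(1) Y(2) Z3(2,4) RY] .
  have Z3P: "Z3 \<in> covs K P" using Z3(1) by (simp add: covs_diff)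
  have "Z3 c1 = y c1" using vsum_l0[OF Z3(4) RP(2)] Yc1 by simp
  then have "Z3 f = Z f"
    using prop_plane[OF inP(1) xg inP(4) A(1) r(6) c1(4) A(2) Z3P Z3(2) inP(3) s(8)] c1(2,5) by simp
  then have "lift Z3 f = Z f" using lift_close(2)[OF step_inherited[OF st3 tR tY g] f] by simp
  moreover have "step N g (lift R) (lift Z3) (lift Y)" using step_transfer[OF st3 tR tY g] .
  moreover have "(lift (anchor x), lift R) \<in> (wz (Z f))\<^sup>*"
  proof -
    note rx = anchor_close[OF n]
    have "insert p (supp x) \<subseteq> P - {c1}" using c1(1,3) by (auto simp: supp_def)
    then have "anchor x \<in> covs K (P - {c1})" using rx(3) covs_mono by blast
    then show ?thesis using null_connection[OF l1 m1(2) r(6) A r(3) rx(1) _ rx(2) tR R(3,1)] by blast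
  qed
  moreover have "(lift Y, lift X) \<in> (wz (Z f))\<^sup>*"
    using null_connection[OF l2 m2(2) r(6) A r(3) tY Y(1,2) X(1) m2(1) X(3)] .
  ultimately show ?thesis by blast
qed

lemma compat_null_zero:
  assumes n: "null x" and y0: "y e = 0"
  shows "compat x Z y"
proof -
  have ty: "inherited y" using y0 s(13) by (simp add: inherited_def)
  have "\<exists>u v Z'. (lift (anchor x), u) \<in> (wz (Z f))\<^sup>* \<and> step N g u Z' v \<and> Z' f = Z f \<and> (v, lift y) \<in> (wz (Z f))\<^sup>*"
  proof (rule null_path[OF n ty inP(2) s(7) refl _ y0 r(3) inP(1) w(3)])
    show "e \<noteq> p" using pe by simp
    show "U h \<noteq> 0" if "U \<in> cocircuits K" "U e = 0" "\<not> inherited U" for U h using that by (simp add: inherited_def)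
  qed
  moreover have "shadow x = lift (anchor x)" "slope x = 0" using n by (auto simp: shadow_def slope_def fin_def null_def)
  ultimately show ?thesis using shadow_inherited[OF ty] by (auto intro: goodI)
qed

lemma compat_null_fin:
  assumes n: "null x" and fy: "fin y"
  shows "compat x Z y"
proof -
  have A: "foot x g = 0" "foot x f = 0" using n by (auto simp: null_def)
  have ty: "inherited (foot y)" using foot_inherited[OF s(13) yp] .
  have B: "foot y g = 1" using fy by (simp add: fin_def)
  then have ne: "foot y \<noteq> foot x" using A by auto
  have "\<exists>u v Z'. (lift (anchor x), u) \<in> (wz (Z f))\<^sup>* \<and> step N g u Z' v \<and> Z' f = Z f \<and> (v, lift (foot y)) \<in> (wz (Z f))\<^sup>*"
  proof (rule null_path[OF n ty inP(5) B foot_y_c1[OF ne] _ ry(3) r(3) inP(1) w(3)])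
    show "e \<noteq> p" using pe by simp
    show "U h \<noteq> 0" if "U \<in> cocircuits K" "U e = 0" "\<not> inherited U" for U h using that by (simp add: inherited_def)
  qed
  moreover have "shadow x = lift (anchor x)" "slope x = 0" using n by (auto simp: shadow_def slope_def fin_def null_def)
  moreover have "shadow y = lift (foot y)" using fy lift_close(3)[OF ty ry(3)] by (simp add: shadow_def)
  moreover have "slope y = 0" if "Z f = 0"
  proof -
    note zy = escape_close[OF fy]
    have "foot x \<noteq> Z" "foot x \<noteq> - Z" using w(7) Zp by auto
    then have "escape y f = 0"
      using f_vanishes[OF inP(4) A r(6) inP(3) s(8) that s(11) _ _ escape_P(2)[OF fy] zy(2)] by blast
    then show ?thesis by (simp add: slope_def)
  qed
  ultimately show ?thesis by (auto intro: goodI)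
qed

lemma compat_null_null:
  assumes n: "null x" and ny: "null y"
  shows "compat x Z y"
proof -
  have A: "foot x g = 0" "foot x f = 0" using n by (auto simp: null_def)
  have B: "foot y g = 0" "foot y f = 0" and t1y: "crossing y" using ny by (auto simp: null_def)
  note wy = crossing_close[OF t1y]
  have yx: "y e = x e" using ye wy(3) by blast
  note R1 = anchor_close[OF n] and R2 = anchor_close[OF ny]
  have ph: "shadow x = lift (anchor x)" "slope x = 0" "shadow y = lift (anchor y)" "slope y = 0"
    using n ny by (auto simp: shadow_def slope_def fin_def null_def)
  have sub1: "insert p (supp x) \<subseteq> P - {c1}" using c1(1,3) by (auto simp: supp_def)
  have sub2: "insert p (supp y) \<subseteq> P - {c2}" using c2(1,3) by (auto simp: supp_def)
  have rr1: "anchor x \<in> covs K (P - {c1})" using R1(3) covs_mono sub1 by blast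
  have rr2: "anchor y \<in> covs K (P - {c2})" using R2(3) covs_mono sub2 by blast
  have l1: "rank_le K 2 (P - {c1})" using line[OF inP(2) c1(2)] .
  have l2: "rank_le K 2 (P - {c2})" using line[OF inP(1) c2(2)] .
  note m1 = in_diff[OF inP(1) c1(1)] in_diff[OF inP(4) c1(4)]
  note m2 = in_diff[OF inP(2) c2(1)] in_diff[OF inP(5) c2(4)]
  have ynz: "y \<noteq> zero_vec" and yg: "y g \<noteq> 0" using s(7) by auto
  show ?thesis
  proof (cases "foot x = foot y")
    case eq: True
    have ly: "rank_le K 2 (insert p (supp y))" "foot y \<in> covs K (insert p (supp y))" "y \<in> covs K (insert p (supp y))"
      using foot_line[OF wy(1-3)] .
    have Bc1: "foot y c1 = 0" using eq c1(4) by simp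
    have "anchor y c1 = y c1"
      by (rule K.line_prop[OF ly(1,2) ry(6) B(1) Bc1 R2(3) ly(3)]) (use R2(2) s(7) in auto)
    moreover have "anchor y \<in> covs K P" "anchor y c2 = 0" using rr2 by (auto simp: covs_diff)
    moreover have "foot x c2 = 0" using eq c2(4) by simp
    ultimately have "\<exists>u v Z'. (lift (anchor x), u) \<in> (wz (Z f))\<^sup>* \<and> step N g u Z' v \<and> Z' f = Z f \<and> (v, lift (anchor y)) \<in> (wz (Z f))\<^sup>*"
    proof (intro null_path[OF n R2(1) _ R2(2) _ c2(3) _ _ inP(1) c2(2)])
      fix U h assume U: "U \<in> cocircuits K" "U \<in> covs K P" "U c2 = 0" "\<not> inherited U" and h: "h \<noteq> p" "foot x h \<noteq> 0"
      have Up: "U p = 0" using inherited_p[OF U(1)] U(4) by blast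
      have "U = y \<or> U = - y"
        using unique[OF inP(1) c2(2) inP(5) c2(4) wy(7) U(2,3) Up cocircuit_nonzero[OF U(1)] inP(2) c2(1) yp ynz] .
      moreover have "y h \<noteq> 0" using off_leD[OF ry(5) h(1)] h(2) eq by auto
      ultimately show "U h \<noteq> 0" by auto
    qed
    then show ?thesis using ph by (auto intro: goodI)
  next
    case ne: False
    \<comment> \<open>Two different feet at infinity force \<open>e\<close> and then
      \<open>f\<close> to vanish at \<open>Z\<close>, so the edge is a tie. \<open>R\<close> is the
      meeting point of the two lines of constant objective.\<close>
    have nn: "foot x \<noteq> - foot y" using foot_opposite by (metis neg_neg)
    have Ze: "Z e = 0"
    proof (rule ccontr)
      assume "Z e \<noteq> 0"
      from unique[OF inP(1) xg inP(3) s(8) this inP(4) A(1) r(3) r(6) inP(5) B(1) ry(3) ry(6)] ne nn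
      show False by blast
    qed
    have Zf: "Z f = 0"
    proof (rule ccontr)
      assume "Z f \<noteq> 0"
      from unique[OF inP(1) w(3) inP(3) Ze this inP(4) r(3) A(2) r(6) inP(5) ry(3) B(2) ry(6)] ne nn
      show False by blast
    qed
    have Ac2: "foot x c2 \<noteq> 0" using foot_x_c2[OF wy(3)] ne by auto
    obtain R where tR: "inherited R" and R: "R g = 1" "R c2 = 0" "R \<in> covs K (P - {c1})"
      using foot_line_point[OF l1 m1 t1x s(6) A(1) c2(3) Ac2] by metis
    have R2c: "R \<in> covs K (P - {c2})" using R by (auto simp: covs_diff)
    have "(lift (anchor x), lift R) \<in> (wz 0)\<^sup>*"
      using null_connection[OF l1 m1(2) r(6) A r(3) R1(1) rr1 R1(2) tR R(3,1)] .
    moreover have "(lift R, lift (anchor y)) \<in> (wz 0)\<^sup>*"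
      using null_connection[OF l2 m2(2) ry(6) B ry(3) tR R2c R(1) R2(1) rr2 R2(2)] .
    ultimately show ?thesis using ph Zf by (intro compat_flatI) auto
  qed
qed

text \<open>If the line \<open>e\<close> has a finite point, its point at infinity is
  \<open>foot x\<close> up to sign; the condition on \<open>Z f\<close> gives
  \<open>foot Z = foot x\<close>, and then \<open>y\<close> has the same foot. Otherwise
  \<open>e\<close> is the line at infinity, and different feet satisfy foot y = foot x + Z, which
  preserves the sign of \<open>f\<close>.\<close>

lemma inf_plane:
  assumes i: "inf \<nu> x" and \<nu>: "\<nu> = 1 \<or> \<nu> = -1" and Zf: "0 \<le> \<nu> * Z f"
  shows "inf \<nu> y"
proof -
  have A: "foot x g = 0" "foot x f = \<nu>" using i by (auto simp: inf_def)
  have yprop: "y \<in> cocircuits K" "y p = 0" using s(13) yp by auto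
  have same_foot: "inf \<nu> y" if "y e \<noteq> 0" "foot y = foot x" using that A yprop by (simp add: inf_def crossing_def)
  have xe: "x e \<noteq> 0" using w(3) .
  show ?thesis
  proof (cases "\<exists>U \<in> covs K P. U e = 0 \<and> U g \<noteq> 0")
    case True
    then obtain U where U: "U \<in> covs K P" "U e = 0" "U g \<noteq> 0" by blast
    have eg: "V = foot x \<or> V = - foot x" if "V \<in> covs K P" "V e = 0" "V g = 0" "V \<noteq> zero_vec" for V
      using unique[OF inP(1) xe U that inP(4) r(3) A(1) r(6)] .
    have "foot Z = foot x \<or> foot Z = - foot x" using eg[OF inP(6) rZ(3) foot_Z_g rZ(6)] .
    moreover have "foot Z \<noteq> - foot x"
    proof
      assume a: "foot Z = - foot x"
      then have "foot Z f = - \<nu>" using A by simp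
      then have "Z f = - \<nu>" using foot_Z_f \<nu> by auto
      then show False using Zf \<nu> by auto
    qed
    ultimately have ZA: "foot Z = foot x" by blast
    then have "\<alpha> * Z e = \<alpha> * x e" using rZ(4) r(4) by simp
    then have Ze: "Z e = x e" by simp
    then have yx: "y e = x e" using vsum_same[OF s(5), of e] by simp
    show ?thesis
    proof (rule ccontr)
      assume "\<not> inf \<nu> y"
      then have ne: "foot y \<noteq> foot x" using same_foot yx xe by auto
      have "foot x c2 \<noteq> 0" using foot_x_c2 ne yx xe by simp
      then have "x c2 = foot x c2" "Z c2 = foot x c2"
        using off_leD[OF r(5) c2(3)] off_leD[OF rZ(5) c2(3)] ZA by auto
      then have "y c2 = x c2" using vsum_same[OF s(5), of c2] by simp
      then show False using c2 by simp
    qed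
  next
    case False
    then have g0: "\<And>U. U \<in> covs K P \<Longrightarrow> U e = 0 \<Longrightarrow> U g = 0" by blast
    have ye0: "y e \<noteq> 0" using g0[OF inP(2)] s(7) by auto
    have yx: "y e = x e" using ye ye0 by blast
    have Bg: "foot y g = 0" using g0[OF inP(5) ry(3)] .
    have Ze: "Z e = 0"
    proof (rule ccontr)
      assume Ze: "Z e \<noteq> 0"
      obtain Q where Q: "Q \<in> covs K P" "Q e = 0" "Q \<noteq> zero_vec" "Q p = 0" using Q by blast
      from unique[OF inP(1) xg inP(3) s(8) Ze inP(4) A(1) r(3) r(6) Q(1) g0[OF Q(1,2)] Q(2,3)]
      show False using w(7) Q(4) by auto
    qed
    show ?thesis
    proof (cases "foot y = foot x")
      case True then show ?thesis using same_foot ye0 by blast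
    next
      case ne: False
      have l: "rank_le K 2 (P - {e})" using line[OF inP(1) xe] .
      note m = in_diff[OF inP(4) r(3)] in_diff[OF inP(5) ry(3)] in_diff[OF inP(3) Ze]
      have pp: "foot x p = foot y p" using r(4) ry(4) yx by simp
      obtain C where C: "C \<in> covs K (P - {e})" "C p = 0" "C \<noteq> zero_vec" "vsum (foot x) C (foot y)"
        using K.line_diff[OF m(1,2) pp w(7)] ne by auto
      have "C c1 = Z c1" using vsum_l0[OF C(4) c1(4)] foot_y_c1[OF ne] c1(5) by simp
      moreover have "C c1 \<noteq> 0" using calculation c1(2,5) by simp
      ultimately have "C = Z" by (rule K.line_eq[OF l m(1) w(7) C(1) m(3) C(2) Zp])
      then have v: "vsum (foot x) Z (foot y)" using C(4) by simp
      have "Z f = 0 \<or> Z f = \<nu>" using Zf \<nu> signsD[OF s(17), of f] by auto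
      then have "foot y f = \<nu>" using vsum_r0[OF v, of f] vsum_same[OF v, of f] A(2) by auto
      then show ?thesis using Bg yprop ye0 by (simp add: inf_def crossing_def)
    qed
  qed
qed

end

section \<open>Euclideanness of lexicographic extensions\<close>

lemma conformal_sym: "conformal x y \<longleftrightarrow> conformal y x"
  unfolding conformal_def sep_def by (auto simp: equation_minus_iff)

lemma conformalD: "conformal x y \<Longrightarrow> x h = - y h \<Longrightarrow> x h = 0"
  by (auto simp: conformal_def sep_def)

context near_program
begin

lemma planeI: "step K g x Z y \<Longrightarrow> crossing x \<Longrightarrow> y p = 0 \<Longrightarrow> conformal x y \<Longrightarrow> plane E K N p e \<alpha> g f x Z y"
proof (intro plane.intro near_program_axioms plane_axioms.intro)
  assume a: "step K g x Z y" "crossing x" "conformal x y"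
  show "y e = x e" if "y e \<noteq> 0"
    using conformalD[OF a(3), of e] that crossing_close(3)[OF a(2)] signsD[OF K.step_covs(15)[OF a(1)], of e] signsD[OF K.step_covs(16)[OF a(1)], of e]
    by auto
qed

lemma fin_or_null:
  assumes "crossing x" "x g = 1" "\<And>\<nu>. \<nu> \<noteq> 0 \<Longrightarrow> \<not> inf \<nu> x" shows "fin x \<or> null x"
proof -
  have "foot x g = 0 \<or> foot x g = 1"
    using off_leD[OF foot_close(5)[OF crossing_close(1,2)[OF assms(1)]] g] assms(2) by auto
  then show ?thesis using assms by (auto simp: fin_def null_def inf_def)
qed

lemma compat_crossing:
  assumes st: "step K g x Z y" and cf: "conformal x y" and t: "crossing x"
    and ni: "\<And>\<nu>. \<nu> \<noteq> 0 \<Longrightarrow> \<not> inf \<nu> x \<and> \<not> inf \<nu> y"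
  shows "compat x Z y"
proof (cases "y p = 0")
  case False
  then show ?thesis using compat_line[OF st t] fin_or_null[OF t K.step_covs(6)[OF st]] ni by blast
next
  case True
  interpret plane E K N p e \<alpha> g f x Z y by (rule planeI[OF st t True cf])
  have fx: "fin x \<or> null x" using fin_or_null[OF t s(6)] ni by blast
  show ?thesis
  proof (cases "y e = 0")
    case True
    then show ?thesis using fx compat_fin_zero compat_null_zero by blast
  next
    case False
    then have ty: "crossing y" using s(13) yp by (simp add: crossing_def)
    have fy: "fin y \<or> null y" using fin_or_null[OF ty s(7)] ni by blast
    show ?thesis
    proof (cases "null y \<and> fin x")
      case False
      then show ?thesis using fx fy compat_fin_fin compat_null_fin compat_null_null by blast
    next
      case nf: True
      have cf': "conformal y x" using cf conformal_sym by blast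
      interpret rev: plane E K N p e \<alpha> g f y "- Z" x
        by (rule planeI[OF K.step_rev[OF st] ty crossing_close(2)[OF t] cf'])
      show ?thesis using compat_rev[OF rev.compat_null_fin] nf by simp
    qed
  qed
qed

lemma compat_edge:
  assumes st: "step K g x Z y" and cf: "conformal x y" and ni: "\<And>\<nu>. \<nu> \<noteq> 0 \<Longrightarrow> \<not> inf \<nu> x \<and> \<not> inf \<nu> y"
  shows "compat x Z y"
proof -
  note s = K.step_covs[OF st]
  consider "crossing x" | "crossing y" | "inherited x" "inherited y" using not_inherited s(12,13) by blast
  then show ?thesis
  proof cases
    case 1 then show ?thesis using compat_crossing[OF st cf] ni by blast
  next
    case 2
    have "conformal y x" using cf conformal_sym by blast
    from compat_crossing[OF K.step_rev[OF st] this 2] ni have "compat y (- Z) x" by blast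
    from compat_rev[OF this] show ?thesis by simp
  next
    case 3
    have stN: "step N g (shadow x) (lift Z) (shadow y)" using step_transfer[OF st 3 g] shadow_inherited 3 by simp
    show ?thesis
      by (rule goodI[OF _ stN]) (use lift_close(2)[OF step_inherited[OF st 3 g] f] shadow_inherited 3 in auto)
  qed
qed

lemma inf_edge:
  assumes st: "step K g x Z y" and cf: "conformal x y" and i: "inf \<nu> x" and \<nu>: "\<nu> = 1 \<or> \<nu> = -1" and Zf: "0 \<le> \<nu> * Z f"
  shows "inf \<nu> y"
proof (cases "y p = 0")
  case True
  have "crossing x" using i by (simp add: inf_def)
  interpret plane E K N p e \<alpha> g f x Z y by (rule planeI[OF st \<open>crossing x\<close> True cf])
  show ?thesis using inf_plane[OF i \<nu> Zf] .
next
  case False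
  \<comment> \<open>This case is contradictory: the direction would be \<open>foot x\<close>, giving
    \<open>y\<close> the wrong sign at \<open>p\<close>.\<close>
  have t: "crossing x" and A: "foot x g = 0" "foot x f = \<nu>" using i by (auto simp: inf_def)
  note s = K.step_covs[OF st] and w = crossing_close[OF t] and r = foot_close[OF crossing_close(1,2)[OF t]]
  have xg: "x g \<noteq> 0" using s(6) by simp
  have "insert p (supp x) \<subseteq> supp x \<union> supp y" using False by (auto simp: supp_def)
  from covs_mono[OF this foot_line(2)[OF w(1-3)]] have rS: "foot x \<in> covs K (supp x \<union> supp y)" .
  have "Z = foot x \<or> Z = - foot x" using K.line_unique[OF s(4) s(1) xg s(3) rS s(8) A(1) s(11) r(6)] .
  then have ZA: "Z = foot x" using Zf A(2) \<nu> by auto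
  have "y p = - (\<alpha> * x e)" using vsum_l0[OF s(5) w(2)] ZA r(4) by simp
  moreover have "y e = x e" using vsum_r0[OF s(5), of e] ZA r(3) by simp
  moreover have "y e = 0 \<or> y p = \<alpha> * y e" using inherited_p[OF s(13) False] by (simp add: inherited_def)
  ultimately show ?thesis using w(3) by auto
qed

text \<open>A common slope zero ends the argument. A nonzero one forces all vertices to be
  \<open>fin\<close> and on one side of \<open>e\<close>, so that the feet and the scaled escape
  directions are vertices of fixed programs for the later tie-breaks.\<close>

lemma no_strict_without_inf:
  assumes N: "\<And>g f. acyc N g f" and R: "strongly_connected R"
    and edge: "\<And>x y. (x, y) \<in> R \<Longrightarrow> \<exists>z. step K g x z y \<and> conformal x y \<and> 0 \<le> z f"
    and ni: "\<And>x y \<nu>. (x, y) \<in> R \<Longrightarrow> \<nu> \<noteq> 0 \<Longrightarrow> \<not> inf \<nu> x \<and> \<not> inf \<nu> y"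
    and x0: "(x0, y0) \<in> R" "step K g x0 z0 y0" "0 \<le> z0 f"
  shows "z0 f = 0"
proof -
  have cf: "conformal x y" if "(x, y) \<in> R" for x y using edge[OF that] by blast
  have gd: "compat x z y" if "(x, y) \<in> R" "step K g x z y" for x y z
    using compat_edge[OF that(2) cf[OF that(1)]] ni[OF that(1)] by blast
  have sub: "(wz k)\<^sup>* \<subseteq> (wk N g f 1)\<^sup>*" if "0 \<le> k" for k
    by (rule rtrancl_mono) (use that in \<open>auto simp: wz_def wk_def\<close>)
  have path: "(shadow x, shadow y) \<in> (wk N g f 1)\<^sup>*" if xy: "(x, y) \<in> R" for x y
  proof -
    obtain z where "step K g x z y" "0 \<le> z f" using edge[OF xy] by blast
    then show ?thesis using gd[OF xy] sub[of "z f"] by (auto simp: compat_def)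
  qed
  have tie: "z f = 0" if "(x, y) \<in> R" "(shadow x, u) \<in> (wk N g f 1)\<^sup>*" "step N g u z v" "(v, shadow y) \<in> (wk N g f 1)\<^sup>*" "0 \<le> z f"
    for x y u v z
    by (rule N.acyc_tie[where \<tau> = 1 and f = f and Z = z and \<phi> = shadow, OF N R _ path that(1-4)]) (use that(5) in auto)
  have sc: "slope_compat (z f) (slope x) (slope y)" if h: "(x, y) \<in> R" "step K g x z y" "0 \<le> z f" for x y z
  proof -
    have "\<not> spath (z f) (shadow x) (shadow y)"
    proof
      assume "spath (z f) (shadow x) (shadow y)"
      then obtain u v Z' where "z f \<noteq> 0" "(shadow x, u) \<in> (wz (z f))\<^sup>*" "step N g u Z' v" "Z' f = z f" "(v, shadow y) \<in> (wz (z f))\<^sup>*"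
        unfolding spath_def by blast
      then show False using tie[OF h(1), of u Z' v] sub[OF h(3)] h(3) by auto
    qed
    then show ?thesis using gd[OF h(1,2)] by (simp add: compat_def)
  qed
  have slope_eq: "slope x = slope y" if xy: "(x, y) \<in> R" for x y
  proof (rule strongly_connected_mono[OF R _ xy, where q = slope])
    fix x y assume xy: "(x, y) \<in> R"
    obtain z where "step K g x z y" "0 \<le> z f" using edge[OF xy] by blast
    then show "slope x \<le> slope y" using sc[OF xy] by (auto simp: slope_compat_def)
  qed
  define s where "s = slope x0"
  have slope_const: "slope x = s" "slope y = s" if "(x, y) \<in> R" for x y
    unfolding s_def using strongly_connected_const[where q = slope and R = R, OF R _ x0(1) that] slope_eq by blast+
  show ?thesis
  proof (cases "s = 0")
    case True
    then show ?thesis using sc[OF x0] slope_const[OF x0(1)] by (simp add: slope_compat_def)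
  next
    case s0: False
    have fin: "fin x" "fin y" if "(x, y) \<in> R" for x y
      using slope_const[OF that] s0 by (auto simp: slope_def split: if_splits)
    have pl: "plane E K N p e \<alpha> g f x z y" if "(x, y) \<in> R" "step K g x z y" for x y z
      using planeI[OF that(2) _ _ cf[OF that(1)]] fin[OF that(1)] crossing_close(2) by (auto simp: fin_def)
    define \<epsilon> where "\<epsilon> = x0 e"
    have e_eq: "x e = y e" if xy: "(x, y) \<in> R" for x y
    proof -
      obtain z where z: "step K g x z y" using edge[OF xy] by blast
      interpret plane E K N p e \<alpha> g f x z y by (rule pl[OF xy z])
      show ?thesis using ye fin(2)[OF xy] crossing_close(3) by (metis fin_def)
    qed
    have \<epsilon>c: "x e = \<epsilon>" "y e = \<epsilon>" if "(x, y) \<in> R" for x y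
      unfolding \<epsilon>_def using strongly_connected_const[where q = "\<lambda>x. x e" and R = R, OF R _ x0(1) that] e_eq by blast+
    have t10: "crossing x0" using fin[OF x0(1)] by (simp add: fin_def)
    have \<epsilon>: "\<epsilon> = 1 \<or> \<epsilon> = -1"
      using crossing_close(3)[OF t10] signsD[OF K.covector_signs[OF crossing_close(4)[OF t10]], of e] by (auto simp: \<epsilon>_def)
    have s1: "s = 1 \<or> s = -1"
      using s0 signsD[OF K.covs_signs[OF escape_close(1)[OF fin(1)[OF x0(1)]]], of f] fin[OF x0(1)] by (auto simp: s_def slope_def)
    \<comment> \<open>\<open>\<kappa>\<close> combines \<open>obj_formula\<close> with
      \<open>foot z p = - (\<alpha> * z e)\<close>.\<close>
    define \<kappa> where "\<kappa> = - (s * \<epsilon> * \<alpha>)"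
    have \<kappa>: "\<kappa> = 1 \<or> \<kappa> = -1" using \<epsilon> s1 \<alpha> by (auto simp: \<kappa>_def)
    have val: "z f = \<kappa> * foot z p" if h: "(x, y) \<in> R" "step K g x z y" "foot z f = 0" for x y z
    proof -
      interpret plane E K N p e \<alpha> g f x z y by (rule pl[OF h(1,2)])
      have "z f = s * \<epsilon> * z e" using obj_formula[OF fin(1)[OF h(1)] h(3)] slope_const[OF h(1)] \<epsilon>c[OF h(1)] by simp
      moreover have "z e = - (\<alpha> * foot z p)" using rZ(4) by simp
      ultimately show ?thesis by (simp add: \<kappa>_def)
    qed
    have pos: "0 \<le> foot z f" if h: "(x, y) \<in> R" "step K g x z y" "0 \<le> z f" for x y z
    proof -
      interpret plane E K N p e \<alpha> g f x z y by (rule pl[OF h(1,2)])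
      show ?thesis using foot_Z_f h(3) by auto
    qed
    have rsum: "step K g (foot x) (foot z) (foot y) \<and> foot z f = 0"
      if h: "(x, y) \<in> R" "step K g x z y" "0 \<le> z f" "foot x \<noteq> foot y" for x y z
    proof -
      interpret plane E K N p e \<alpha> g f x z y by (rule pl[OF h(1,2)])
      note fx = fin[OF h(1)]
      have st: "step K g (foot x) (foot z) (foot y)" "step N g (foot x) (foot z) (foot y)"
        using foot_sum h(4) fx by (auto simp: fin_def)
      have "step N g (shadow x) (foot z) (shadow y)" using st(2) fx by (simp add: shadow_def)
      then have "foot z f = 0" using tie[OF h(1), of "shadow x" "foot z" "shadow y"] pos[OF h(1-3)] by simp
      then show ?thesis using st by simp
    qed
    have p0: "foot z p = 0" if h: "(x, y) \<in> R" "step K g x z y" "0 \<le> z f" "foot x \<noteq> foot y" for x y z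
    proof (rule K.acyc_tie1[where \<phi> = foot and Z = "foot z" and f = p, OF acyc_new_objective[OF N g] R \<kappa> _ h(1)])
      show "step K g (foot x) (foot z) (foot y)" using rsum[OF h] by blast
      show "0 \<le> \<kappa> * foot z p" using val[OF h(1,2)] rsum[OF h] h(3) by simp
      fix x y assume xy: "(x, y) \<in> R"
      obtain z where z: "step K g x z y" "0 \<le> z f" using edge[OF xy] by blast
      show "foot x = foot y \<or> (\<exists>Z. step K g (foot x) Z (foot y) \<and> 0 \<le> \<kappa> * Z p)"
        using rsum[OF xy z] val[OF xy z(1)] z(2) by auto
    qed
    have ep: "e \<noteq> p" using pe by simp
    \<comment> \<open>All escape directions have value \<open>\<epsilon>\<close> at
      \<open>e\<close>; scaled, they are vertices of the program with \<open>e\<close> at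
      infinity.\<close>
    define q where "q x = scale \<epsilon> (escape x)" for x
    \<comment> \<open>For different feet \<open>\<sigma>\<close> is unknown, but then
      \<open>foot z\<close> is already a tie for \<open>f\<close> and for \<open>p\<close>.\<close>
    have zstep: "\<exists>\<sigma>. (\<sigma> = 1 \<or> \<sigma> = -1) \<and> (foot x = foot y \<longrightarrow> \<sigma> = 1) \<and> step K e (q x) (scale \<epsilon> (scale \<sigma> (foot z))) (q y)"
      if h: "(x, y) \<in> R" "step K g x z y" "escape x \<noteq> escape y" for x y z
    proof -
      interpret plane E K N p e \<alpha> g f x z y by (rule pl[OF h(1,2)])
      note fx = fin[OF h(1)]
      note zx = escape_close[OF fx(1)] and zy = escape_close[OF fx(2)]
      have l: "rank_le K 2 (P - {g})" using line[OF inP(1) xg] .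
      note m = in_diff[OF escape_P(1)[OF fx(1)] zx(2)] in_diff[OF escape_P(2)[OF fx(2)] zy(2)] in_diff[OF inP(6) foot_Z_g]
      obtain \<sigma> where \<sigma>: "\<sigma> = 1 \<or> \<sigma> = -1" "foot x = foot y \<longrightarrow> \<sigma> = 1" "vsum (escape x) (scale \<sigma> (foot z)) (escape y)"
      proof (cases "foot x = foot y")
        case True
        then show ?thesis using that[of 1] escape_sum(1)[OF fx True] by (simp add: scale_one)
      next
        case False
        then show ?thesis
          using that[of 1] that[of "-1"] escape_sum(2)[OF fx h(3)] by (auto simp: scale_one scale_minus_one)
      qed
      have m3: "scale \<sigma> (foot z) \<in> covs K (P - {g})"
        using \<sigma>(1) m(3) K.covs_neg by (auto simp: scale_one scale_minus_one)
      have ee: "escape x e = \<epsilon>" "escape y e = \<epsilon>" "scale \<sigma> (foot z) e = 0" using zx(5) zy(5) \<epsilon>c[OF h(1)] rZ(3) by auto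
      from K.step_scaleI[OF l m(1,2) m3 zx(7) zy(7) ee(1,2) \<epsilon> ee(3) \<sigma>(3) h(3)] \<sigma> show ?thesis
        unfolding q_def by blast
    qed
    have tq: "inherited (q x)" "inherited (q y)" if "(x, y) \<in> R" for x y
      using fin[OF that] escape_close(8) inherited_scale \<epsilon> by (auto simp: q_def)
    have zf: "foot z f = 0" if h: "(x, y) \<in> R" "step K g x z y" "0 \<le> z f" for x y z
    proof (cases "foot x = foot y")
      case False then show ?thesis using rsum[OF h] by blast
    next
      case True
      have edgeN: "\<exists>Z. step N e (lift (q x)) Z (lift (q y)) \<and> 0 \<le> \<epsilon> * Z f \<and> (foot x = foot y \<longrightarrow> Z f = \<epsilon> * foot z f)"
        if h: "(x, y) \<in> R" "step K g x z y" "0 \<le> z f" "escape x \<noteq> escape y" for x y z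
      proof -
        obtain \<sigma> where \<sigma>: "\<sigma> = 1 \<or> \<sigma> = -1" "foot x = foot y \<longrightarrow> \<sigma> = 1" "step K e (q x) (scale \<epsilon> (scale \<sigma> (foot z))) (q y)"
          using zstep[OF h(1,2,4)] by blast
        let ?Z = "lift (scale \<epsilon> (scale \<sigma> (foot z)))"
        have v: "?Z f = \<epsilon> * (\<sigma> * foot z f)"
          using lift_close(2)[OF step_inherited[OF \<sigma>(3) tq[OF h(1)] ep] f] by simp
        have "0 \<le> \<sigma> * foot z f" using \<sigma>(2) rsum[OF h(1-3)] pos[OF h(1-3)] by (cases "foot x = foot y") auto
        then have "0 \<le> \<epsilon> * ?Z f" using v \<epsilon> by auto
        then show ?thesis using step_transfer[OF \<sigma>(3) tq[OF h(1)] ep] v \<sigma>(2) by auto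
      qed
      interpret plane E K N p e \<alpha> g f x z y by (rule pl[OF h(1,2)])
      have ne: "escape x \<noteq> escape y" using escape_sum(1)[OF fin[OF h(1)] True] by blast
      obtain Z where Z: "step N e (lift (q x)) Z (lift (q y))" "0 \<le> \<epsilon> * Z f" "Z f = \<epsilon> * foot z f"
        using edgeN[OF h ne] True by blast
      have "Z f = 0"
      proof (rule N.acyc_tie1[where \<phi> = "\<lambda>x. lift (q x)" and Z = Z and f = f, OF N R \<epsilon> _ h(1) Z(1,2)])
        fix x y assume xy: "(x, y) \<in> R"
        obtain z where z: "step K g x z y" "0 \<le> z f" using edge[OF xy] by blast
        show "lift (q x) = lift (q y) \<or> (\<exists>Z. step N e (lift (q x)) Z (lift (q y)) \<and> 0 \<le> \<epsilon> * Z f)"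
          using edgeN[OF xy z] by (cases "escape x = escape y") (auto simp: q_def)
      qed
      then show ?thesis using Z(3) \<epsilon> by auto
    qed
    have "foot z0 p = 0"
    proof (cases "foot x0 = foot y0")
      case False then show ?thesis using p0[OF x0] by blast
    next
      case True
      have edgeK: "\<exists>Z. step K e (q x) Z (q y) \<and> 0 \<le> (\<kappa> * \<epsilon>) * Z p \<and> (foot x = foot y \<longrightarrow> Z p = \<epsilon> * foot z p)"
        if h: "(x, y) \<in> R" "step K g x z y" "0 \<le> z f" "escape x \<noteq> escape y" for x y z
      proof -
        obtain \<sigma> where \<sigma>: "\<sigma> = 1 \<or> \<sigma> = -1" "foot x = foot y \<longrightarrow> \<sigma> = 1" "step K e (q x) (scale \<epsilon> (scale \<sigma> (foot z))) (q y)"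
          using zstep[OF h(1,2,4)] by blast
        let ?Z = "scale \<epsilon> (scale \<sigma> (foot z))"
        have "0 \<le> \<kappa> * (\<sigma> * foot z p)"
          using \<sigma>(2) p0[OF h(1-3)] val[OF h(1,2) zf[OF h(1-3)]] h(3) by (cases "foot x = foot y") auto
        then have "0 \<le> (\<kappa> * \<epsilon>) * ?Z p" using \<epsilon> by auto
        then show ?thesis using \<sigma> by (intro exI[of _ ?Z]) auto
      qed
      interpret plane E K N p e \<alpha> g f x0 z0 y0 by (rule pl[OF x0(1,2)])
      have ne: "escape x0 \<noteq> escape y0" using escape_sum(1)[OF fin[OF x0(1)] True] by blast
      obtain Z where Z: "step K e (q x0) Z (q y0)" "0 \<le> (\<kappa> * \<epsilon>) * Z p" "Z p = \<epsilon> * foot z0 p"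
        using edgeK[OF x0 ne] True by blast
      have \<tau>: "\<kappa> * \<epsilon> = 1 \<or> \<kappa> * \<epsilon> = -1" using \<kappa> \<epsilon> by auto
      have "Z p = 0"
      proof (rule K.acyc_tie1[where \<phi> = q and Z = Z and f = p, OF acyc_new_objective[OF N ep] R \<tau> _ x0(1) Z(1,2)])
        fix x y assume xy: "(x, y) \<in> R"
        obtain z where z: "step K g x z y" "0 \<le> z f" using edge[OF xy] by blast
        show "q x = q y \<or> (\<exists>Z. step K e (q x) Z (q y) \<and> 0 \<le> (\<kappa> * \<epsilon>) * Z p)"
          using edgeK[OF xy z] by (cases "escape x = escape y") (auto simp: q_def)
      qed
      then show ?thesis using Z(3) \<epsilon> by auto
    qed
    then show ?thesis using val[OF x0(1,2) zf[OF x0]] by simp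
  qed
qed

end

text \<open>\<open>V\<close> is the direction in the chart of \<open>f\<close>. The difference of
  \<open>Z\<close> and \<open>V\<close> vanishes at \<open>d\<close>, as \<open>x\<close> does, so
  it is \<open>x\<close> up to sign; its values at \<open>g\<close> and \<open>f\<close> relate
  \<open>V g\<close> to \<open>Z f\<close>. Reversing the edge absorbs the minus sign.\<close>

lemma (in oriented_matroid) step_swap:
  assumes st: "step L g x Z y" and xf: "x f = \<nu>" "y f = \<nu>" and \<nu>: "\<nu> = 1 \<or> \<nu> = -1"
  shows "\<exists>Z'. step L f (scale \<nu> y) Z' (scale \<nu> x) \<and> Z' g = Z f"
proof -
  let ?S = "supp x \<union> supp y"
  note s = step_covs[OF st]
  have xf0: "x f \<noteq> 0" "x g \<noteq> 0" using xf \<nu> s(6) by auto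
  obtain V where V: "V \<in> covs L ?S" "V f = 0" "V \<noteq> zero_vec" "vsum x V y"
    using line_diff[OF s(1,2) _ xf0(1) s(9)] xf by auto
  have vrev: "vsum y (- V) x" using vsum_rev[OF s(15,16) covs_signs[OF V(1)] V(4)] .
  have yx: "y \<noteq> x" using s(9) by simp
  have nV: "- V \<in> covs L ?S" "(- V) f = 0" using V covs_neg by auto
  have step': "step L f (scale \<nu> y) (scale \<nu> (- V)) (scale \<nu> x)"
    using step_scaleI[OF s(4) s(2,1) nV(1) s(13,12) xf(2,1) \<nu> nV(2) vrev yx] .
  obtain d where d: "x d = 0" "y d \<noteq> 0" using cocircuit_zero[OF s(12,13,9,10)] by blast
  have Zd: "Z d = y d" "V d = y d" using vsum_l0[OF s(5) d(1)] vsum_l0[OF V(4) d(1)] by auto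
  have "V g = - (\<nu> * Z f)"
  proof (cases "Z = V")
    case True
    then show ?thesis using s(8) V(2) by simp
  next
    case False
    have "V d = Z d" "V d \<noteq> 0" using Zd d by auto
    then obtain U where U: "U \<in> covs L ?S" "U d = 0" "U \<noteq> zero_vec" "vsum V U Z"
      using line_diff[OF V(1) s(3)] False by metis
    have Ux: "U = x \<or> U = - x"
      using line_unique[OF s(4) s(2) d(2) U(1) s(1) U(2) d(1) U(3) cocircuit_nonzero[OF s(12)]] .
    have Zf: "Z f = U f" using vsum_l0[OF U(4) V(2)] .
    have Vg: "V g = - U g" using vsum_zero[OF covs_signs[OF V(1)] covs_signs[OF U(1)] U(4) s(8)] .
    from Ux show ?thesis using Zf Vg xf s(6) \<nu> by auto
  qed
  then have "scale \<nu> (- V) g = Z f" using \<nu> by auto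
  then show ?thesis using step' by blast
qed

context near_program
begin

lemma cacyc_old:
  assumes N: "\<And>g f. acyc N g f"
  shows "cacyc K g f"
  unfolding cacyc_def
proof (intro allI impI notI)
  fix X0 Z0 Y0 assume st0: "step K g X0 Z0 Y0" "conformal X0 Y0" "0 < Z0 f" "(Y0, X0) \<in> (cwk K g f)\<^sup>*"
  have "(X0, Y0) \<in> cwk K g f" using st0 by (auto simp: cwk_def)
  then obtain R where R: "strongly_connected R" "(X0, Y0) \<in> R" "R \<subseteq> cwk K g f"
    using strongly_connected_component st0(4) by metis
  have edge: "\<exists>z. step K g x z y \<and> conformal x y \<and> 0 \<le> z f" if "(x, y) \<in> R" for x y
    using R(3) that by (auto simp: cwk_def)
  \<comment> \<open>Forward edges preserve \<open>inf 1\<close> and, read backwards,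
    \<open>inf (-1)\<close>; hence \<open>lev\<close> is monotone.\<close>
  define lev :: "'a signvec \<Rightarrow> int" where "lev x = (if inf 1 x then 1 else if inf (-1) x then -1 else 0)" for x
  have lev_eq: "lev x = lev y" if xy: "(x, y) \<in> R" for x y
  proof (rule strongly_connected_mono[OF R(1) _ xy, where q = lev])
    fix x y assume "(x, y) \<in> R"
    then obtain z where z: "step K g x z y" "conformal x y" "0 \<le> z f" using edge by blast
    have cf: "conformal y x" using z(2) conformal_sym by blast
    have "inf 1 x \<Longrightarrow> inf 1 y" using inf_edge[OF z(1,2)] z(3) by simp
    moreover have "inf (-1) y \<Longrightarrow> inf (-1) x" using inf_edge[OF K.step_rev[OF z(1)] cf] z(3) by simp
    ultimately show "lev x \<le> lev y" by (simp add: lev_def)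
  qed
  define \<nu> where "\<nu> = lev X0"
  have lev_const: "lev x = \<nu>" "lev y = \<nu>" if "(x, y) \<in> R" for x y
    unfolding \<nu>_def using strongly_connected_const[where q = lev and R = R, OF R(1) _ R(2) that] lev_eq by blast+
  have "Z0 f = 0"
  proof (cases "\<nu> = 0")
    case True
    have noinf: "\<not> inf \<mu> x" if l: "lev x = 0" and m: "\<mu> \<noteq> 0" for x \<mu>
    proof
      assume i: "inf \<mu> x"
      then have "crossing x" by (simp add: inf_def)
      note t = crossing_close[OF this]
      have "\<mu> = 1 \<or> \<mu> = -1"
        using i m signsD[OF K.covector_signs[OF foot_close(2)[OF t(1,2)]], of f] by (auto simp: inf_def)
      then show False using i l by (auto simp: lev_def split: if_splits)
    qed
    show ?thesis
      by (rule no_strict_without_inf[OF N R(1) edge _ R(2) st0(1)])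
        (use noinf lev_const True st0(3) in auto)
  next
    case False
    then have \<nu>: "\<nu> = 1 \<or> \<nu> = -1" by (auto simp: \<nu>_def lev_def split: if_splits)
    have i: "inf \<nu> x" if "lev x = \<nu>" for x using that False \<nu> by (auto simp: lev_def split: if_splits)
    have xf: "x f = \<nu>" if "inf \<nu> x" for x
    proof -
      have t: "crossing x" "foot x f = \<nu>" using that by (auto simp: inf_def)
      show ?thesis using off_leD[OF foot_close(5)[OF crossing_close(1,2)[OF t(1)]] f] t(2) False by auto
    qed
    \<comment> \<open>All vertices are close to infinity; exchanging the roles of \<open>g\<close> and \<open>f\<close> moves them away from it.\<close>
    interpret sw: near_program E K N p e \<alpha> f g by unfold_locales (use f g in auto)
    define R' where "R' = (\<lambda>(x, y). (scale \<nu> y, scale \<nu> x)) ` R"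
    have sw: "\<exists>Z'. step K f (scale \<nu> y) Z' (scale \<nu> x) \<and> Z' g = z f" if "(x, y) \<in> R" "step K g x z y" for x y z
      using K.step_swap[OF that(2) _ _ \<nu>] xf i lev_const[OF that(1)] by blast
    have R'star: "(scale \<nu> b, scale \<nu> a) \<in> R'\<^sup>*" if "(a, b) \<in> R\<^sup>*" for a b
      using that
    proof induction
      case (step y z)
      then have "(scale \<nu> z, scale \<nu> y) \<in> R'" by (force simp: R'_def)
      then show ?case using step.IH by (meson converse_rtrancl_into_rtrancl)
    qed simp
    have scR': "strongly_connected R'"
      unfolding strongly_connected_def
    proof (intro ballI, clarify)
      fix a b c d assume "(a, b) \<in> R'" "(c, d) \<in> R'"
      then obtain x y u v where xy: "(x, y) \<in> R" "a = scale \<nu> y" "b = scale \<nu> x" and uv: "(u, v) \<in> R" "c = scale \<nu> v" "d = scale \<nu> u"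
        by (auto simp: R'_def)
      have "(v, x) \<in> R\<^sup>*" using R(1) xy uv by (fastforce simp: strongly_connected_def)
      then show "(b, c) \<in> R'\<^sup>*" using R'star xy uv by blast
    qed
    have edge': "\<exists>z. step K f x z y \<and> conformal x y \<and> 0 \<le> z g" if xy: "(x, y) \<in> R'" for x y
    proof -
      obtain u v where uv: "(u, v) \<in> R" "x = scale \<nu> v" "y = scale \<nu> u" using xy by (auto simp: R'_def)
      obtain z where z: "step K g u z v" "conformal u v" "0 \<le> z f" using edge[OF uv(1)] by blast
      have "sep (scale \<nu> v) (scale \<nu> u) = sep v u" using \<nu> 
        by (elim disjE) (simp_all add: sep_def, metis add.inverse_inverse)
      then have "conformal x y" using z(2) uv(2,3) conformal_sym[of u v] by (simp add: conformal_def)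
      then show ?thesis using sw[OF uv(1) z(1)] z(3) uv by auto
    qed
    \<comment> \<open>\<open>foot x\<close> is nonzero at \<open>f\<close>, hence a finite point
      once \<open>f\<close> is at infinity.\<close>
    have noinf: "\<not> sw.inf \<mu> (scale \<nu> x)" if "inf \<nu> x" for x \<mu>
    proof
      assume a: "sw.inf \<mu> (scale \<nu> x)"
      have t: "crossing x" "foot x f = \<nu>" using that by (auto simp: inf_def)
      have "foot (scale \<nu> x) = scale \<nu> (foot x)"
        using \<nu> foot_neg[OF crossing_close(1,2)[OF t(1)]] by (auto simp: scale_one scale_minus_one)
      then show False using a t(2) \<nu> by (auto simp: sw.inf_def)
    qed
    have ni': "\<not> sw.inf \<mu> x \<and> \<not> sw.inf \<mu> y" if xy: "(x, y) \<in> R'" for x y \<mu>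
    proof -
      obtain u v where uv: "(u, v) \<in> R" "x = scale \<nu> v" "y = scale \<nu> u" using xy by (auto simp: R'_def)
      then show ?thesis using noinf i lev_const[OF uv(1)] by blast
    qed
    obtain Z' where Z': "step K f (scale \<nu> Y0) Z' (scale \<nu> X0)" "Z' g = Z0 f" using sw[OF R(2) st0(1)] by blast
    have "(scale \<nu> Y0, scale \<nu> X0) \<in> R'" using R(2) by (force simp: R'_def)
    from sw.no_strict_without_inf[OF N scR' edge' _ this Z'(1)] ni' Z'(2) st0(3) have "Z' g = 0" by auto
    then show ?thesis using Z'(2) by simp
  qed
  then show False using st0(3) by simp
qed

end

section \<open>Induction on the list\<close>

lemma (in near) euclidean_near:
  assumes "euclidean_om E N"
  shows "euclidean_om E K"
proof (rule euclidean_omI[OF K.oriented_matroid_axioms])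
  fix g f :: 'a assume gf: "g \<noteq> f"
  have N: "acyc N g f" for g f using N.acyc_if_euclidean_om[OF assms] .
  show "cacyc K g f"
  proof (cases "g = p \<or> f = p")
    case True
    then show ?thesis
      using acyc_new_objective[OF N] acyc_new_infinity[OF N] K.cacyc_if_acyc gf by metis
  next
    case False
    then interpret near_program E K N p e \<alpha> g f by unfold_locales auto
    show ?thesis using cacyc_old[OF N] .
  qed
qed

lemma euclidean_lex_ext:
  assumes "euclidean_om E L" "lex_data E L es p"
  shows "euclidean_om (insert p E) (lex_ext es p L)"
  using assms(2)
proof (induction es)
  case Nil
  interpret D: lex_data E L "[]" p by fact
  \<comment> \<open>With the empty list \<open>p\<close> is a loop and the covectors do not
    change.\<close>
  have eq: "lex_ext [] p L = L"
  proof -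
    have "X(p := 0) \<in> L \<and> X p = 0 \<longleftrightarrow> X \<in> L" for X
      using D.at_p fun_upd_idem by metis
    then show ?thesis by (auto simp: lex_ext_def)
  qed
  show ?case
    using euclidean_omI[OF D.oriented_matroid_lex_ext] D.cacyc_if_acyc D.acyc_if_euclidean_om[OF assms(1)] eq by auto
next
  case (Cons ea es)
  obtain e \<alpha> where ea: "ea = (e, \<alpha>)" by (cases ea)
  interpret D: lex_data E L "ea # es" p by fact
  have "lex_data E L es p" using D.es_ground D.es_signs D.p_new by unfold_locales auto
  from Cons.IH[OF this] have IH: "euclidean_om (insert p E) (lex_ext es p L)" .
  interpret near "insert p E" "lex_ext (ea # es) p L" "lex_ext es p L" p e \<alpha>
    using near_lex_ext[of E L e \<alpha> es p] Cons.prems ea by simp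
  show ?case using euclidean_near[OF IH] .
qed

theorem theorem1p2:
  fixes E :: "'a set" and L L' :: "'a signvec set" and p :: 'a and es :: "('a \<times> int) list"
  assumes "oriented_matroid E L"
    and "euclidean_om E L"
    and "lexicographic_extension E L es p L'"
  shows "euclidean_om (insert p E) L'"
proof -
  have ext: "fst ` set es \<subseteq> E" "snd ` set es \<subseteq> {1, -1}" "p \<notin> E" "oriented_matroid (insert p E) L'"
    "om_deletion L' p = L" "\<not> om_coloop (insert p E) L' p"
    "\<And>Y. Y \<in> cocircuits L \<Longrightarrow> Y(p := lex_localization es Y) \<in> cocircuits L'"
    using assms(3) by (auto simp: lexicographic_extension_def extension_with_localization_def)
  interpret D: lex_data E L es p
    using assms(1) ext(1-3) by (intro lex_data.intro lex_data_axioms.intro)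
  have "L' = lex_ext es p L" using D.extension_is_lex_ext[OF ext(4-7)] .
  then show ?thesis using euclidean_lex_ext[OF assms(2) D.lex_data_axioms] by simp
qed

end
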